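(* Let $X$ be a Banach space and let $A:D(A)\subset X\to X$ and $B:D(B)\subset X\to X$ be closed, resolvent commuting linear operators which satisfy the analytic resolvent condition with exponents $p_A^*\in[1,\infty)$ and $p_B^*\in[1,\infty)$ respectively. Assume that there exists $\lambda_0\in\mathbb R$ such that for all $\lambda\ge\lambda_0$ the range $\mathrm R(\lambda-(A+B))$ is dense in $X$, and that $$\frac1{p_A^*}+\frac1{p_B^*}>1 .$$ Then $A+B:D(A)\cap D(B)\subset X\to X$ is closable and its closure $\overline{A+B}:D(\overline{A+B})\subset X\to X$ also satisfies the analytic resolvent condition, with any exponent $p^*\in(1,\infty)$ such that $$0<\frac1{p^*}<\frac1{p_A^*}+\frac1{p_B^*}-1\le1 .$$
   Context: For a linear operator $T$ on $X$: $\rho(T)$ is its resolvent set, $\mathrm R(T)=T(D(T))$ its range, and $T_0$ denotes the part of $T$ in $\overline{D(T)}$, i.e. the restriction of $T$ to $\{x\in D(T):Tx\in\overline{D(T)}\}$. $T$ is closable if it has a closed extension; $\overline T$ is then the smallest closed extension. Domains are not assumed dense. Resolvent commuting: $(\lambda-A)^{-1}(\mu-B)^{-1}=(\mu-B)^{-1}(\lambda-A)^{-1}$ for all $\lambda,\mu\in\rho(A)\cap\rho(B)$. Analytic resolvent condition for an operator $T$ with exponent $p^*\in[1,\infty)$: (a) $T_0$ generates a strongly continuous analytic semigroup of bounded linear operators on $\overline{D(T)}$; (b) there is $\omega_T\in\mathbb R$ with $(\omega_T,\infty)\subset\rho(T)$ and $\|(\lambda-T)^{-1}\|_{\mathcal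 L(X)}=\mathcal O(\lambda^{-1/p^*})$ as $\lambda\to\infty$. *)

theory Defs
  imports "HOL-Analysis.Analysis" "HOL-Library.Landau_Symbols"
begin

text \<open>Scalars are complex, as usual for analytic semigroups. The underlying real Banach space
  structure is the one given by restriction of scalars.\<close>

class cbanach = banach +
  fixes scaleC :: "complex \<Rightarrow> 'a \<Rightarrow> 'a"  (infixr "*\<^sub>C" 75)
  assumes scaleC_add_right: "a *\<^sub>C (x + y) = a *\<^sub>C x + a *\<^sub>C y"
    and scaleC_add_left: "(a + b) *\<^sub>C x = a *\<^sub>C x + b *\<^sub>C x"
    and scaleC_scaleC: "a *\<^sub>C (b *\<^sub>C x) = (a * b) *\<^sub>C x"
    and scaleC_of_real: "complex_of_real r *\<^sub>C x = r *\<^sub>R x"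
    and norm_scaleC: "norm (a *\<^sub>C x) = cmod a * norm x"

instantiation complex :: cbanach
begin
definition "scaleC = ((*) :: complex \<Rightarrow> complex \<Rightarrow> complex)"
instance
  by standard (auto simp: scaleC_complex_def algebra_simps scaleR_conv_of_real norm_mult)
end


text \<open>An unbounded operator \<open>T : D(T) \<subset> X \<rightarrow> X\<close> is represented by its graph, so \<open>D(T)\<close> is
  \<^const>\<open>Domain\<close> \<open>T\<close>, the range is \<^const>\<open>Range\<close> \<open>T\<close>, extension of operators is inclusion,
  and \<open>T\<close> is a closed operator iff \<open>T\<close> is a closed subset of the product space.\<close>

type_synonym 'a operator = "('a \<times> 'a) set"

definition linear_operator :: "'a::cbanach operator \<Rightarrow> bool" where
  "linear_operator T \<longleftrightarrow>
     single_valued T \<and> (0, 0) \<in> T \<and>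
     (\<forall>x y x' y'. (x, y) \<in> T \<longrightarrow> (x', y') \<in> T \<longrightarrow> (x + x', y + y') \<in> T) \<and>
     (\<forall>c x y. (x, y) \<in> T \<longrightarrow> (c *\<^sub>C x, c *\<^sub>C y) \<in> T)"

definition closed_operator :: "'a::cbanach operator \<Rightarrow> bool" where
  "closed_operator T \<longleftrightarrow> linear_operator T \<and> closed T"

definition closable :: "'a::cbanach operator \<Rightarrow> bool" where
  "closable T \<longleftrightarrow> (\<exists>S. closed_operator S \<and> T \<subseteq> S)"

text \<open>The least element with respect to inclusion of graphs; meaningful for closable \<open>T\<close>.\<close>

definition operator_closure :: "'a::cbanach operator \<Rightarrow> 'a operator" where
  "operator_closure T = (LEAST S. closed_operator S \<and> T \<subseteq> S)"

definition operator_sum :: "'a::cbanach operator \<Rightarrow> 'a operator \<Rightarrow> 'a operator" where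
  "operator_sum A B = {(x, y + z) | x y z. (x, y) \<in> A \<and> (x, z) \<in> B}"

text \<open>The operator \<open>\<lambda> - T\<close> with domain \<open>D(T)\<close>.\<close>

definition shifted :: "complex \<Rightarrow> 'a::cbanach operator \<Rightarrow> 'a operator" where
  "shifted l T = {(x, l *\<^sub>C x - y) | x y. (x, y) \<in> T}"

text \<open>The part \<open>T\<^sub>0\<close> of \<open>T\<close> in the closure of its domain.\<close>

definition part_in_closure :: "'a::cbanach operator \<Rightarrow> 'a operator" where
  "part_in_closure T = {(x, y). (x, y) \<in> T \<and> y \<in> closure (Domain T)}"

text \<open>Membership in \<open>\<L>(Y)\<close> and its norm, for a linear subspace \<open>Y\<close>. Values outside \<open>Y\<close> are
  irrelevant.\<close>

definition bounded_clinear_on :: "'a::cbanach set \<Rightarrow> ('a \<Rightarrow> 'a) \<Rightarrow> bool" where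
  "bounded_clinear_on Y f \<longleftrightarrow>
     (\<forall>x\<in>Y. f x \<in> Y) \<and>
     (\<forall>x\<in>Y. \<forall>y\<in>Y. f (x + y) = f x + f y) \<and>
     (\<forall>c. \<forall>x\<in>Y. f (c *\<^sub>C x) = c *\<^sub>C f x) \<and>
     (\<exists>M. \<forall>x\<in>Y. norm (f x) \<le> M * norm x)"

definition onorm_on :: "'a::cbanach set \<Rightarrow> ('a \<Rightarrow> 'a) \<Rightarrow> real" where
  "onorm_on Y f = (SUP x\<in>Y. norm (f x) / norm x)"

text \<open>\<open>(\<lambda> - T)\<inverse>\<close> as a total function; meaningful when \<open>\<lambda> - T\<close> is a bijection onto the space.\<close>

definition resolvent :: "'a::cbanach operator \<Rightarrow> complex \<Rightarrow> 'a \<Rightarrow> 'a" where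
  "resolvent T l = (\<lambda>y. THE x. (x, y) \<in> shifted l T)"

definition resolvent_set :: "'a::cbanach operator \<Rightarrow> complex set" where
  "resolvent_set T =
     {l. (\<forall>y. \<exists>!x. (x, y) \<in> shifted l T) \<and> bounded_clinear_on UNIV (resolvent T l)}"

definition resolvent_commuting :: "'a::cbanach operator \<Rightarrow> 'a operator \<Rightarrow> bool" where
  "resolvent_commuting A B \<longleftrightarrow>
     (\<forall>l \<in> resolvent_set A \<inter> resolvent_set B. \<forall>m \<in> resolvent_set A \<inter> resolvent_set B.
        resolvent A l \<circ> resolvent B m = resolvent B m \<circ> resolvent A l)"

definition sector :: "real \<Rightarrow> complex set" where
  "sector \<theta> = {z. z \<noteq> 0 \<and> \<bar>Arg z\<bar> < \<theta>}"

text \<open>Strongly continuous analytic semigroup of angle \<open>\<theta>\<close> on the closed subspace \<open>Y\<close>, in the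
  sense of Pazy and of Engel and Nagel. The map \<open>z \<mapsto> S z\<close> is complex differentiable on the open
  sector with respect to the norm of \<open>\<L>(Y)\<close>.\<close>

definition analytic_semigroup_on ::
    "'a::cbanach set \<Rightarrow> real \<Rightarrow> (complex \<Rightarrow> 'a \<Rightarrow> 'a) \<Rightarrow> bool" where
  "analytic_semigroup_on Y \<theta> S \<longleftrightarrow>
     (\<forall>z \<in> insert 0 (sector \<theta>). bounded_clinear_on Y (S z)) \<and>
     (\<forall>x\<in>Y. S 0 x = x) \<and>
     (\<forall>z \<in> sector \<theta>. \<forall>w \<in> sector \<theta>. \<forall>x\<in>Y. S (z + w) x = S z (S w x)) \<and>
     (\<forall>z \<in> sector \<theta>. \<exists>S'. bounded_clinear_on Y S' \<and>
        ((\<lambda>w. onorm_on Y (\<lambda>x. inverse (w - z) *\<^sub>C (S w x - S z x) - S' x)) \<longlongrightarrow> 0) (at z)) \<and>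
     (\<forall>x\<in>Y. \<forall>\<theta>'. 0 < \<theta>' \<and> \<theta>' < \<theta> \<longrightarrow> ((\<lambda>z. S z x) \<longlongrightarrow> x) (at 0 within sector \<theta>'))"

definition generator_on :: "'a::cbanach set \<Rightarrow> (complex \<Rightarrow> 'a \<Rightarrow> 'a) \<Rightarrow> 'a operator" where
  "generator_on Y S =
     {(x, y). x \<in> Y \<and> y \<in> Y \<and>
        ((\<lambda>t. (1 / t) *\<^sub>R (S (complex_of_real t) x - x)) \<longlongrightarrow> y) (at_right 0)}"

definition generates_analytic_semigroup_on :: "'a::cbanach set \<Rightarrow> 'a operator \<Rightarrow> bool" where
  "generates_analytic_semigroup_on Y G \<longleftrightarrow>
     (\<exists>\<theta> S. 0 < \<theta> \<and> \<theta> \<le> pi / 2 \<and> analytic_semigroup_on Y \<theta> S \<and> generator_on Y S = G)"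

definition analytic_resolvent_condition :: "'a::cbanach operator \<Rightarrow> real \<Rightarrow> bool" where
  "analytic_resolvent_condition T p \<longleftrightarrow>
     generates_analytic_semigroup_on (closure (Domain T)) (part_in_closure T) \<and>
     (\<exists>\<omega>::real. (\<forall>l>\<omega>. complex_of_real l \<in> resolvent_set T) \<and>
        (\<lambda>l::real. onorm (resolvent T (complex_of_real l))) \<in> O[at_top](\<lambda>l. l powr (- 1 / p)))"

lemma continuous_scaleC: "continuous_on UNIV (\<lambda>x::'a::cbanach. c *\<^sub>C x)"
proof -
  have "bounded_linear (\<lambda>x::'a. c *\<^sub>C x)"
  proof (rule bounded_linear_intro[where K = "cmod c"])
    fix r and x :: 'a
    show "c *\<^sub>C (r *\<^sub>R x) = r *\<^sub>R (c *\<^sub>C x)"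
      by (simp add: scaleC_of_real[symmetric] scaleC_scaleC mult.commute)
  qed (simp_all add: scaleC_add_right norm_scaleC mult.commute)
  then show ?thesis by (simp add: linear_continuous_on)
qed

lemma closed_operator_closure:
  assumes T: "linear_operator T" and cl: "closable T"
  shows "operator_closure T = closure T" "closed_operator (operator_closure T)"
proof -
  obtain S where S: "closed_operator S" "T \<subseteq> S" using cl by (auto simp: closable_def)
  then have sub: "closure T \<subseteq> S" by (simp add: closed_operator_def closure_minimal)
  have add: "p + q \<in> closure T" if pq: "p \<in> closure T" "q \<in> closure T" for p q
  proof -
    obtain f g where "\<And>n. f n \<in> T" "f \<longlonglongrightarrow> p" "\<And>n. g n \<in> T" "g \<longlonglongrightarrow> q"
      using pq unfolding closure_sequential by blast
    then have "(\<lambda>n. f n + g n) \<longlonglongrightarrow> p + q" "\<And>n. f n + g n \<in> T"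
      using T by (auto intro!: tendsto_Pair tendsto_add intro: tendsto_fst tendsto_snd simp: linear_operator_def plus_prod_def)
    then show ?thesis
      unfolding closure_sequential by (intro exI[of _ "\<lambda>n. f n + g n"]) simp
  qed
  have sc: "(c *\<^sub>C fst p, c *\<^sub>C snd p) \<in> closure T" if pq: "p \<in> closure T" for c p
  proof -
    obtain f where f: "\<And>n. f n \<in> T" "f \<longlonglongrightarrow> p"
      using pq unfolding closure_sequential by blast
    have "(\<lambda>n. c *\<^sub>C fst (f n)) \<longlonglongrightarrow> c *\<^sub>C fst p" "(\<lambda>n. c *\<^sub>C snd (f n)) \<longlonglongrightarrow> c *\<^sub>C snd p"
      using tendsto_fst[OF f(2)] tendsto_snd[OF f(2)] continuous_scaleC[of c]
      by (auto simp: continuous_on_eq_continuous_at intro: isCont_tendsto_compose)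
    then have "(\<lambda>n. (c *\<^sub>C fst (f n), c *\<^sub>C snd (f n))) \<longlonglongrightarrow> (c *\<^sub>C fst p, c *\<^sub>C snd p)"
      by (rule tendsto_Pair)
    moreover have "\<And>n. (c *\<^sub>C fst (f n), c *\<^sub>C snd (f n)) \<in> T"
      using T f(1) unfolding linear_operator_def by (metis prod.collapse)
    ultimately show ?thesis
      unfolding closure_sequential
      by (intro exI[of _ "\<lambda>n. (c *\<^sub>C fst (f n), c *\<^sub>C snd (f n))"]) simp
  qed
  have sv: "single_valued (closure T)"
    using S sub by (auto simp: closed_operator_def linear_operator_def intro: single_valued_subset)
  have z: "(0, 0) \<in> closure T" using T closure_subset by (auto simp: linear_operator_def)
  have c: "closed_operator (closure T)"
    unfolding closed_operator_def linear_operator_def 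
    using sv z add[of "(_, _)" "(_, _)"] sc[of "(_, _)"] by auto
  show eq: "operator_closure T = closure T"
    unfolding operator_closure_def
    by (rule Least_equality) (use c closure_subset in
        \<open>auto simp: closed_operator_def dest: closure_minimal\<close>)
  show "closed_operator (operator_closure T)" using c eq by simp
qed

end

theory Submission imports Defs begin

text \<open>The analytic semigroup generated by \<open>A\<^sub>0\<close> extends to the whole space by
  \<open>T\<^sub>A(z) = (\<mu> - A) S\<^sub>A(z) (\<mu> - A)\<inverse>\<close>. Cauchy's estimate for \<open>S\<^sub>A'\<close> and the choice \<open>\<mu> = 1/t\<close> give
  \<open>\<parallel>T\<^sub>A(t)\<parallel> = O(t powr (1/p\<^sub>A - 1))\<close> near 0. The operators \<open>U(t) = T\<^sub>A(t) T\<^sub>B(t)\<close> commute and satisfy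
  \<open>U'(t) x = U(t) (A + B) x\<close> on \<open>D(A) \<inter> D(B)\<close>, with an integrable singularity \<open>t powr (\<delta> - 1)\<close>,
  \<open>\<delta> = 1/p\<^sub>A + 1/p\<^sub>B - 1\<close>. Applying the mean value inequality to \<open>exp (- \<lambda> t) U(t) x\<close> yields
  \<open>\<parallel>x\<parallel> \<le> K \<lambda> powr (- \<delta>) \<parallel>(\<lambda> - A - B) x\<parallel>\<close>, which together with the dense range gives the
  resolvent of the closure without any improper Banach-space valued integral. On the closure of
  the domain, \<open>U\<close> is an analytic semigroup, and its generator is identified by the commutation
  of \<open>U\<close> with the resolvent of the closure.\<close>

section \<open>Bounded operators on complex subspaces\<close>

text \<open>The semigroup S is only known to exist, on a subspace that may be smaller than the
  space, and no contour formula ties it to the resolvent. All links between the two are derived from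
  the generator: an operator commuting with A commutes with S, so (\<mu> - A) S(z) (\<mu> -
  A)\<inverse> does not depend on \<mu>, and \<mu> may vary with t. It equals \<mu> S(t) R(\<mu>) -
  S'(t) R(\<mu>), where the factors in front of R(\<mu>) have size \<mu> and 1/t; \<mu> = 1/t
  balances them, and the decay \<mu> powr (- 1/p) of the resolvent becomes t powr (1/p - 1). Since
  the domains need not be dense, this may blow up at 0. The product of the singularities of A and B
  is integrable at 0 exactly when \<delta> > 0, which is the assumption on the exponents. Formally,
  the estimate comes from the Laplace representation of x as the integral of exp (- \<lambda> t)
  U(t) (\<lambda> - A - B) x over t > 0. The resolvent then decays like \<lambda> powr (- \<delta>),
  which covers every 1/p < \<delta>.\<close>

lemma bounded_bilinear_scaleC:
  "bounded_bilinear (scaleC :: complex \<Rightarrow> 'a::cbanach \<Rightarrow> 'a)"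
proof
  fix r and a b :: complex and x y :: 'a
  show "(a + b) *\<^sub>C x = a *\<^sub>C x + b *\<^sub>C x" by (rule scaleC_add_left)
  show "a *\<^sub>C (x + y) = a *\<^sub>C x + a *\<^sub>C y" by (rule scaleC_add_right)
  show "(r *\<^sub>R a) *\<^sub>C x = r *\<^sub>R (a *\<^sub>C x)"
    by (simp add: scaleR_conv_of_real scaleC_of_real[symmetric] scaleC_scaleC)
  show "a *\<^sub>C (r *\<^sub>R x) = r *\<^sub>R (a *\<^sub>C x)"
    by (simp add: scaleC_of_real[symmetric] scaleC_scaleC mult.commute)
  show "\<exists>K. \<forall>a (x::'a). norm (a *\<^sub>C x) \<le> norm a * norm x * K"
    by (rule exI[of _ 1]) (simp add: norm_scaleC)
qed

interpretation scaleC: bounded_bilinear scaleC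
  by (rule bounded_bilinear_scaleC)

lemma scaleC_one [simp]: "1 *\<^sub>C (x::'a::cbanach) = x"
  using scaleC_of_real[of 1 x] by simp

lemma scaleC_left_commute: "a *\<^sub>C (b *\<^sub>C (x::'a::cbanach)) = b *\<^sub>C (a *\<^sub>C x)"
  by (simp add: scaleC_scaleC mult.commute)

text \<open>The subspaces in question are closures of domains. They depend on the operator and so
  cannot be types; boundedness and differentiability are therefore taken relative to a set
  \<open>Y\<close>.\<close>

definition closed_csubspace :: "'a::cbanach set \<Rightarrow> bool" where
  "closed_csubspace Y \<longleftrightarrow> closed Y \<and> 0 \<in> Y \<and> (\<forall>x\<in>Y. \<forall>y\<in>Y. x + y \<in> Y) \<and> (\<forall>c. \<forall>x\<in>Y. c *\<^sub>C x \<in> Y)"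

lemma closed_csubspaceD:
  assumes "closed_csubspace Y"
  shows "closed Y" "0 \<in> Y" "\<And>x y. x \<in> Y \<Longrightarrow> y \<in> Y \<Longrightarrow> x + y \<in> Y" "\<And>c x. x \<in> Y \<Longrightarrow> c *\<^sub>C x \<in> Y"
    "\<And>x y. x \<in> Y \<Longrightarrow> y \<in> Y \<Longrightarrow> x - y \<in> Y" "\<And>r x. x \<in> Y \<Longrightarrow> r *\<^sub>R x \<in> Y"
proof -
  show s: "closed Y" "0 \<in> Y" "\<And>x y. x \<in> Y \<Longrightarrow> y \<in> Y \<Longrightarrow> x + y \<in> Y" "\<And>c x. x \<in> Y \<Longrightarrow> c *\<^sub>C x \<in> Y"
    using assms by (auto simp: closed_csubspace_def)
  show "r *\<^sub>R x \<in> Y" if "x \<in> Y" for r x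
    using s(4)[OF that, of "of_real r"] by (simp add: scaleC_of_real)
  from this[of _ "-1"] show "x - y \<in> Y" if "x \<in> Y" "y \<in> Y" for x y
    using s(3)[of x "- y"] that by simp
qed

lemma closed_csubspace_UNIV: "closed_csubspace UNIV"
  by (simp add: closed_csubspace_def)

lemma bounded_clinear_onD:
  assumes "bounded_clinear_on Y f"
  shows "\<And>x. x \<in> Y \<Longrightarrow> f x \<in> Y" "\<And>x y. x \<in> Y \<Longrightarrow> y \<in> Y \<Longrightarrow> f (x + y) = f x + f y"
    "\<And>c x. x \<in> Y \<Longrightarrow> f (c *\<^sub>C x) = c *\<^sub>C f x" "\<And>r x. x \<in> Y \<Longrightarrow> f (r *\<^sub>R x) = r *\<^sub>R f x"
  using assms by (auto simp: bounded_clinear_on_def simp flip: scaleC_of_real)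

lemma bounded_clinear_on_bound:
  assumes "bounded_clinear_on Y f"
  obtains M where "M > 0" "\<And>x. x \<in> Y \<Longrightarrow> norm (f x) \<le> M * norm x"
proof -
  obtain M where M: "\<And>x. x \<in> Y \<Longrightarrow> norm (f x) \<le> M * norm x"
    using assms unfolding bounded_clinear_on_def by blast
  have "norm (f x) \<le> (\<bar>M\<bar> + 1) * norm x" if "x \<in> Y" for x
  proof -
    have "M * norm x \<le> (\<bar>M\<bar> + 1) * norm x" by (rule mult_right_mono) auto
    with M[OF that] show ?thesis by linarith
  qed
  then show ?thesis using that[of "\<bar>M\<bar> + 1"] by auto
qed

lemma bounded_clinear_on_diff:
  assumes "closed_csubspace Y" "bounded_clinear_on Y f" "x \<in> Y" "y \<in> Y"
  shows "f (x - y) = f x - f y"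
  using bounded_clinear_onD(2)[OF assms(2), of x "(-1) *\<^sub>R y"] bounded_clinear_onD(4)[OF assms(2), of y "-1"]
    closed_csubspaceD(6)[OF assms(1), of y "-1"] assms by simp

lemma bounded_clinear_on_zero:
  assumes "closed_csubspace Y" "bounded_clinear_on Y f"
  shows "f 0 = 0"
  using bounded_clinear_on_diff[OF assms, of 0 0] closed_csubspaceD(2)[OF assms(1)] by simp

lemma bounded_clinear_UNIV_bounded_linear:
  assumes "bounded_clinear_on UNIV f"
  shows "bounded_linear f"
proof -
  obtain M where "M > 0" "\<And>x. norm (f x) \<le> M * norm x" using bounded_clinear_on_bound[OF assms] by auto
  then show ?thesis
    using bounded_clinear_onD[OF assms] by (intro bounded_linear_intro[of f M]) (auto simp: mult.commute)
qed

lemma bounded_clinear_on_tendsto: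
  assumes Y: "closed_csubspace Y" and f: "bounded_clinear_on Y f"
    and "\<forall>\<^sub>F n in F. g n \<in> Y" "x \<in> Y" "(g \<longlongrightarrow> x) F"
  shows "((\<lambda>n. f (g n)) \<longlongrightarrow> f x) F"
proof -
  obtain M where M: "M > 0" "\<And>x. x \<in> Y \<Longrightarrow> norm (f x) \<le> M * norm x"
    using bounded_clinear_on_bound[OF f] by blast
  have "((\<lambda>n. f (g n) - f x) \<longlongrightarrow> 0) F"
  proof (rule Lim_null_comparison)
    show "((\<lambda>n. M * norm (g n - x)) \<longlongrightarrow> 0) F"
      using assms(5) by (intro tendsto_mult_right_zero tendsto_norm_zero) (simp add: LIM_zero_iff)
    show "\<forall>\<^sub>F n in F. norm (f (g n) - f x) \<le> M * norm (g n - x)"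
      using assms(3)
    proof eventually_elim
      case (elim n)
      then show ?case
        using M(2)[of "g n - x"] bounded_clinear_on_diff[OF Y f] closed_csubspaceD(5)[OF Y] assms(4) by auto
    qed
  qed
  then show ?thesis by (simp add: LIM_zero_iff)
qed

lemma bounded_clinear_on_comp:
  assumes "bounded_clinear_on Y f" "bounded_clinear_on Y g"
  shows "bounded_clinear_on Y (\<lambda>x. f (g x))"
proof -
  obtain M where M: "M > 0" "\<And>x. x \<in> Y \<Longrightarrow> norm (f x) \<le> M * norm x"
    using bounded_clinear_on_bound[OF assms(1)] by blast
  obtain N where N: "N > 0" "\<And>x. x \<in> Y \<Longrightarrow> norm (g x) \<le> N * norm x"
    using bounded_clinear_on_bound[OF assms(2)] by blast
  have "norm (f (g x)) \<le> (M * N) * norm x" if "x \<in> Y" for x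
  proof -
    have "norm (f (g x)) \<le> M * norm (g x)" using M bounded_clinear_onD(1)[OF assms(2)] that by blast
    also have "\<dots> \<le> M * (N * norm x)" using M(1) N(2)[OF that] by simp
    finally show ?thesis by (simp add: mult.assoc)
  qed
  then show ?thesis
    using bounded_clinear_onD(1-3)[OF assms(1)] bounded_clinear_onD(1-3)[OF assms(2)]
    unfolding bounded_clinear_on_def by auto
qed

lemma bounded_clinear_on_add:
  assumes Y: "closed_csubspace Y" and "bounded_clinear_on Y f" "bounded_clinear_on Y g"
  shows "bounded_clinear_on Y (\<lambda>x. f x + g x)"
proof -
  obtain M where M: "M > 0" "\<And>x. x \<in> Y \<Longrightarrow> norm (f x) \<le> M * norm x"
    using bounded_clinear_on_bound[OF assms(2)] by blast
  obtain N where N: "N > 0" "\<And>x. x \<in> Y \<Longrightarrow> norm (g x) \<le> N * norm x"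
    using bounded_clinear_on_bound[OF assms(3)] by blast
  have "norm (f x + g x) \<le> (M + N) * norm x" if "x \<in> Y" for x
    using norm_triangle_ineq[of "f x" "g x"] M(2)[OF that] N(2)[OF that] by (simp add: algebra_simps)
  then show ?thesis
    using bounded_clinear_onD(1-3)[OF assms(2)] bounded_clinear_onD(1-3)[OF assms(3)] closed_csubspaceD[OF Y]
    unfolding bounded_clinear_on_def by (auto simp: scaleC_add_right)
qed

lemma bounded_clinear_on_scaleC:
  assumes Y: "closed_csubspace Y" and "bounded_clinear_on Y f"
  shows "bounded_clinear_on Y (\<lambda>x. c *\<^sub>C f x)"
proof -
  obtain M where M: "M > 0" "\<And>x. x \<in> Y \<Longrightarrow> norm (f x) \<le> M * norm x"
    using bounded_clinear_on_bound[OF assms(2)] by blast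
  have "norm (c *\<^sub>C f x) \<le> (cmod c * M) * norm x" if "x \<in> Y" for x
    using M(2)[OF that] by (simp add: norm_scaleC mult.assoc mult_left_mono)
  then show ?thesis
    using bounded_clinear_onD(1-3)[OF assms(2)] closed_csubspaceD[OF Y]
    unfolding bounded_clinear_on_def by (auto simp: scaleC_add_right scaleC_left_commute)
qed

section \<open>The principle of uniform boundedness\<close>

text \<open>Without a uniform bound, every ball of \<open>Y\<close> contains a smaller ball on which
  some \<open>F i\<close> is large everywhere. Nested balls of this kind with radii tending to 0
  shrink to a point of \<open>Y\<close>, since \<open>Y\<close> is closed in a Banach space, and at
  that point the values \<open>F i\<close> are unbounded, against \<open>pw\<close>.\<close>

theorem uniform_boundedness_on:
  fixes F :: "'i \<Rightarrow> 'a::cbanach \<Rightarrow> 'a"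
  assumes Y: "closed_csubspace Y" and F: "\<And>i. i \<in> I \<Longrightarrow> bounded_clinear_on Y (F i)"
    and pw: "\<And>x. x \<in> Y \<Longrightarrow> \<exists>b. \<forall>i\<in>I. norm (F i x) \<le> b"
  obtains M where "M > 0" "\<And>i x. i \<in> I \<Longrightarrow> x \<in> Y \<Longrightarrow> norm (F i x) \<le> M * norm x"
proof -
  note Y' = closed_csubspaceD[OF Y]
  have "\<exists>M. \<forall>i\<in>I. \<forall>x\<in>Y. norm (F i x) \<le> M * norm x"
  proof (rule ccontr)
    assume "\<not> ?thesis"
    then have unb: "\<exists>i\<in>I. \<exists>x\<in>Y. norm (F i x) > M * norm x" for M by (auto simp: not_le)
    let ?P = "\<lambda>(x, r::real). x \<in> Y \<and> 0 < r"
    let ?Q = "\<lambda>n (x, r) (x', r'). r' \<le> r / 2 \<and> dist x x' + r' \<le> r \<and>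
      (\<exists>i\<in>I. \<forall>y\<in>Y. dist x' y \<le> r' \<longrightarrow> real n \<le> norm (F i y))"
    have step: "\<exists>q. ?P q \<and> ?Q n p q" if "?P p" for n p
    proof -
      obtain x r where p: "p = (x, r)" "x \<in> Y" "0 < r" using \<open>?P p\<close> by (cases p) auto
      obtain b where b: "\<And>i. i \<in> I \<Longrightarrow> norm (F i x) \<le> b" using pw[OF p(2)] by auto
      \<comment> \<open>Chosen so that the multiple \<open>v\<close> of \<open>u\<close> with norm
        \<open>r / 2\<close> has \<open>norm (F i v)\<close> above
        \<open>\<bar>b\<bar> + real n + 1\<close>; subtracting the bound \<open>b\<close> at the
        centre still leaves more than \<open>n + 1\<close> at \<open>x + v\<close>.\<close>
      let ?M = "2 * (\<bar>b\<bar> + real n + 1) / r"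
      obtain i u where i: "i \<in> I" "u \<in> Y" "norm (F i u) > ?M * norm u" using unb[of ?M] by auto
      have Fi: "bounded_clinear_on Y (F i)" using F i by auto
      have u0: "norm u > 0" using i(3) bounded_clinear_on_zero[OF Y Fi] by auto
      define v where "v = (r / 2 / norm u) *\<^sub>R u"
      have v: "v \<in> Y" "norm v = r / 2" using i u0 p Y'(6) by (auto simp: v_def)
      have "norm (F i v) = (r / 2 / norm u) * norm (F i u)"
        using u0 p by (simp add: v_def bounded_clinear_onD(4)[OF Fi i(2)])
      also have "\<dots> > (r / 2 / norm u) * (?M * norm u)"
        using i(3) u0 p by (intro mult_strict_left_mono) auto
      also have "(r / 2 / norm u) * (?M * norm u) = \<bar>b\<bar> + real n + 1"
        using u0 p by (simp add: field_simps)
      finally have Fv: "norm (F i v) > \<bar>b\<bar> + real n + 1" .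
      define x' where "x' = x + v"
      have x': "x' \<in> Y" "dist x x' = r / 2" using v p Y' by (auto simp: x'_def dist_norm)
      have "F i x' = F i x + F i v" unfolding x'_def using p v by (intro bounded_clinear_onD(2)[OF Fi])
      then have Fx': "norm (F i x') > real n + 1"
        using Fv b[OF i(1)] norm_triangle_ineq4[of "F i x'" "F i x"] by auto
      obtain K where K: "K > 0" "\<And>x. x \<in> Y \<Longrightarrow> norm (F i x) \<le> K * norm x"
        using bounded_clinear_on_bound[OF Fi] by blast
      define r' where "r' = min (r / 2) (1 / K)"
      have r': "r' > 0" "r' \<le> r / 2" "r' \<le> 1 / K" using K p by (auto simp: r'_def)
      have "real n \<le> norm (F i y)" if y: "y \<in> Y" "dist x' y \<le> r'" for y
      proof -
        have "norm (F i x' - F i y) \<le> K * norm (x' - y)"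
          using K(2)[of "x' - y"] bounded_clinear_on_diff[OF Y Fi, of x' y] Y'(5) x' y by auto
        also have "\<dots> \<le> K * (1 / K)" using y r' K by (intro mult_left_mono) (auto simp: dist_norm)
        also have "\<dots> = 1" using K by simp
        finally have "norm (F i x' - F i y) \<le> 1" .
        then show ?thesis using Fx' norm_triangle_ineq2[of "F i x'" "F i y"] by linarith
      qed
      then show ?thesis using p x' r' i by (intro exI[of _ "(x', r')"]) auto
    qed
    have "\<exists>f. \<forall>n. ?P (f n) \<and> ?Q n (f n) (f (Suc n))"
    proof (rule dependent_nat_choice)
      show "\<exists>p. ?P p" using Y'(2) by (intro exI[of _ "(0, 1)"]) simp
    qed (rule step)
    then obtain f where f': "\<forall>n. ?P (f n) \<and> ?Q n (f n) (f (Suc n))" ..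
    have f: "?P (f n)" "?Q n (f n) (f (Suc n))" for n
      by (rule f'[THEN spec, THEN conjunct1], rule f'[THEN spec, THEN conjunct2])
    define x r where "x = (\<lambda>n. fst (f n))" and "r = (\<lambda>n. snd (f n))"
    have f1: "x n \<in> Y" "r n > 0" "r (Suc n) \<le> r n / 2" "dist (x n) (x (Suc n)) + r (Suc n) \<le> r n" for n
      using f(1)[of n] f(2)[of n] by (auto simp: x_def r_def split_beta)
    have f2: "\<exists>i\<in>I. \<forall>y\<in>Y. dist (x (Suc n)) y \<le> r (Suc n) \<longrightarrow> real n \<le> norm (F i y)" for n
      using f(2)[of n] by (auto simp: x_def r_def split_beta)
    have nest: "dist (x n) (x (n + k)) + r (n + k) \<le> r n" for n k
    proof (induction k)
      case (Suc k)
      then show ?case using f1(4)[of "n + k"] dist_triangle[of "x n" "x (n + Suc k)" "x (n + k)"] by auto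
    qed simp
    have rb: "r n \<le> r 0 * (1/2) ^ n" for n
    proof (induction n)
      case (Suc n)
      then show ?case using f1(3)[of n] by auto
    qed simp
    have r0: "r \<longlonglongrightarrow> 0"
    proof (rule Lim_null_comparison)
      show "(\<lambda>n. r 0 * (1/2) ^ n) \<longlonglongrightarrow> 0" by (intro tendsto_mult_right_zero LIMSEQ_power_zero) simp
      show "\<forall>\<^sub>F n in sequentially. norm (r n) \<le> r 0 * (1/2) ^ n"
        using rb f1(2) by (simp add: less_imp_le)
    qed
    have d: "dist (x n) (x m) \<le> r n" if "n \<le> m" for n m
      using nest[of n "m - n"] f1(2)[of m] that by simp
    have "Cauchy x"
    proof (rule metric_CauchyI)
      fix e :: real assume "e > 0"
      then obtain N where N: "r N < e / 2"
        using order_tendstoD(2)[OF r0, of "e/2"] by (auto simp: eventually_sequentially)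
      have "dist (x m) (x n) < e" if "m \<ge> N" "n \<ge> N" for m n
        using d[OF that(1)] d[OF that(2)] N dist_triangle3[of "x m" "x n" "x N"] by linarith
      then show "\<exists>N. \<forall>m\<ge>N. \<forall>n\<ge>N. dist (x m) (x n) < e" by blast
    qed
    then obtain y where y: "x \<longlonglongrightarrow> y" using Cauchy_convergent_iff convergent_def by blast
    have yY: "y \<in> Y" using closed_sequentially[OF Y'(1)] f1(1) y by blast
    have dy: "dist (x n) y \<le> r n" for n
      by (rule LIMSEQ_le_const2[OF tendsto_dist[OF tendsto_const y]]) (use d in blast)
    obtain b where b: "\<And>i. i \<in> I \<Longrightarrow> norm (F i y) \<le> b" using pw[OF yY] by auto
    obtain n where n: "real n > b" using reals_Archimedean2 by blast
    obtain i where "i \<in> I" "real n \<le> norm (F i y)" using f2[of n] yY dy by blast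
    with b[of i] n show False by simp
  qed
  then obtain M where M: "\<forall>i\<in>I. \<forall>x\<in>Y. norm (F i x) \<le> M * norm x" by blast
  have "norm (F i x) \<le> (\<bar>M\<bar> + 1) * norm x" if "i \<in> I" "x \<in> Y" for i x
  proof -
    have "M * norm x \<le> (\<bar>M\<bar> + 1) * norm x" by (rule mult_right_mono) auto
    with M that show ?thesis by fastforce
  qed
  then show ?thesis using that[of "\<bar>M\<bar> + 1"] by auto
qed

section \<open>Sectors\<close>

text \<open>The difference of the two sides is
  \<open>cmod z * sin (\<theta> - \<bar>Arg z\<bar>)\<close>, and the angle lies in a range where
  the sine has the sign of its argument. This polynomial form makes convexity, openness and the
  inclusion of discs elementary.\<close>

lemma sector_iff:
  assumes "0 < \<theta>" "\<theta> \<le> pi / 2"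
  shows "z \<in> sector \<theta> \<longleftrightarrow> \<bar>Im z\<bar> * cos \<theta> < Re z * sin \<theta>"
proof (cases "z = 0")
  case False
  let ?p = "\<bar>Arg z\<bar>"
  have p: "?p \<le> pi" using mpi_less_Arg[of z] Arg_le_pi[of z] by auto
  have re: "Re z = cmod z * cos ?p" using Arg_eq[OF False] False by (metis Re_rcis rcis_def Arg_eq cis_conv_exp cos_abs_real)
  have "Im z = cmod z * sin (Arg z)" using Arg_eq[OF False] False by (metis Im_rcis rcis_def Arg_eq cis_conv_exp)
  moreover have "\<bar>sin (Arg z)\<bar> = sin ?p"
    using sin_ge_zero[of ?p] p by (cases "Arg z \<ge> 0") auto
  ultimately have im: "\<bar>Im z\<bar> = cmod z * sin ?p" by (simp add: abs_mult)
  have "\<bar>Im z\<bar> * cos \<theta> < Re z * sin \<theta> \<longleftrightarrow> 0 < cmod z * sin (\<theta> - ?p)"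
    unfolding re im sin_diff by (simp add: algebra_simps)
  also have "\<dots> \<longleftrightarrow> 0 < sin (\<theta> - ?p)" using False by (simp add: zero_less_mult_iff)
  also have "\<dots> \<longleftrightarrow> ?p < \<theta>"
  proof -
    have "sin (\<theta> - ?p) = - sin (?p - \<theta>)" by (metis minus_diff_eq sin_minus)
    moreover have "sin (\<theta> - ?p) > 0" if "?p < \<theta>" using that assms by (intro sin_gt_zero) auto
    moreover have "sin (?p - \<theta>) \<ge> 0" if "\<not> ?p < \<theta>" using that assms p by (intro sin_ge_zero) auto
    ultimately show ?thesis by linarith
  qed
  finally show ?thesis using False by (auto simp: sector_def)
qed (simp add: sector_def)

lemma sector_mono: "\<theta>' \<le> \<theta> \<Longrightarrow> z \<in> sector \<theta>' \<Longrightarrow> z \<in> sector \<theta>"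
  by (auto simp: sector_def)

lemma of_real_in_sector: "0 < t \<Longrightarrow> 0 < \<theta> \<Longrightarrow> complex_of_real t \<in> sector \<theta>"
  by (simp add: sector_def)

lemma sector_scale: "0 < r \<Longrightarrow> z \<in> sector \<theta> \<Longrightarrow> of_real r * z \<in> sector \<theta>"
  by (auto simp: sector_def Arg_times_of_real)

lemma sector_add:
  assumes "0 < \<theta>" "\<theta> \<le> pi / 2" "z \<in> sector \<theta>" "w \<in> sector \<theta>"
  shows "z + w \<in> sector \<theta>"
proof -
  have "cos \<theta> \<ge> 0" using assms(1,2) by (intro cos_ge_zero) auto
  then have "\<bar>Im z + Im w\<bar> * cos \<theta> \<le> (\<bar>Im z\<bar> + \<bar>Im w\<bar>) * cos \<theta>"
    by (intro mult_right_mono) auto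
  then show ?thesis using assms by (simp add: sector_iff algebra_simps)
qed

lemma open_sector:
  assumes "0 < \<theta>" "\<theta> \<le> pi / 2"
  shows "open (sector \<theta>)"
proof -
  have "sector \<theta> = {z. \<bar>Im z\<bar> * cos \<theta> < Re z * sin \<theta>}" using sector_iff[OF assms] by blast
  also have "open \<dots>" by (intro open_Collect_less continuous_intros)
  finally show ?thesis .
qed

text \<open>The distance from the point t to the boundary rays is
  \<open>t * sin \<theta>\<close>.\<close>

lemma ball_in_sector:
  assumes "0 < \<theta>" "\<theta> \<le> pi / 2" "cmod (w - of_real t) < t * sin \<theta>"
  shows "w \<in> sector \<theta>"
proof -
  define u where "u = w - of_real t"
  have w: "Re w = t + Re u" "Im w = Im u" by (simp_all add: u_def)
  \<comment> \<open>A rotation of the vector with coordinates \<open>\<bar>Im u\<bar>\<close> and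
    \<open>Re u\<close> preserves its length, so each rotated coordinate is at most
    \<open>cmod u\<close>.\<close>
  have "(\<bar>Im u\<bar> * cos \<theta> - Re u * sin \<theta>)\<^sup>2 + (\<bar>Im u\<bar> * sin \<theta> + Re u * cos \<theta>)\<^sup>2
    = (\<bar>Im u\<bar>\<^sup>2 + (Re u)\<^sup>2) * ((sin \<theta>)\<^sup>2 + (cos \<theta>)\<^sup>2)"
    unfolding power2_eq_square by algebra
  also have "\<dots> = (cmod u)\<^sup>2" by (simp add: cmod_power2)
  finally have "(\<bar>Im u\<bar> * cos \<theta> - Re u * sin \<theta>)\<^sup>2 \<le> (cmod u)\<^sup>2"
    using zero_le_power2[of "\<bar>Im u\<bar> * sin \<theta> + Re u * cos \<theta>"] by linarith
  then have "\<bar>Im u\<bar> * cos \<theta> - Re u * sin \<theta> \<le> cmod u"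
    by (rule power2_le_imp_le) simp
  with assms(3) have "\<bar>Im u\<bar> * cos \<theta> - Re u * sin \<theta> < t * sin \<theta>" by (simp add: u_def)
  then show ?thesis by (simp add: sector_iff[OF assms(1,2)] w algebra_simps)
qed

section \<open>Complex derivatives\<close>

text \<open>Complex differentiability in the norm of L(Y), written without the operator norm: in
  this form restriction to a smaller subspace and the product rule need no suprema. The agreement
  with the notion used for semigroups is \<open>has_op_derivative_iff_onorm_on\<close>.\<close>

definition has_op_derivative ::
    "'a::cbanach set \<Rightarrow> (complex \<Rightarrow> 'a \<Rightarrow> 'a) \<Rightarrow> ('a \<Rightarrow> 'a) \<Rightarrow> complex \<Rightarrow> bool" where
  "has_op_derivative Y F F' z \<longleftrightarrow> (\<forall>e>0. \<exists>d>0. \<forall>w. cmod (w - z) < d \<longrightarrow>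
     (\<forall>x\<in>Y. norm (F w x - F z x - (w - z) *\<^sub>C F' x) \<le> e * cmod (w - z) * norm x))"

lemma has_op_derivativeD:
  assumes "has_op_derivative Y F F' z" "0 < e"
  obtains d where "0 < d" "\<And>w x. cmod (w - z) < d \<Longrightarrow> x \<in> Y \<Longrightarrow>
    norm (F w x - F z x - (w - z) *\<^sub>C F' x) \<le> e * cmod (w - z) * norm x"
  using assms unfolding has_op_derivative_def by blast

lemma has_op_derivative_subset:
  "has_op_derivative Y F F' z \<Longrightarrow> Y' \<subseteq> Y \<Longrightarrow> has_op_derivative Y' F F' z"
  unfolding has_op_derivative_def by (meson subsetD)

lemma has_op_derivative_pointwise:
  assumes "has_op_derivative Y F F' z" "x \<in> Y"
  shows "((\<lambda>w. F w x) has_derivative (\<lambda>h. h *\<^sub>C F' x)) (at z)"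
  unfolding has_derivative_at_alt
proof (intro conjI allI impI)
  show "bounded_linear (\<lambda>h. h *\<^sub>C F' x)" by (rule scaleC.bounded_linear_left)
  fix e :: real assume "e > 0"
  then have "e / (norm x + 1) > 0" by (simp add: add_nonneg_pos)
  from has_op_derivativeD[OF assms(1) this] obtain d where d: "0 < d"
    "\<And>w y. cmod (w - z) < d \<Longrightarrow> y \<in> Y \<Longrightarrow> norm (F w y - F z y - (w - z) *\<^sub>C F' y)
      \<le> e / (norm x + 1) * cmod (w - z) * norm y"
    by blast
  have "norm (F w x - F z x - (w - z) *\<^sub>C F' x) \<le> e * norm (w - z)" if "cmod (w - z) < d" for w
  proof -
    have "norm (F w x - F z x - (w - z) *\<^sub>C F' x) \<le> e / (norm x + 1) * cmod (w - z) * norm x"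
      by (rule d(2)[OF that assms(2)])
    also have "\<dots> = e * cmod (w - z) * (norm x / (norm x + 1))" by simp
    also have "\<dots> \<le> e * cmod (w - z) * 1"
    proof (rule mult_left_mono)
      have "norm x + 1 > 0" by (simp add: add_nonneg_pos)
      then show "norm x / (norm x + 1) \<le> 1" by simp
    qed (use \<open>e > 0\<close> in simp)
    finally show ?thesis by simp
  qed
  with d(1) show "\<exists>d>0. \<forall>y. norm (y - z) < d \<longrightarrow>
      norm (F y x - F z x - (y - z) *\<^sub>C F' x) \<le> e * norm (y - z)" by blast
qed

lemma has_op_derivative_affine:
  assumes "has_op_derivative Y F F' (a + b * z)"
  shows "has_op_derivative Y (\<lambda>s. F (a + b * s)) (\<lambda>x. b *\<^sub>C F' x) z"
  unfolding has_op_derivative_def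
proof (intro allI impI)
  fix e :: real assume "e > 0"
  then obtain d where d: "0 < d" "\<And>w x. cmod (w - (a + b * z)) < d \<Longrightarrow> x \<in> Y \<Longrightarrow>
      norm (F w x - F (a + b * z) x - (w - (a + b * z)) *\<^sub>C F' x)
      \<le> e / (cmod b + 1) * cmod (w - (a + b * z)) * norm x"
    using has_op_derivativeD[OF assms, of "e / (cmod b + 1)"] by (metis add_nonneg_pos divide_pos_pos norm_ge_zero zero_less_one)
  show "\<exists>d>0. \<forall>w. cmod (w - z) < d \<longrightarrow> (\<forall>x\<in>Y. norm (F (a + b * w) x - F (a + b * z) x
      - (w - z) *\<^sub>C b *\<^sub>C F' x) \<le> e * cmod (w - z) * norm x)"
  proof (intro exI[of _ "d / (cmod b + 1)"] conjI allI impI ballI)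
    show "0 < d / (cmod b + 1)" using d by (simp add: add_nonneg_pos)
    fix w x assume w: "cmod (w - z) < d / (cmod b + 1)" and x: "x \<in> Y"
    have b1: "cmod b + 1 > 0" by (simp add: add_nonneg_pos)
    have eq: "a + b * w - (a + b * z) = b * (w - z)" by (simp add: algebra_simps)
    have "cmod (b * (w - z)) \<le> (cmod b + 1) * cmod (w - z)"
      unfolding norm_mult by (intro mult_right_mono) auto
    moreover have "(cmod b + 1) * cmod (w - z) < d" using w b1 by (simp add: field_simps)
    ultimately have "norm (F (a + b * w) x - F (a + b * z) x - (b * (w - z)) *\<^sub>C F' x)
      \<le> e / (cmod b + 1) * cmod (b * (w - z)) * norm x"
      using d(2)[of "a + b * w" x] x unfolding eq by simp
    also have "\<dots> \<le> e / (cmod b + 1) * ((cmod b + 1) * cmod (w - z)) * norm x"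
      using \<open>cmod (b * (w - z)) \<le> _\<close> \<open>e > 0\<close> b1 by (intro mult_right_mono mult_left_mono) auto
    also have "\<dots> = e * cmod (w - z) * norm x" using b1 by simp
    finally show "norm (F (a + b * w) x - F (a + b * z) x - (w - z) *\<^sub>C b *\<^sub>C F' x) \<le> e * cmod (w - z) * norm x"
      by (simp add: scaleC_scaleC mult.commute)
  qed
qed

text \<open>Product rule for operator families. The error splits into the remainder of
  \<open>F\<close> evaluated at \<open>G w x\<close>, the term
  \<open>(w - z) *\<^sub>C F' (G w x - G z x)\<close>, and \<open>F z\<close> applied to the
  remainder of \<open>G\<close>; each receives a third of \<open>e\<close>.\<close>

lemma has_op_derivative_comp:
  assumes Y: "closed_csubspace Y" and F: "has_op_derivative Y F F' z" and G: "has_op_derivative Y G G' z"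
    and lF: "bounded_clinear_on Y (F z)" and lF': "bounded_clinear_on Y F'"
    and lG: "bounded_clinear_on Y (G z)" and lG': "bounded_clinear_on Y G'"
    and GY: "\<forall>\<^sub>F w in nhds z. \<forall>x\<in>Y. G w x \<in> Y"
  shows "has_op_derivative Y (\<lambda>w x. F w (G w x)) (\<lambda>x. F' (G z x) + F z (G' x)) z"
proof -
  note Y' = closed_csubspaceD[OF Y]
  obtain M where M: "M > 0" "\<And>x. x \<in> Y \<Longrightarrow> norm (F z x) \<le> M * norm x"
    using bounded_clinear_on_bound[OF lF] by blast
  obtain M' where M': "M' > 0" "\<And>x. x \<in> Y \<Longrightarrow> norm (F' x) \<le> M' * norm x"
    using bounded_clinear_on_bound[OF lF'] by blast
  obtain N where N: "N > 0" "\<And>x. x \<in> Y \<Longrightarrow> norm (G z x) \<le> N * norm x"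
    using bounded_clinear_on_bound[OF lG] by blast
  obtain N' where N': "N' > 0" "\<And>x. x \<in> Y \<Longrightarrow> norm (G' x) \<le> N' * norm x"
    using bounded_clinear_on_bound[OF lG'] by blast
  \<comment> \<open>For \<open>cmod (w - z) \<le> 1\<close> this single constant bounds both
    \<open>G w\<close> and the difference quotient of \<open>G\<close>.\<close>
  define L where "L = N + N' + 1"
  have L: "L > 0" using N N' by (simp add: L_def)
  show ?thesis unfolding has_op_derivative_def
  proof (intro allI impI)
    fix e :: real assume e: "e > 0"
    obtain d1 where d1: "0 < d1" "\<And>w x. cmod (w - z) < d1 \<Longrightarrow> x \<in> Y \<Longrightarrow>
        norm (F w x - F z x - (w - z) *\<^sub>C F' x) \<le> e / (3 * L) * cmod (w - z) * norm x"
      using has_op_derivativeD[OF F, of "e / (3 * L)"] e L by (metis divide_pos_pos mult_pos_pos zero_less_numeral)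
    obtain d2 where d2: "0 < d2" "\<And>w x. cmod (w - z) < d2 \<Longrightarrow> x \<in> Y \<Longrightarrow>
        norm (G w x - G z x - (w - z) *\<^sub>C G' x) \<le> min 1 (e / (3 * M)) * cmod (w - z) * norm x"
      using has_op_derivativeD[OF G, of "min 1 (e / (3 * M))"] e M
      by (metis divide_pos_pos mult_pos_pos zero_less_numeral min_less_iff_conj zero_less_one)
    obtain d3 where d3: "0 < d3" "\<And>w x. cmod (w - z) < d3 \<Longrightarrow> x \<in> Y \<Longrightarrow> G w x \<in> Y"
      using GY unfolding eventually_nhds_metric dist_norm by blast
    define d where "d = min (min d1 d2) (min d3 (min 1 (e / (3 * M' * L))))"
    have d: "d > 0" "d \<le> d1" "d \<le> d2" "d \<le> d3" "d \<le> 1" "d \<le> e / (3 * M' * L)"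
      using d1 d2 d3 e M' L by (auto simp: d_def)
    show "\<exists>d>0. \<forall>w. cmod (w - z) < d \<longrightarrow> (\<forall>x\<in>Y. norm (F w (G w x) - F z (G z x)
        - (w - z) *\<^sub>C (F' (G z x) + F z (G' x))) \<le> e * cmod (w - z) * norm x)"
    proof (intro exI[of _ d] conjI allI impI ballI)
      fix w x assume w: "cmod (w - z) < d" and x: "x \<in> Y"
      let ?h = "cmod (w - z)"
      have gY: "G w x \<in> Y" "G z x \<in> Y" "G' x \<in> Y"
        using d3 d w x bounded_clinear_onD(1)[OF lG] bounded_clinear_onD(1)[OF lG'] by auto
      define R where "R = G w x - G z x - (w - z) *\<^sub>C G' x"
      have R1: "norm R \<le> min 1 (e / (3 * M)) * ?h * norm x" using d2(2)[of w x] w d x by (simp add: R_def)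
      have RY: "R \<in> Y" using gY Y' by (simp add: R_def)
      have "norm R \<le> 1 * ?h * norm x" using R1 mult_right_mono[of "min 1 (e / (3 * M))" 1 "?h * norm x"] by (simp add: mult.assoc)
      moreover have "norm ((w - z) *\<^sub>C G' x) \<le> ?h * (N' * norm x)" using N'(2)[OF x] by (simp add: norm_scaleC mult_left_mono)
      moreover have "G w x - G z x = R + (w - z) *\<^sub>C G' x" by (simp add: R_def)
      ultimately have "norm (G w x - G z x) \<le> ?h * norm x + ?h * (N' * norm x)"
        using norm_triangle_ineq[of R "(w - z) *\<^sub>C G' x"] by simp
      also have "\<dots> = (1 + N') * (?h * norm x)" by (simp add: algebra_simps)
      also have "\<dots> \<le> L * (?h * norm x)" using N N' by (intro mult_right_mono) (auto simp: L_def)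
      finally have D: "norm (G w x - G z x) \<le> L * ?h * norm x" by (simp add: mult.assoc)
      have "norm (G z x) \<le> N * norm x" by (rule N(2)[OF x])
      moreover have "norm (G w x - G z x) \<le> (1 + N') * norm x"
      proof -
        have "?h * norm x + ?h * (N' * norm x) = ?h * ((1 + N') * norm x)" by (simp add: algebra_simps)
        also have "\<dots> \<le> 1 * ((1 + N') * norm x)" using w d N' by (intro mult_right_mono) auto
        finally show ?thesis
          using \<open>norm (G w x - G z x) \<le> ?h * norm x + ?h * (N' * norm x)\<close> by simp
      qed
      ultimately have "norm (G w x) \<le> N * norm x + (1 + N') * norm x"
        using norm_triangle_ineq[of "G w x - G z x" "G z x"] by simp
      also have "\<dots> = (N + 1 + N') * norm x" by (simp add: algebra_simps)
      also have "\<dots> \<le> L * norm x" using N N' by (intro mult_right_mono) (auto simp: L_def)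
      finally have Gw: "norm (G w x) \<le> L * norm x" .
      have "norm (F w (G w x) - F z (G w x) - (w - z) *\<^sub>C F' (G w x)) \<le> e / (3 * L) * ?h * norm (G w x)"
        using d1(2)[of w "G w x"] w d gY by simp
      also have "\<dots> \<le> e / (3 * L) * ?h * (L * norm x)" using e L Gw by (intro mult_left_mono) auto
      also have "\<dots> = e / 3 * ?h * norm x" using L by simp
      finally have T1: "norm (F w (G w x) - F z (G w x) - (w - z) *\<^sub>C F' (G w x)) \<le> e / 3 * ?h * norm x" .
      have "norm ((w - z) *\<^sub>C (F' (G w x - G z x))) \<le> ?h * (M' * (L * ?h * norm x))"
        using M'(2)[of "G w x - G z x"] Y' gY D M'(1)
        by (auto simp: norm_scaleC intro!: mult_left_mono intro: order_trans)
      also have "\<dots> = (M' * L * ?h) * (?h * norm x)" by simp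
      also have "\<dots> \<le> e / 3 * (?h * norm x)"
      proof (rule mult_right_mono)
        have "M' * L * ?h \<le> M' * L * (e / (3 * M' * L))" using w d M' L by (intro mult_left_mono) auto
        then show "M' * L * ?h \<le> e / 3" using M' L by (simp add: field_simps)
      qed simp
      finally have T2: "norm ((w - z) *\<^sub>C (F' (G w x - G z x))) \<le> e / 3 * ?h * norm x" by simp
      have "norm (F z R) \<le> M * (e / (3 * M) * ?h * norm x)"
      proof -
        have "norm (F z R) \<le> M * norm R" by (rule M(2)[OF RY])
        also have "norm R \<le> e / (3 * M) * ?h * norm x"
          using R1 mult_right_mono[of "min 1 (e / (3 * M))" "e / (3 * M)" "?h * norm x"] by (simp add: mult.assoc)
        finally show ?thesis using M(1) by simp
      qed
      then have T3: "norm (F z R) \<le> e / 3 * ?h * norm x" using M(1) by simp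
      have "F z R = F z (G w x) - F z (G z x) - (w - z) *\<^sub>C F z (G' x)"
        unfolding R_def using gY Y' bounded_clinear_onD(3)[OF lF] by (simp add: bounded_clinear_on_diff[OF Y lF])
      then have "F w (G w x) - F z (G z x) - (w - z) *\<^sub>C (F' (G z x) + F z (G' x))
        = (F w (G w x) - F z (G w x) - (w - z) *\<^sub>C F' (G w x)) + (w - z) *\<^sub>C (F' (G w x - G z x)) + F z R"
        using gY by (simp add: bounded_clinear_on_diff[OF Y lF'] scaleC_add_right scaleC.diff_right)
      also have "norm \<dots> \<le> e / 3 * ?h * norm x + e / 3 * ?h * norm x + e / 3 * ?h * norm x"
        using T1 T2 T3 by (intro norm_triangle_le add_mono) auto
      finally show "norm (F w (G w x) - F z (G z x) - (w - z) *\<^sub>C (F' (G z x) + F z (G' x))) \<le> e * ?h * norm x"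
        by (simp add: mult_ac)
    qed (rule d)
  qed
qed

section \<open>Comparison with the operator norm on a subspace\<close>

lemma onorm_on_le:
  assumes "0 \<in> Y" "0 \<le> b" "\<And>x. x \<in> Y \<Longrightarrow> norm (f x) \<le> b * norm x"
  shows "onorm_on Y f \<le> b"
  unfolding onorm_on_def
proof (rule cSUP_least)
  \<comment> \<open>At \<open>x = 0\<close> the quotient is 0 because division by zero gives 0, and
    there \<open>0 \<le> b\<close> is the bound.\<close>
  show "norm (f x) / norm x \<le> b" if "x \<in> Y" for x
    using assms(2) assms(3)[OF that] by (cases "x = 0") (auto simp: divide_le_eq)
qed (use assms in auto)

lemma le_onorm_on:
  assumes Y: "closed_csubspace Y" and f: "bounded_clinear_on Y f"
  shows "x \<in> Y \<Longrightarrow> norm (f x) \<le> onorm_on Y f * norm x" "0 \<le> onorm_on Y f"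
proof -
  obtain M where M: "M > 0" "\<And>x. x \<in> Y \<Longrightarrow> norm (f x) \<le> M * norm x"
    using bounded_clinear_on_bound[OF f] by blast
  have "norm (f x) / norm x \<le> M" if "x \<in> Y" for x
    using M(1) M(2)[OF that] by (cases "x = 0") (auto simp: divide_le_eq)
  then have bdd: "bdd_above ((\<lambda>x. norm (f x) / norm x) ` Y)" by (intro bdd_aboveI2)
  have up: "norm (f x) / norm x \<le> onorm_on Y f" if "x \<in> Y" for x
    unfolding onorm_on_def by (rule cSUP_upper[OF that bdd])
  show "0 \<le> onorm_on Y f" using up[of 0] closed_csubspaceD(2)[OF Y] by simp
  show "norm (f x) \<le> onorm_on Y f * norm x" if "x \<in> Y" for x
    using up[OF that] bounded_clinear_on_zero[OF Y f] by (cases "x = 0") (auto simp: divide_le_eq)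
qed

text \<open>The remainder is \<open>w - z\<close> times the error of the difference quotient.
  Boundedness of \<open>F w\<close> near \<open>z\<close> ensures that \<open>onorm_on\<close> is a
  genuine supremum, not an arbitrary value for an unbounded set.\<close>

lemma has_op_derivative_iff_onorm_on:
  assumes Y: "closed_csubspace Y" and F: "\<forall>\<^sub>F w in nhds z. bounded_clinear_on Y (F w)"
    and F': "bounded_clinear_on Y F'"
  shows "has_op_derivative Y F F' z \<longleftrightarrow>
    ((\<lambda>w. onorm_on Y (\<lambda>x. inverse (w - z) *\<^sub>C (F w x - F z x) - F' x)) \<longlongrightarrow> 0) (at z)"
proof -
  let ?D = "\<lambda>w x. inverse (w - z) *\<^sub>C (F w x - F z x) - F' x"
  have eq: "norm (F w x - F z x - (w - z) *\<^sub>C F' x) = cmod (w - z) * norm (?D w x)" if "w \<noteq> z" for w x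
    using that by (simp add: scaleC.diff_right scaleC_scaleC flip: norm_scaleC)
  have Fz: "bounded_clinear_on Y (F z)" using F by (rule eventually_nhds_x_imp_x)
  have D: "bounded_clinear_on Y (?D w)" if "bounded_clinear_on Y (F w)" for w
  proof -
    have "bounded_clinear_on Y (\<lambda>x. inverse (w - z) *\<^sub>C (F w x + (-1) *\<^sub>C F z x) + (-1) *\<^sub>C F' x)"
      by (intro bounded_clinear_on_add bounded_clinear_on_scaleC that Fz F' Y)
    moreover have "(-1) *\<^sub>C y = - y" for y :: 'a using scaleC.minus_left[of 1 y] by simp
    ultimately show ?thesis by simp
  qed
  show ?thesis
  proof
    assume L: "has_op_derivative Y F F' z"
    show "((\<lambda>w. onorm_on Y (?D w)) \<longlongrightarrow> 0) (at z)"
    proof (rule tendstoI)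
      fix e :: real assume "e > 0"
      then have "e / 2 > 0" by simp
      from has_op_derivativeD[OF L this] obtain d where d: "0 < d"
        "\<And>w x. cmod (w - z) < d \<Longrightarrow> x \<in> Y \<Longrightarrow> norm (F w x - F z x - (w - z) *\<^sub>C F' x) \<le> e / 2 * cmod (w - z) * norm x"
        by blast
      have "\<forall>\<^sub>F w in at z. bounded_clinear_on Y (F w) \<and> w \<in> ball z d \<and> w \<noteq> z"
        using F d(1) by (auto simp: eventually_at_filter intro: eventually_mono[OF eventually_conj[OF F eventually_nhds_in_open[of "ball z d" z]]])
      then show "\<forall>\<^sub>F w in at z. dist (onorm_on Y (?D w)) 0 < e"
      proof eventually_elim
        case (elim w)
        have "onorm_on Y (?D w) \<le> e / 2"
        proof (rule onorm_on_le)
          fix x assume x: "x \<in> Y"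
          have "cmod (w - z) * norm (?D w x) \<le> cmod (w - z) * (e / 2 * norm x)"
            using d(2)[of w x] x elim eq[of w x] by (simp add: dist_norm norm_minus_commute mult_ac)
          then show "norm (?D w x) \<le> e / 2 * norm x" using elim by simp
        qed (use closed_csubspaceD(2)[OF Y] \<open>e > 0\<close> in auto)
        then show ?case using le_onorm_on(2)[OF Y D] elim \<open>e > 0\<close> by auto
      qed
    qed
  next
    assume R: "((\<lambda>w. onorm_on Y (?D w)) \<longlongrightarrow> 0) (at z)"
    show "has_op_derivative Y F F' z"
      unfolding has_op_derivative_def
    proof (intro allI impI)
      fix e :: real assume "e > 0"
      then have "\<forall>\<^sub>F w in at z. onorm_on Y (?D w) < e \<and> bounded_clinear_on Y (F w)"
        using order_tendstoD(2)[OF R] F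
        by (intro eventually_conj) (auto simp: eventually_at_filter elim: eventually_mono)
      then obtain d where d: "d > 0" "\<And>w. w \<noteq> z \<Longrightarrow> dist w z < d \<Longrightarrow> onorm_on Y (?D w) < e \<and> bounded_clinear_on Y (F w)"
        by (auto simp: eventually_at)
      have "norm (F w x - F z x - (w - z) *\<^sub>C F' x) \<le> e * cmod (w - z) * norm x" if "cmod (w - z) < d" "x \<in> Y" for w x
      proof (cases "w = z")
        case False
        then have 1: "onorm_on Y (?D w) < e" "bounded_clinear_on Y (F w)" using d that by (auto simp: dist_norm)
        have "norm (?D w x) \<le> onorm_on Y (?D w) * norm x" by (rule le_onorm_on(1)[OF Y D[OF 1(2)] that(2)])
        also have "\<dots> \<le> e * norm x" using 1 by (intro mult_right_mono) auto
        finally have "cmod (w - z) * norm (?D w x) \<le> cmod (w - z) * (e * norm x)" by (intro mult_left_mono) auto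
        then show ?thesis using eq[OF False, of x] by (simp add: mult_ac)
      qed (simp add: scaleC.zero_left)
      with d(1) show "\<exists>d>0. \<forall>w. cmod (w - z) < d \<longrightarrow> (\<forall>x\<in>Y. norm (F w x - F z x - (w - z) *\<^sub>C F' x)
        \<le> e * cmod (w - z) * norm x)" by blast
    qed
  qed
qed

section \<open>Cauchy's estimate\<close>

text \<open>After the substitution \<open>w = z + exp (\<sigma> + \<i> \<theta>)\<close> the mean over \<open>\<theta>\<close> of the difference quotient
  is independent of \<open>\<sigma>\<close>, since its \<open>\<sigma>\<close>-derivative is the integral of a periodic \<open>\<theta>\<close>-derivative;
  it tends to \<open>f' z\<close> as \<open>\<sigma> \<rightarrow> -\<infinity>\<close>.\<close>

lemma cauchy_estimate:
  fixes f f' :: "complex \<Rightarrow> 'a::cbanach"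
  assumes U: "cball z r \<subseteq> U" and r: "0 < r"
    and der: "\<And>w. w \<in> U \<Longrightarrow> (f has_derivative (\<lambda>h. h *\<^sub>C f' w)) (at w)"
    and cont: "continuous_on U f'"
    and M: "\<And>w. w \<in> cball z r \<Longrightarrow> norm (f w) \<le> M"
  shows "norm (f' z) \<le> 2 * M / r"
proof -
  define e where "e = (\<lambda>\<sigma> \<theta>. exp (Complex \<sigma> \<theta>))"
  \<comment> \<open>Subtracting \<open>f z\<close> keeps the quotient bounded as the radius exp
    \<sigma> tends to 0. On the circle of radius \<open>r\<close> it costs the factor 2 in
    \<open>2 * M / r\<close>.\<close>
  define G where "G = (\<lambda>\<sigma> \<theta>. exp (- Complex \<sigma> \<theta>) *\<^sub>C (f (z + e \<sigma> \<theta>) - f z))"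
  define G' where "G' = (\<lambda>\<sigma> \<theta>. f' (z + e \<sigma> \<theta>) - G \<sigma> \<theta>)"
  let ?B = "cbox 0 (2 * pi)"
  let ?I = "\<lambda>\<sigma>. integral ?B (G \<sigma>)"
  have ne: "cmod (e \<sigma> \<theta>) = exp \<sigma>" for \<sigma> \<theta> by (simp add: e_def)
  have eU: "z + e \<sigma> \<theta> \<in> cball z r" if "\<sigma> \<le> ln r" for \<sigma> \<theta>
    using that r by (simp add: dist_norm ne) (metis exp_le_cancel_iff exp_ln)
  have fcont: "continuous_on U f"
    by (rule continuous_at_imp_continuous_on, rule ballI, rule has_derivative_continuous, rule der)
  \<comment> \<open>One complex derivative in s = \<sigma> + \<i> \<theta> yields both real partial
    derivatives, and the one in \<theta> is \<i> times the one in \<sigma>.\<close>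
  have ds: "((\<lambda>s. exp (- s) *\<^sub>C (f (z + exp s) - f z)) has_derivative
      (\<lambda>h. h *\<^sub>C (f' (z + exp s) - exp (- s) *\<^sub>C (f (z + exp s) - f z)))) (at s)"
    if "z + exp s \<in> U" for s
  proof -
    have "((\<lambda>s. z + exp s) has_derivative (\<lambda>h. h * exp s)) (at s)"
      by (auto intro!: derivative_eq_intros)
    then have 1: "((\<lambda>s. f (z + exp s)) has_derivative (\<lambda>h. (h * exp s) *\<^sub>C f' (z + exp s))) (at s)"
      using der[OF that] by (rule has_derivative_compose)
    have "((\<lambda>s::complex. exp (- s)) has_field_derivative - exp (- s)) (at s)"
      by (auto intro!: derivative_eq_intros)
    then have 2: "((\<lambda>s::complex. exp (- s)) has_derivative (\<lambda>h. - h * exp (- s))) (at s)"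
      unfolding has_field_derivative_def by (rule has_derivative_eq_rhs) (auto simp: fun_eq_iff)
    have "((\<lambda>s. exp (- s) *\<^sub>C (f (z + exp s) - f z)) has_derivative
      (\<lambda>h. exp (- s) *\<^sub>C ((h * exp s) *\<^sub>C f' (z + exp s) - 0) + (- h * exp (- s)) *\<^sub>C (f (z + exp s) - f z))) (at s)"
      by (intro scaleC.FDERIV 2 has_derivative_diff 1 has_derivative_const)
    also have "(\<lambda>h. exp (- s) *\<^sub>C ((h * exp s) *\<^sub>C f' (z + exp s) - 0) + (- h * exp (- s)) *\<^sub>C (f (z + exp s) - f z))
      = (\<lambda>h. h *\<^sub>C (f' (z + exp s) - exp (- s) *\<^sub>C (f (z + exp s) - f z)))"
    proof
      fix h
      have eq: "exp (- s) * (h * exp s) = h" by (simp add: exp_minus)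
      show "exp (- s) *\<^sub>C ((h * exp s) *\<^sub>C f' (z + exp s) - 0) + (- h * exp (- s)) *\<^sub>C (f (z + exp s) - f z)
        = h *\<^sub>C (f' (z + exp s) - exp (- s) *\<^sub>C (f (z + exp s) - f z))"
        by (simp add: scaleC_scaleC eq scaleC.diff_right scaleC.minus_left del: mult_minus_left)
    qed
    finally show ?thesis .
  qed
  have dG: "((\<lambda>\<sigma>. G \<sigma> \<theta>) has_vector_derivative G' \<sigma> \<theta>) (at \<sigma>)"
    "((\<lambda>\<theta>. G \<sigma> \<theta>) has_vector_derivative (\<i> *\<^sub>C G' \<sigma> \<theta>)) (at \<theta>)" if "\<sigma> \<le> ln r" for \<sigma> \<theta>
  proof -
    have zU: "z + exp (Complex \<sigma> \<theta>) \<in> U" using eU[OF that, of \<theta>] U by (auto simp: e_def)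
    have "((\<lambda>\<sigma>. Complex \<sigma> \<theta>) has_derivative (\<lambda>h. of_real h)) (at \<sigma>)"
      unfolding Complex_eq by (auto intro!: derivative_eq_intros)
    from has_derivative_compose[OF this ds[OF zU]]
    show "((\<lambda>\<sigma>. G \<sigma> \<theta>) has_vector_derivative G' \<sigma> \<theta>) (at \<sigma>)"
      by (simp add: has_vector_derivative_def G_def G'_def e_def scaleC_of_real)
    have "((\<lambda>\<theta>. Complex \<sigma> \<theta>) has_derivative (\<lambda>h. of_real h * \<i>)) (at \<theta>)"
      unfolding Complex_eq by (auto intro!: derivative_eq_intros simp: mult.commute)
    from has_derivative_compose[OF this ds[OF zU]]
    show "((\<lambda>\<theta>. G \<sigma> \<theta>) has_vector_derivative (\<i> *\<^sub>C G' \<sigma> \<theta>)) (at \<theta>)"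
      by (simp add: has_vector_derivative_def G_def G'_def e_def flip: scaleC_of_real scaleC_scaleC)
  qed
  have cG: "continuous_on ?B (G \<sigma>)" if "\<sigma> \<le> ln r" for \<sigma>
    by (rule continuous_at_imp_continuous_on, rule ballI, rule has_vector_derivative_continuous, rule dG(2)[OF that])
  let ?D = "{..ln r} \<times> ?B"
  have ce: "continuous_on ?D (\<lambda>x. z + e (fst x) (snd x))"
    unfolding e_def Complex_eq by (intro continuous_intros)
  have ce1: "continuous_on ?D (\<lambda>x. exp (- Complex (fst x) (snd x)))"
    unfolding Complex_eq by (intro continuous_intros)
  have im: "(\<lambda>x. z + e (fst x) (snd x)) ` ?D \<subseteq> U"
  proof (rule image_subsetI)
    fix x assume "x \<in> ?D"
    then have "fst x \<le> ln r" by (auto simp: mem_Times_iff)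
    from eU[OF this] U show "z + e (fst x) (snd x) \<in> U" by (rule subsetD[rotated])
  qed
  have cff: "continuous_on ?D (\<lambda>x. f' (z + e (fst x) (snd x)))"
    "continuous_on ?D (\<lambda>x. f (z + e (fst x) (snd x)))"
    by (rule continuous_on_compose2[OF cont ce im], rule continuous_on_compose2[OF fcont ce im])
  have cG': "continuous_on ?D (\<lambda>(\<sigma>, \<theta>). G' \<sigma> \<theta>)"
    unfolding G'_def G_def split_beta
    by (rule continuous_on_diff[OF cff(1) scaleC.continuous_on[OF ce1 continuous_on_diff[OF cff(2) continuous_on_const]]])
  have "(?I has_vector_derivative 0) (at \<sigma> within {..ln r})" if s: "\<sigma> \<in> {..ln r}" for \<sigma>
  proof -
    have "(?I has_vector_derivative integral ?B (G' \<sigma>)) (at \<sigma> within {..ln r})"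
    proof (rule leibniz_rule_vector_derivative[where f = G and fx = G' and U = "{..ln r}" and a = 0
            and b = "2 * pi" and ?x0.0 = \<sigma>])
      show "((\<lambda>\<sigma>. G \<sigma> \<theta>) has_vector_derivative G' \<sigma> \<theta>) (at \<sigma> within {..ln r})"
        if "\<sigma> \<in> {..ln r}" for \<sigma> \<theta>
        by (rule has_vector_derivative_at_within, rule dG(1)) (use that in simp)
      show "G \<sigma> integrable_on ?B" if "\<sigma> \<in> {..ln r}" for \<sigma>
        by (rule integrable_continuous, rule cG) (use that in simp)
      show "continuous_on ?D (\<lambda>(\<sigma>, \<theta>). G' \<sigma> \<theta>)" by (rule cG')
      show "\<sigma> \<in> {..ln r}" by (rule s)
      show "convex {..ln r}" by simp
    qed
    moreover have "(G' \<sigma> has_integral ((- \<i>) *\<^sub>C G \<sigma> (2 * pi) - (- \<i>) *\<^sub>C G \<sigma> 0)) {0..2 * pi}"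
    proof (rule fundamental_theorem_of_calculus)
      fix \<theta>
      have "((\<lambda>\<theta>. (- \<i>) *\<^sub>C G \<sigma> \<theta>) has_vector_derivative ((- \<i>) *\<^sub>C \<i> *\<^sub>C G' \<sigma> \<theta>)) (at \<theta>)"
        using s by (intro bounded_linear.has_vector_derivative[OF scaleC.bounded_linear_right] dG) auto
      then show "((\<lambda>\<theta>. (- \<i>) *\<^sub>C G \<sigma> \<theta>) has_vector_derivative G' \<sigma> \<theta>) (at \<theta> within {0..2 * pi})"
        by (simp add: scaleC_scaleC has_vector_derivative_at_within)
    qed simp
    moreover have "e \<sigma> (2 * pi) = e \<sigma> 0" "exp (- Complex \<sigma> (2 * pi)) = exp (- Complex \<sigma> 0)"
      by (simp_all add: e_def exp_eq_polar complex_eq_iff)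
    then have "G \<sigma> (2 * pi) = G \<sigma> 0" by (simp add: G_def)
    ultimately show ?thesis by (simp add: integral_unique)
  qed
  then have "\<exists>c. \<forall>\<sigma>\<in>{..ln r}. ?I \<sigma> = c"
    by (intro has_derivative_zero_constant) (auto simp: has_vector_derivative_def)
  then have const: "?I \<sigma> = ?I (ln r)" if "\<sigma> \<le> ln r" for \<sigma> using that by auto
  have nG: "norm (G \<sigma> \<theta>) = norm (f (z + e \<sigma> \<theta>) - f z) / exp \<sigma>" for \<sigma> \<theta>
    by (simp add: G_def norm_scaleC) (simp add: exp_minus divide_inverse mult.commute)
  have bI: "norm (integral ?B h) \<le> b * (2 * pi)" if "continuous_on ?B h" "\<And>\<theta>. norm (h \<theta>) \<le> b" for h :: "real \<Rightarrow> 'a" and b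
    using integral_bound[of 0 "2 * pi" h b] that by simp
  have "norm (?I (ln r)) \<le> (2 * M / r) * (2 * pi)"
  proof (rule bI[OF cG])
    fix \<theta>
    have "norm (f (z + e (ln r) \<theta>) - f z) \<le> 2 * M"
      using norm_triangle_ineq4[of "f (z + e (ln r) \<theta>)" "f z"] M[OF eU, of "ln r" \<theta>] M[of z] r by simp
    then show "norm (G (ln r) \<theta>) \<le> 2 * M / r" using r by (simp add: nG divide_right_mono)
  qed simp
  moreover have "norm (?I (ln r) - (2 * pi) *\<^sub>R f' z) \<le> d * (2 * pi)" if d: "d > 0" for d
  proof -
    have "z \<in> U" using U r by auto
    from der[OF this] d obtain \<delta> where \<delta>: "\<delta> > 0"
      "\<And>y. norm (y - z) < \<delta> \<Longrightarrow> norm (f y - f z - (y - z) *\<^sub>C f' z) \<le> d * norm (y - z)"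
      unfolding has_derivative_at_alt by blast
    \<comment> \<open>A circle inside the radius \<delta> on which the difference quotient is within
      \<open>d\<close> of \<open>f' z\<close>.\<close>
    define \<sigma> where "\<sigma> = min (ln r) (ln (\<delta> / 2))"
    have s: "\<sigma> \<le> ln r" "exp \<sigma> < \<delta>"
      using \<delta>(1) exp_le_cancel_iff[of \<sigma> "ln (\<delta> / 2)"] by (auto simp: \<sigma>_def simp del: exp_le_cancel_iff)
    have "norm (G \<sigma> \<theta> - f' z) \<le> d" for \<theta>
    proof -
      have "G \<sigma> \<theta> - f' z = exp (- Complex \<sigma> \<theta>) *\<^sub>C (f (z + e \<sigma> \<theta>) - f z - e \<sigma> \<theta> *\<^sub>C f' z)"
        by (simp add: G_def e_def scaleC.diff_right scaleC_scaleC flip: exp_add)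
      then have "norm (G \<sigma> \<theta> - f' z) = norm (f (z + e \<sigma> \<theta>) - f z - e \<sigma> \<theta> *\<^sub>C f' z) / exp \<sigma>"
        by (simp add: norm_scaleC) (simp add: exp_minus divide_inverse mult.commute)
      also have "\<dots> \<le> d" using \<delta>(2)[of "z + e \<sigma> \<theta>"] s(2) by (simp add: ne divide_le_eq)
      finally show ?thesis .
    qed
    then have "norm (integral ?B (\<lambda>\<theta>. G \<sigma> \<theta> - f' z)) \<le> d * (2 * pi)"
      by (intro bI continuous_intros cG s(1))
    also have "integral ?B (\<lambda>\<theta>. G \<sigma> \<theta> - f' z) = ?I \<sigma> - (2 * pi) *\<^sub>R f' z"
      using integrable_continuous[OF cG[OF s(1)]] by (subst integral_diff) auto
    finally show ?thesis using const[OF s(1)] by simp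
  qed
  then have "norm (?I (ln r) - (2 * pi) *\<^sub>R f' z) \<le> 0 + d" if "d > 0" for d
  proof -
    have "d / (2 * pi) > 0" using that by simp
    from \<open>\<And>d. d > 0 \<Longrightarrow> norm (?I (ln r) - (2 * pi) *\<^sub>R f' z) \<le> d * (2 * pi)\<close>[OF this] show ?thesis by simp
  qed
  then have "?I (ln r) = (2 * pi) *\<^sub>R f' z" using field_le_epsilon[of "norm (?I (ln r) - (2 * pi) *\<^sub>R f' z)" 0] by simp
  ultimately have "norm ((2 * pi) *\<^sub>R f' z) \<le> (2 * M / r) * (2 * pi)" by simp
  then have "norm (f' z) * (2 * pi) \<le> (2 * M / r) * (2 * pi)" by (simp add: mult.commute)
  then show ?thesis by (rule mult_right_le_imp_le) simp
qed

section \<open>Unbounded operators\<close>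

lemma linear_operatorD:
  assumes "linear_operator T"
  shows "\<And>x y z. (x, y) \<in> T \<Longrightarrow> (x, z) \<in> T \<Longrightarrow> y = z" "(0, 0) \<in> T"
    "\<And>x y x' y'. (x, y) \<in> T \<Longrightarrow> (x', y') \<in> T \<Longrightarrow> (x + x', y + y') \<in> T"
    "\<And>c x y. (x, y) \<in> T \<Longrightarrow> (c *\<^sub>C x, c *\<^sub>C y) \<in> T"
    "\<And>x y x' y'. (x, y) \<in> T \<Longrightarrow> (x', y') \<in> T \<Longrightarrow> (x - x', y - y') \<in> T"
proof -
  show 1: "\<And>x y z. (x, y) \<in> T \<Longrightarrow> (x, z) \<in> T \<Longrightarrow> y = z" "(0, 0) \<in> T"
    and 2: "\<And>x y x' y'. (x, y) \<in> T \<Longrightarrow> (x', y') \<in> T \<Longrightarrow> (x + x', y + y') \<in> T"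
    and 3: "\<And>c x y. (x, y) \<in> T \<Longrightarrow> (c *\<^sub>C x, c *\<^sub>C y) \<in> T"
    using assms by (auto simp: linear_operator_def single_valued_def)
  show "(x - x', y - y') \<in> T" if "(x, y) \<in> T" "(x', y') \<in> T" for x y x' y'
    using 2[OF that(1) 3[OF that(2), of "-1"]] by (simp add: scaleC.minus_left)
qed

lemma closure_seqE:
  fixes x :: "'a::metric_space"
  assumes "x \<in> closure V"
  obtains f where "\<forall>n. f n \<in> V" "f \<longlonglongrightarrow> x"
  using assms unfolding closure_sequential by blast

lemma closure_seqI:
  fixes x :: "'a::metric_space"
  shows "\<forall>n. f n \<in> V \<Longrightarrow> f \<longlonglongrightarrow> x \<Longrightarrow> x \<in> closure V"
  unfolding closure_sequential by blast

lemma closed_csubspace_closure_Domain: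
  assumes T: "linear_operator T"
  shows "closed_csubspace (closure (Domain T))"
proof -
  note T' = linear_operatorD[OF T]
  have "x + y \<in> closure (Domain T)" if x: "x \<in> closure (Domain T)" and y: "y \<in> closure (Domain T)" for x y
  proof -
    obtain f where f: "\<forall>n. f n \<in> Domain T" "f \<longlonglongrightarrow> x" using x by (rule closure_seqE)
    obtain g where g: "\<forall>n. g n \<in> Domain T" "g \<longlonglongrightarrow> y" using y by (rule closure_seqE)
    have "\<forall>n. f n + g n \<in> Domain T" using T'(3) f(1) g(1) by blast
    then show ?thesis using tendsto_add[OF f(2) g(2)] by (rule closure_seqI)
  qed
  moreover have "c *\<^sub>C x \<in> closure (Domain T)" if x: "x \<in> closure (Domain T)" for c x
  proof -
    obtain f where f: "\<forall>n. f n \<in> Domain T" "f \<longlonglongrightarrow> x" using x by (rule closure_seqE)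
    have "\<forall>n. c *\<^sub>C f n \<in> Domain T" using T'(4) f(1) by blast
    then show ?thesis using scaleC.tendsto[OF tendsto_const f(2)] by (rule closure_seqI)
  qed
  ultimately show ?thesis
    using T'(2) closure_subset[of "Domain T"] by (auto simp: closed_csubspace_def)
qed

lemma resolventD:
  assumes l: "l \<in> resolvent_set T"
  shows "(x, y) \<in> T \<Longrightarrow> resolvent T l (l *\<^sub>C x - y) = x"
    and "(resolvent T l y, l *\<^sub>C resolvent T l y - y) \<in> T"
    and "bounded_clinear_on UNIV (resolvent T l)"
proof -
  have ex: "\<exists>!x. (x, y) \<in> shifted l T" for y using l by (simp add: resolvent_set_def)
  have mem: "(resolvent T l y, y) \<in> shifted l T" for y
    unfolding resolvent_def by (rule theI'[OF ex])
  show "resolvent T l (l *\<^sub>C x - y) = x" if "(x, y) \<in> T"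
  proof -
    have "(x, l *\<^sub>C x - y) \<in> shifted l T" using that by (auto simp: shifted_def)
    with mem ex show ?thesis by blast
  qed
  obtain z where z: "(resolvent T l y, z) \<in> T" "y = l *\<^sub>C resolvent T l y - z"
    using mem[of y] by (auto simp: shifted_def)
  have "z = l *\<^sub>C resolvent T l y - y" using z(2) by (simp add: algebra_simps)
  with z(1) show "(resolvent T l y, l *\<^sub>C resolvent T l y - y) \<in> T" by simp
  show "bounded_clinear_on UNIV (resolvent T l)" using l by (simp add: resolvent_set_def)
qed

text \<open>The usual commutation P T \<subseteq> T P of a bounded operator with an unbounded one.
  The two lemmas \<open>preserves_resolvent_commute\<close> and \<open>preservesI_resolvent\<close>
  show that it can be tested with the resolvent at one point.\<close>

definition preserves :: "('a \<Rightarrow> 'a) \<Rightarrow> 'a::cbanach operator \<Rightarrow> bool" where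
  "preserves P T \<longleftrightarrow> bounded_clinear_on UNIV P \<and> (\<forall>x y. (x, y) \<in> T \<longrightarrow> (P x, P y) \<in> T)"

lemma preserves_resolvent_commute:
  assumes "preserves P T" "l \<in> resolvent_set T"
  shows "resolvent T l (P y) = P (resolvent T l y)"
proof -
  have "(P (resolvent T l y), P (l *\<^sub>C resolvent T l y - y)) \<in> T"
    using resolventD(2)[OF assms(2)] assms(1) by (simp add: preserves_def)
  moreover have "P (l *\<^sub>C resolvent T l y - y) = l *\<^sub>C P (resolvent T l y) - P y"
    using assms(1) bounded_clinear_on_diff[OF closed_csubspace_UNIV, of P] bounded_clinear_onD(3)[of UNIV P]
    by (simp add: preserves_def)
  ultimately show ?thesis using resolventD(1)[OF assms(2)] by fastforce
qed

lemma preservesI_resolvent: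
  assumes P: "bounded_clinear_on UNIV P" and l: "l \<in> resolvent_set T"
    and comm: "\<And>y. resolvent T l (P y) = P (resolvent T l y)"
  shows "preserves P T"
  unfolding preserves_def
proof (intro conjI allI impI)
  fix x y assume "(x, y) \<in> T"
  then have x: "x = resolvent T l (l *\<^sub>C x - y)" by (rule resolventD(1)[OF l, symmetric])
  have 1: "P x = resolvent T l (P (l *\<^sub>C x - y))" by (subst x) (rule comm[symmetric])
  have "P (l *\<^sub>C x - y) = l *\<^sub>C P x - P y"
    using bounded_clinear_on_diff[OF closed_csubspace_UNIV P] bounded_clinear_onD(3)[OF P] by simp
  moreover have "(P x, l *\<^sub>C P x - P (l *\<^sub>C x - y)) \<in> T"
    using resolventD(2)[OF l, of "P (l *\<^sub>C x - y)"] unfolding 1[symmetric] .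
  ultimately show "(P x, P y) \<in> T" by simp
qed (rule P)

lemma preserves_resolvent:
  assumes "l \<in> resolvent_set T"
  shows "preserves (resolvent T l) T"
  by (rule preservesI_resolvent[OF resolventD(3)[OF assms] assms]) simp

lemma preserves_closure_Domain:
  assumes P: "preserves P T" and x: "x \<in> closure (Domain T)"
  shows "P x \<in> closure (Domain T)"
proof -
  obtain f where f: "\<forall>n. f n \<in> Domain T" "f \<longlonglongrightarrow> x" using x by (rule closure_seqE)
  have "\<forall>n. P (f n) \<in> Domain T" using f(1) P unfolding preserves_def by blast
  moreover have "bounded_linear P" using P by (simp add: preserves_def bounded_clinear_UNIV_bounded_linear)
  then have "(\<lambda>n. P (f n)) \<longlonglongrightarrow> P x" using f(2) by (rule bounded_linear.tendsto)
  ultimately show ?thesis by (rule closure_seqI)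
qed

lemma vector_derivative_quotient:
  assumes "(f has_vector_derivative v) (at (0::real))"
  shows "((\<lambda>t. (1 / t) *\<^sub>R (f t - f 0)) \<longlongrightarrow> v) (at_right 0)"
proof -
  have "((\<lambda>h. norm (f (0 + h) - f 0 - h *\<^sub>R v) / norm h) \<longlongrightarrow> 0) (at 0)"
    using assms unfolding has_vector_derivative_def has_derivative_at by blast
  then have 1: "((\<lambda>h. norm (f (0 + h) - f 0 - h *\<^sub>R v) / norm h) \<longlongrightarrow> 0) (at_right 0)"
    by (rule tendsto_within_subset) auto
  have "((\<lambda>t. (1 / t) *\<^sub>R (f t - f 0) - v) \<longlongrightarrow> 0) (at_right 0)"
  proof (rule Lim_null_comparison[OF _ 1])
    have "norm ((1 / t) *\<^sub>R (f t - f 0) - v) = norm (f (0 + t) - f 0 - t *\<^sub>R v) / norm t" if "t > 0" for t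
    proof -
      have "(1 / t) *\<^sub>R (f t - f 0) - v = (1 / t) *\<^sub>R (f (0 + t) - f 0 - t *\<^sub>R v)"
        using that by (simp add: scaleR_diff_right)
      then show ?thesis using that by simp
    qed
    then show "\<forall>\<^sub>F t in at_right 0. norm ((1 / t) *\<^sub>R (f t - f 0) - v) \<le> norm (f (0 + t) - f 0 - t *\<^sub>R v) / norm t"
      by (auto simp: eventually_at_filter)
  qed
  then show ?thesis by (simp add: LIM_zero_iff)
qed

text \<open>Differentiability in operator norm gives continuity in operator norm, so the parameter
  and the vector may move at the same time. At 0, where only strong continuity is available, this is
  lost.\<close>

lemma has_op_derivative_tendsto:
  assumes Y: "closed_csubspace Y" and F: "has_op_derivative Y F F' z"
    and Fz: "bounded_clinear_on Y (F z)" and F': "bounded_clinear_on Y F'"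
    and w: "(w \<longlongrightarrow> z) G" and g: "(g \<longlongrightarrow> u) G" "\<forall>\<^sub>F n in G. g n \<in> Y" "u \<in> Y"
  shows "((\<lambda>n. F (w n) (g n)) \<longlongrightarrow> F z u) G"
proof -
  obtain M' where M': "M' > 0" "\<And>x. x \<in> Y \<Longrightarrow> norm (F' x) \<le> M' * norm x"
    using bounded_clinear_on_bound[OF F'] by blast
  obtain d where d: "0 < d" "\<And>w x. cmod (w - z) < d \<Longrightarrow> x \<in> Y \<Longrightarrow>
      norm (F w x - F z x - (w - z) *\<^sub>C F' x) \<le> 1 * cmod (w - z) * norm x"
    using has_op_derivativeD[OF F, of 1] by auto
  have "((\<lambda>n. F (w n) (g n) - F z (g n)) \<longlongrightarrow> 0) G"
  proof (rule Lim_null_comparison)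
    have "\<forall>\<^sub>F n in G. cmod (w n - z) < d" using tendstoD[OF w d(1)] by (simp add: dist_norm)
    then show "\<forall>\<^sub>F n in G. norm (F (w n) (g n) - F z (g n)) \<le> cmod (w n - z) * ((1 + M') * norm (g n))"
      using g(2)
    proof eventually_elim
      case (elim n)
      have "norm (F (w n) (g n) - F z (g n)) \<le> norm (F (w n) (g n) - F z (g n) - (w n - z) *\<^sub>C F' (g n))
          + norm ((w n - z) *\<^sub>C F' (g n))"
        using norm_triangle_ineq[of "F (w n) (g n) - F z (g n) - (w n - z) *\<^sub>C F' (g n)" "(w n - z) *\<^sub>C F' (g n)"] by simp
      also have "\<dots> \<le> cmod (w n - z) * norm (g n) + cmod (w n - z) * (M' * norm (g n))"
        using d(2)[of "w n" "g n"] elim M'(2)[of "g n"] by (intro add_mono) (auto simp: norm_scaleC intro: mult_left_mono)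
      finally show ?case by (simp add: algebra_simps)
    qed
    show "((\<lambda>n. cmod (w n - z) * ((1 + M') * norm (g n))) \<longlongrightarrow> 0) G"
      by (rule tendsto_eq_intros w g refl | simp)+
  qed
  moreover have "((\<lambda>n. F z (g n)) \<longlongrightarrow> F z u) G"
    by (rule bounded_clinear_on_tendsto[OF Y Fz g(2) g(3) g(1)])
  ultimately show ?thesis using tendsto_add by fastforce
qed

lemma has_op_derivative_cong:
  assumes "has_op_derivative Y F F' z" "\<forall>\<^sub>F w in nhds z. \<forall>x\<in>Y. F w x = G w x" "\<And>x. x \<in> Y \<Longrightarrow> F' x = G' x"
  shows "has_op_derivative Y G G' z"
  unfolding has_op_derivative_def
proof (intro allI impI)
  fix e :: real assume "e > 0"
  from has_op_derivativeD[OF assms(1) this] obtain d where d: "0 < d" "\<And>w x. cmod (w - z) < d \<Longrightarrow> x \<in> Y \<Longrightarrow>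
    norm (F w x - F z x - (w - z) *\<^sub>C F' x) \<le> e * cmod (w - z) * norm x" by blast
  obtain d' where d': "0 < d'" "\<And>w x. cmod (w - z) < d' \<Longrightarrow> x \<in> Y \<Longrightarrow> F w x = G w x"
    using assms(2) unfolding eventually_nhds_metric dist_norm by blast
  show "\<exists>d>0. \<forall>w. cmod (w - z) < d \<longrightarrow> (\<forall>x\<in>Y. norm (G w x - G z x - (w - z) *\<^sub>C G' x)
        \<le> e * cmod (w - z) * norm x)"
  proof (intro exI[of _ "min d d'"] conjI allI impI ballI)
    fix w x assume "cmod (w - z) < min d d'" "x \<in> Y"
    then show "norm (G w x - G z x - (w - z) *\<^sub>C G' x) \<le> e * cmod (w - z) * norm x"
      using d(2)[of w x] d'(2)[of w x] d'(2)[of z x] d'(1) assms(3)[of x] by simp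
  qed (use d d' in auto)
qed

section \<open>The given semigroup\<close>

text \<open>The existential data of the resolvent condition are fixed, and the Landau bound is an
  inequality for all \<open>l > \<omega>\<close>, ready for the substitution of \<open>1 / t\<close>
  for \<open>l\<close>.\<close>

locale analytic_operator =
  fixes A :: "'a::cbanach operator" and p \<theta> \<omega> K :: real and S :: "complex \<Rightarrow> 'a \<Rightarrow> 'a"
  assumes A: "closed_operator A"
    and \<theta>: "0 < \<theta>" "\<theta> \<le> pi / 2"
    and S: "analytic_semigroup_on (closure (Domain A)) \<theta> S"
    and gen: "generator_on (closure (Domain A)) S = part_in_closure A"
    and \<omega>: "0 < \<omega>" and K: "0 < K"
    and res: "\<And>l. l > \<omega> \<Longrightarrow> complex_of_real l \<in> resolvent_set A"
    and res_bound: "\<And>l x. l > \<omega> \<Longrightarrow> norm (resolvent A (complex_of_real l) x) \<le> K * l powr (- 1 / p) * norm x"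
begin

abbreviation "Y \<equiv> closure (Domain A)"

lemma linA: "linear_operator A" using A by (simp add: closed_operator_def)

lemmas A_unique = linear_operatorD(1)[OF linA]

lemma Y: "closed_csubspace Y" by (rule closed_csubspace_closure_Domain[OF linA])

lemmas Y' = closed_csubspaceD[OF Y]

lemma dom_Y: "(x, y) \<in> A \<Longrightarrow> x \<in> Y"
  by (rule subsetD[OF closure_subset DomainI])

lemmas S_parts = S[unfolded analytic_semigroup_on_def]

lemma S_bl: "z \<in> sector \<theta> \<Longrightarrow> bounded_clinear_on Y (S z)"
  using conjunct1[OF S_parts] by blast

lemma S_Y: "z \<in> sector \<theta> \<Longrightarrow> x \<in> Y \<Longrightarrow> S z x \<in> Y"
  using bounded_clinear_onD(1)[OF S_bl] by simp

lemma S_add: "z \<in> sector \<theta> \<Longrightarrow> w \<in> sector \<theta> \<Longrightarrow> x \<in> Y \<Longrightarrow> S (z + w) x = S z (S w x)"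
  using S_parts[THEN conjunct2, THEN conjunct2, THEN conjunct1] by blast

lemma S_cont: "x \<in> Y \<Longrightarrow> 0 < \<theta>' \<Longrightarrow> \<theta>' < \<theta> \<Longrightarrow> ((\<lambda>z. S z x) \<longlongrightarrow> x) (at 0 within sector \<theta>')"
  using S_parts[THEN conjunct2, THEN conjunct2, THEN conjunct2, THEN conjunct2] by blast

lemma eventually_sector: "z \<in> sector \<theta> \<Longrightarrow> \<forall>\<^sub>F w in nhds z. w \<in> sector \<theta>"
  using open_sector[OF \<theta>] by (rule eventually_nhds_in_open)

definition S' :: "complex \<Rightarrow> 'a \<Rightarrow> 'a" where
  "S' z = (SOME S'. bounded_clinear_on Y S' \<and> has_op_derivative Y S S' z)"

lemma S':
  assumes z: "z \<in> sector \<theta>"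
  shows "bounded_clinear_on Y (S' z)" "has_op_derivative Y S (S' z) z"
proof -
  obtain S1 where S1: "bounded_clinear_on Y S1"
    "((\<lambda>w. onorm_on Y (\<lambda>x. inverse (w - z) *\<^sub>C (S w x - S z x) - S1 x)) \<longlongrightarrow> 0) (at z)"
    using S_parts[THEN conjunct2, THEN conjunct2, THEN conjunct2, THEN conjunct1] z by blast
  have "\<forall>\<^sub>F w in nhds z. bounded_clinear_on Y (S w)"
    using eventually_sector[OF z] by (rule eventually_mono) (rule S_bl)
  then have "\<exists>S'. bounded_clinear_on Y S' \<and> has_op_derivative Y S S' z"
    using S1 has_op_derivative_iff_onorm_on[OF Y _ S1(1)] by blast
  from someI_ex[OF this] show "bounded_clinear_on Y (S' z)" "has_op_derivative Y S (S' z) z"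
    by (simp_all add: S'_def)
qed

lemma S'_Y: "z \<in> sector \<theta> \<Longrightarrow> x \<in> Y \<Longrightarrow> S' z x \<in> Y"
  using bounded_clinear_onD(1)[OF S'(1)] by simp

lemma S_deriv: "z \<in> sector \<theta> \<Longrightarrow> x \<in> Y \<Longrightarrow> ((\<lambda>w. S w x) has_derivative (\<lambda>h. h *\<^sub>C S' z x)) (at z)"
  using S'(2) by (rule has_op_derivative_pointwise)

section \<open>The derivative of the semigroup and its generator\<close>

lemma S_quotient:
  assumes z: "z \<in> sector \<theta>" and x: "x \<in> Y"
  shows "((\<lambda>t. (1 / t) *\<^sub>R (S (z + of_real t) x - S z x)) \<longlongrightarrow> S' z x) (at_right 0)"
proof -
  have 1: "((\<lambda>t. z + of_real t) has_derivative (\<lambda>h. of_real h)) (at (0::real))"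
    by (auto intro!: derivative_eq_intros)
  have 2: "((\<lambda>w. S w x) has_derivative (\<lambda>h. h *\<^sub>C S' z x)) (at (z + of_real 0))"
    using S_deriv[OF assms] by simp
  have "((\<lambda>t. S (z + of_real t) x) has_vector_derivative S' z x) (at 0)"
    using has_derivative_compose[OF 1 2] by (simp add: has_vector_derivative_def scaleC_of_real)
  from vector_derivative_quotient[OF this] show ?thesis by simp
qed

text \<open>The semigroup law turns the difference quotient of \<open>S\<close> at \<open>z\<close>
  in the real direction into the quotient that defines the generator at \<open>S z x\<close>. This
  is the smoothing of analytic semigroups: all of \<open>Y\<close> is mapped into the
  domain.\<close>

lemma S_gen:
  assumes z: "z \<in> sector \<theta>" and x: "x \<in> Y"
  shows "(S z x, S' z x) \<in> A"
proof -
  have "((\<lambda>t. (1 / t) *\<^sub>R (S (complex_of_real t) (S z x) - S z x)) \<longlongrightarrow> S' z x) (at_right 0)"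
  proof (rule Lim_transform_eventually[OF S_quotient[OF assms]])
    show "\<forall>\<^sub>F t in at_right 0. (1 / t) *\<^sub>R (S (z + of_real t) x - S z x) =
        (1 / t) *\<^sub>R (S (complex_of_real t) (S z x) - S z x)"
    proof -
      have "S (z + of_real t) x = S (complex_of_real t) (S z x)" if "t > 0" for t
        using S_add[OF of_real_in_sector[OF that \<theta>(1)] z x] by (simp only: add.commute)
      then show ?thesis by (auto simp: eventually_at_filter)
    qed
  qed
  then have "(S z x, S' z x) \<in> generator_on Y S"
    unfolding generator_on_def using S_Y[OF z x] S'_Y[OF z x] by blast
  then show ?thesis unfolding gen part_in_closure_def by blast
qed

text \<open>\<open>S z\<close> is bounded on \<open>Y\<close> and may be applied to the limit
  defining the generator; by the semigroup law the result is the derivative at \<open>z\<close>. The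
  condition \<open>y \<in> Y\<close> says that the pair belongs to the part of \<open>A\<close> in
  \<open>Y\<close>.\<close>

lemma S_A:
  assumes z: "z \<in> sector \<theta>" and xy: "(x, y) \<in> A" "y \<in> Y"
  shows "S' z x = S z y"
proof -
  have x: "x \<in> Y" by (rule dom_Y[OF xy(1)])
  have "(x, y) \<in> generator_on Y S" unfolding gen part_in_closure_def using xy by blast
  then have "((\<lambda>t. (1 / t) *\<^sub>R (S (complex_of_real t) x - x)) \<longlongrightarrow> y) (at_right 0)"
    unfolding generator_on_def by blast
  moreover have "\<forall>\<^sub>F t in at_right 0. (1 / t) *\<^sub>R (S (complex_of_real t) x - x) \<in> Y"
  proof -
    have "(1 / t) *\<^sub>R (S (complex_of_real t) x - x) \<in> Y" if "t > 0" for t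
      by (intro Y'(6) Y'(5) S_Y of_real_in_sector that \<theta>(1) x)
    then show ?thesis by (auto simp: eventually_at_filter)
  qed
  ultimately have "((\<lambda>t. S z ((1 / t) *\<^sub>R (S (complex_of_real t) x - x))) \<longlongrightarrow> S z y) (at_right 0)"
    by (intro bounded_clinear_on_tendsto[OF Y S_bl[OF z] _ xy(2)])
  moreover have "\<forall>\<^sub>F t in at_right 0. S z ((1 / t) *\<^sub>R (S (complex_of_real t) x - x)) = (1 / t) *\<^sub>R (S (z + of_real t) x - S z x)"
  proof -
    have "S z ((1 / t) *\<^sub>R (S (complex_of_real t) x - x)) = (1 / t) *\<^sub>R (S (z + of_real t) x - S z x)" if "t > 0" for t
    proof -
      have t: "complex_of_real t \<in> sector \<theta>" using that \<theta> by (simp add: of_real_in_sector)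
      have "S (complex_of_real t) x - x \<in> Y" using S_Y[OF t x] x Y' by simp
      then show ?thesis
        using bounded_clinear_onD(4)[OF S_bl[OF z]] bounded_clinear_on_diff[OF Y S_bl[OF z] S_Y[OF t x] x]
          S_add[OF z t x] by simp
    qed
    then show ?thesis by (auto simp: eventually_at_filter)
  qed
  ultimately have "((\<lambda>t. (1 / t) *\<^sub>R (S (z + of_real t) x - S z x)) \<longlongrightarrow> S z y) (at_right 0)"
    by (rule Lim_transform_eventually)
  from tendsto_unique[OF _ this S_quotient[OF z x]] show ?thesis by simp
qed

text \<open>Both sides are the value of \<open>A\<close> at
  \<open>S (z + w) x = S z (S w x)\<close>, and \<open>A\<close> is single valued.\<close>

lemma S'_add:
  assumes "z \<in> sector \<theta>" "w \<in> sector \<theta>" "x \<in> Y"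
  shows "S' (z + w) x = S z (S' w x)"
proof -
  note zw = sector_add[OF \<theta> assms(1,2)]
  have "S' z (S w x) = S z (S' w x)" by (rule S_A[OF assms(1) S_gen[OF assms(2,3)] S'_Y[OF assms(2,3)]])
  moreover have "(S (z + w) x, S' z (S w x)) \<in> A"
    using S_gen[OF assms(1) S_Y[OF assms(2,3)]] unfolding S_add[OF assms] .
  ultimately show ?thesis using A_unique[OF S_gen[OF zw assms(3)]] by simp
qed

text \<open>If the norms were unbounded near 0, there would be a null sequence in the smaller sector
  along which they exceed every bound. By strong continuity each orbit along it converges and hence
  is bounded, which contradicts uniform boundedness.\<close>

lemma S_locally_bounded:
  assumes \<theta>': "0 < \<theta>'" "\<theta>' < \<theta>"
  obtains r M where "0 < r" "0 < M"
    "\<And>z x. z \<in> sector \<theta>' \<Longrightarrow> cmod z < r \<Longrightarrow> x \<in> Y \<Longrightarrow> norm (S z x) \<le> M * norm x"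
proof -
  have "\<exists>r>0. \<exists>M>0. \<forall>z\<in>sector \<theta>'. cmod z < r \<longrightarrow> (\<forall>x\<in>Y. norm (S z x) \<le> M * norm x)"
  proof (rule ccontr)
    assume neg: "\<not> ?thesis"
    have "\<exists>z. z \<in> sector \<theta>' \<and> cmod z < 1 / Suc n \<and> (\<exists>x\<in>Y. norm (S z x) > real (Suc n) * norm x)" for n
    proof (rule ccontr)
      assume "\<not> ?thesis"
      then have "\<forall>z\<in>sector \<theta>'. cmod z < 1 / Suc n \<longrightarrow> (\<forall>x\<in>Y. norm (S z x) \<le> real (Suc n) * norm x)"
        by (auto simp: not_less)
      moreover have "0 < 1 / real (Suc n)" "0 < real (Suc n)" by auto
      ultimately show False using neg by blast
    qed
    then obtain z where z: "\<And>n. z n \<in> sector \<theta>'" "\<And>n. cmod (z n) < 1 / Suc n"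
      "\<And>n. \<exists>x\<in>Y. norm (S (z n) x) > real (Suc n) * norm x" by metis
    have zs: "z n \<in> sector \<theta>" for n by (rule sector_mono[OF less_imp_le[OF \<theta>'(2)] z(1)])
    have z0: "z \<longlonglongrightarrow> 0"
      by (rule Lim_null_comparison[OF _ LIMSEQ_inverse_real_of_nat])
         (use z(2) in \<open>auto simp: inverse_eq_divide less_imp_le\<close>)
    have zlim: "filterlim z (at 0 within sector \<theta>') sequentially"
      unfolding filterlim_at using z(1) z0 by (auto simp: sector_def)
    have "\<exists>b. \<forall>n\<in>UNIV. norm (S (z n) x) \<le> b" if "x \<in> Y" for x
    proof -
      have "(\<lambda>n. S (z n) x) \<longlonglongrightarrow> x"
        by (rule filterlim_compose[OF S_cont[OF that \<theta>'] zlim])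
      then have "Bseq (\<lambda>n. S (z n) x)" by (intro convergent_imp_Bseq) (auto simp: convergent_def)
      then show ?thesis by (auto simp: Bseq_def)
    qed
    then obtain M where M: "M > 0" "\<And>n x. x \<in> Y \<Longrightarrow> norm (S (z n) x) \<le> M * norm x"
      using uniform_boundedness_on[OF Y, of UNIV "\<lambda>n. S (z n)"] S_bl[OF zs] by auto
    obtain n where n: "real n > M" using reals_Archimedean2 by blast
    obtain x where x: "x \<in> Y" "norm (S (z n) x) > real (Suc n) * norm x" using z(3) by blast
    have "M * norm x \<le> real (Suc n) * norm x" using n by (intro mult_right_mono) auto
    with M(2)[OF x(1), of n] x(2) show False by simp
  qed
  then show ?thesis using that by blast
qed

lemma S_continuous_at_0:
  assumes z: "z \<in> sector \<theta>" and x: "x \<in> Y"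
  shows "((\<lambda>s. S (z * of_real s) x) \<longlongrightarrow> x) (at_right 0)"
proof -
  \<comment> \<open>Halfway between the angle of \<open>z\<close> and \<theta>: strong continuity at
    0 is given only in strictly smaller sectors, and this one still contains the ray through
    \<open>z\<close>.\<close>
  define \<theta>' where "\<theta>' = (\<bar>Arg z\<bar> + \<theta>) / 2"
  have \<theta>': "0 < \<theta>'" "\<theta>' < \<theta>" "\<bar>Arg z\<bar> < \<theta>'" "z \<noteq> 0" using z \<theta> by (auto simp: \<theta>'_def sector_def)
  then have "z \<in> sector \<theta>'" by (simp add: sector_def)
  then have "\<forall>\<^sub>F s in at_right 0. z * of_real s \<in> sector \<theta>' \<and> z * of_real s \<noteq> 0"
    using sector_scale[of _ z \<theta>'] \<theta>'(4) by (auto simp: eventually_at_filter mult.commute)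
  moreover have "((\<lambda>s. z * of_real s) \<longlongrightarrow> 0) (at_right 0)"
    by (auto intro!: tendsto_eq_intros)
  ultimately have "filterlim (\<lambda>s. z * of_real s) (at 0 within sector \<theta>') (at_right 0)"
    unfolding filterlim_at by (auto elim: eventually_mono)
  from filterlim_compose[OF S_cont[OF x \<theta>'(1,2)] this] show ?thesis .
qed

text \<open>The function \<open>v\<close> interpolates between the two sides and has derivative zero.\<close>

lemma S_commute:
  assumes P: "preserves P A" and z: "z \<in> sector \<theta>" and x: "x \<in> Y"
  shows "S z (P x) = P (S z x)"
proof -
  have P1: "bounded_clinear_on UNIV P" and P2: "\<And>x y. (x, y) \<in> A \<Longrightarrow> (P x, P y) \<in> A"
    using P by (auto simp: preserves_def)
  have PY: "P y \<in> Y" if "y \<in> Y" for y using preserves_closure_Domain[OF P that] .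
  have P3: "bounded_clinear_on Y P"
    using P1 PY by (auto simp: bounded_clinear_on_def)
  define v where "v = (\<lambda>s::complex. S (z + (- z) * s) (P (S (0 + z * s) x)))"
  have zs: "z * of_real s \<in> sector \<theta>" "z + (- z) * of_real s \<in> sector \<theta>" if "0 < s" "s < 1" for s :: real
    using sector_scale[OF that(1) z] sector_scale[of "1 - s" z \<theta>] that z by (auto simp: algebra_simps)
  have der: "(v has_derivative (\<lambda>h. 0)) (at (of_real s))" if s: "0 < s" "s < 1" for s :: real
  proof -
    let ?a = "z * of_real s" and ?b = "z + (- z) * of_real s"
    have a: "?a \<in> sector \<theta>" "?b \<in> sector \<theta>" using zs[OF s] .
    have G: "has_op_derivative Y (\<lambda>s. S (0 + z * s)) (\<lambda>x. z *\<^sub>C S' ?a x) (of_real s)"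
      using S'(2)[OF a(1)] by (intro has_op_derivative_affine) simp
    have lG: "bounded_clinear_on Y (\<lambda>x. z *\<^sub>C S' ?a x)" by (rule bounded_clinear_on_scaleC[OF Y S'(1)[OF a(1)]])
    have cP: "has_op_derivative Y (\<lambda>s. P) (\<lambda>x. 0) (of_real s)"
      by (auto simp: has_op_derivative_def scaleC.zero_right intro: exI[of _ 1])
    have 0: "bounded_clinear_on Y (\<lambda>x. 0)"
      using Y' by (auto simp: bounded_clinear_on_def scaleC.zero_right intro: exI[of _ 0])
    have "((\<lambda>w. 0 + z * w) \<longlongrightarrow> 0 + z * of_real s) (nhds (complex_of_real s))"
      by (intro tendsto_intros filterlim_ident)
    from eventually_compose_filterlim[OF eventually_sector this] a(1)
    have ev: "\<forall>\<^sub>F w in nhds (of_real s). 0 + z * w \<in> sector \<theta>" by simp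
    have PG: "has_op_derivative Y (\<lambda>s x. P (S (0 + z * s) x)) (\<lambda>x. 0 + P (z *\<^sub>C S' ?a x)) (of_real s)"
      using has_op_derivative_comp[OF Y cP G P3 0 _ lG] S_bl[OF a(1)] eventually_mono[OF ev] S_Y by simp
    have F: "has_op_derivative Y (\<lambda>s. S (z + (- z) * s)) (\<lambda>x. (- z) *\<^sub>C S' ?b x) (of_real s)"
      by (rule has_op_derivative_affine[OF S'(2)[OF a(2)]])
    have "has_op_derivative Y (\<lambda>s x. S (z + (- z) * s) (P (S (0 + z * s) x)))
        (\<lambda>x. (- z) *\<^sub>C S' ?b (P (S (0 + z * of_real s) x)) + S ?b (0 + P (z *\<^sub>C S' ?a x))) (of_real s)"
    proof (rule has_op_derivative_comp[OF Y F PG S_bl[OF a(2)] bounded_clinear_on_scaleC[OF Y S'(1)[OF a(2)]]])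
      show "bounded_clinear_on Y (\<lambda>x. P (S (0 + z * complex_of_real s) x))"
        using bounded_clinear_on_comp[OF P3 S_bl[OF a(1)]] by simp
      show "bounded_clinear_on Y (\<lambda>x. 0 + P (z *\<^sub>C S' ?a x))"
        using bounded_clinear_on_comp[OF P3 lG] by simp
      show "\<forall>\<^sub>F w in nhds (complex_of_real s). \<forall>x\<in>Y. P (S (0 + z * w) x) \<in> Y"
        using ev by (rule eventually_mono) (use S_Y PY in auto)
    qed
    from has_op_derivative_pointwise[OF this x]
    have "(v has_derivative (\<lambda>h. h *\<^sub>C ((- z) *\<^sub>C S' ?b (P (S (0 + z * of_real s) x)) + S ?b (0 + P (z *\<^sub>C S' ?a x))))) (at (of_real s))"
      by (simp add: v_def)
    moreover have "(- z) *\<^sub>C S' ?b (P (S (0 + z * of_real s) x)) + S ?b (0 + P (z *\<^sub>C S' ?a x)) = 0"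
    proof -
      \<comment> \<open>\<open>P\<close> maps the pair formed by \<open>S ?a x\<close> and
        \<open>S' ?a x\<close> into \<open>A\<close> again, so both summands are multiples of the
        same vector by \<open>- z\<close> and \<open>z\<close>.\<close>
      have "S' ?b (P (S ?a x)) = S ?b (P (S' ?a x))"
        by (rule S_A[OF a(2) P2[OF S_gen[OF a(1) x]]]) (rule PY[OF S'_Y[OF a(1) x]])
      moreover have "S ?b (P (z *\<^sub>C S' ?a x)) = z *\<^sub>C S ?b (P (S' ?a x))"
        using bounded_clinear_onD(3)[OF P1] bounded_clinear_onD(3)[OF S_bl[OF a(2)] PY[OF S'_Y[OF a(1) x]]] by simp
      ultimately show ?thesis by (simp add: scaleC.minus_left)
    qed
    ultimately show ?thesis by (simp only: scaleC.zero_right)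
  qed
  \<comment> \<open>At the two ends of [0, 1] one of the parameters becomes 0 and leaves the sector.
    Constancy therefore holds on the open interval, and the end values are one-sided limits.\<close>
  define u where "u = (\<lambda>s::real. v (of_real s))"
  have "(u has_derivative (\<lambda>h. 0)) (at s within {0<..<1})" if s: "s \<in> {0<..<1}" for s
  proof -
    have 1: "(complex_of_real has_derivative complex_of_real) (at s)" by (auto intro!: derivative_eq_intros)
    have "(v has_derivative (\<lambda>h. 0)) (at (of_real s))" using s by (intro der) auto
    from has_derivative_compose[OF 1 this] show ?thesis
      unfolding u_def by (rule has_derivative_at_withinI)
  qed
  then have "\<exists>c. \<forall>s\<in>{0<..<1}. u s = c" by (intro has_derivative_zero_constant) auto
  then obtain c where c: "\<And>s. 0 < s \<Longrightarrow> s < 1 \<Longrightarrow> u s = c"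
    by auto
  have ev01: "\<forall>\<^sub>F s::real in at_right 0. 0 < s \<and> s < 1"
    unfolding eventually_at_right_field by (intro exI[of _ 1]) auto
  have "(u \<longlongrightarrow> S z (P x)) (at_right 0)"
    unfolding u_def v_def
  proof (rule has_op_derivative_tendsto[OF Y S'(2)[OF z] S_bl[OF z] S'(1)[OF z]])
    show "((\<lambda>s. z + - z * complex_of_real s) \<longlongrightarrow> z) (at_right 0)" by (auto intro!: tendsto_eq_intros)
    show "((\<lambda>s. P (S (0 + z * complex_of_real s) x)) \<longlongrightarrow> P x) (at_right 0)"
      using bounded_linear.tendsto[OF bounded_clinear_UNIV_bounded_linear[OF P1] S_continuous_at_0[OF z x]] by simp
    show "\<forall>\<^sub>F s in at_right 0. P (S (0 + z * complex_of_real s) x) \<in> Y"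
      using ev01 by (rule eventually_mono) (use zs S_Y x PY in auto)
  qed (rule PY[OF x])
  moreover have "\<forall>\<^sub>F s in at_right 0. u s = c"
    using ev01 by (rule eventually_mono) (use c in auto)
  ultimately have "((\<lambda>s. c) \<longlongrightarrow> S z (P x)) (at_right (0::real))"
    by (rule Lim_transform_eventually)
  then have e1: "c = S z (P x)" by (simp add: tendsto_const_iff)
  define g where "g = (\<lambda>s::real. P (S (z * of_real (1 - s)) x))"
  have gY: "g s \<in> Y" if "0 < s" "s < 1" for s using zs[of "1 - s"] that S_Y x PY by (simp add: g_def)
  have u1: "u (1 - s) = S (z * of_real s) (g s)" for s
    by (simp add: u_def v_def g_def algebra_simps)
  have glim: "(g \<longlongrightarrow> P (S z x)) (at_right 0)"
    unfolding g_def
  proof (rule bounded_linear.tendsto[OF bounded_clinear_UNIV_bounded_linear[OF P1]])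
    show "((\<lambda>s. S (z * complex_of_real (1 - s)) x) \<longlongrightarrow> S z x) (at_right 0)"
    proof (rule has_op_derivative_tendsto[OF Y S'(2)[OF z] S_bl[OF z] S'(1)[OF z] _ tendsto_const])
      show "((\<lambda>s. z * complex_of_real (1 - s)) \<longlongrightarrow> z) (at_right 0)" by (auto intro!: tendsto_eq_intros)
    qed (use x in auto)
  qed
  have PSY: "P (S z x) \<in> Y" using PY S_Y z x by blast
  \<comment> \<open>Here \<open>S (z * of_real s)\<close> converges only strongly while its argument
    \<open>g s\<close> moves. The norm bound near 0 in a smaller sector containing \<open>z\<close>
    allows \<open>g s\<close> to be replaced by its limit.\<close>
  define \<theta>' where "\<theta>' = (\<bar>Arg z\<bar> + \<theta>) / 2"
  have \<theta>': "0 < \<theta>'" "\<theta>' < \<theta>" "z \<in> sector \<theta>'" using z \<theta> by (auto simp: \<theta>'_def sector_def)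
  obtain r M where rM: "0 < r" "0 < M"
    "\<And>z x. z \<in> sector \<theta>' \<Longrightarrow> cmod z < r \<Longrightarrow> x \<in> Y \<Longrightarrow> norm (S z x) \<le> M * norm x"
    using S_locally_bounded[OF \<theta>'(1,2)] by blast
  have ev: "\<forall>\<^sub>F s in at_right 0. 0 < s \<and> s < 1 \<and> cmod (z * of_real s) < r"
  proof -
    have "((\<lambda>s. cmod (z * of_real s)) \<longlongrightarrow> 0) (at_right (0::real))" by (auto intro!: tendsto_eq_intros)
    then have "\<forall>\<^sub>F s::real in at_right 0. cmod (z * of_real s) < r" using rM(1) by (rule order_tendstoD)
    with ev01 show ?thesis by eventually_elim auto
  qed
  have "((\<lambda>s. S (z * of_real s) (g s) - S (z * of_real s) (P (S z x))) \<longlongrightarrow> 0) (at_right 0)"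
  proof (rule Lim_null_comparison)
    show "\<forall>\<^sub>F s in at_right 0. norm (S (z * of_real s) (g s) - S (z * of_real s) (P (S z x))) \<le> M * norm (g s - P (S z x))"
      using ev
    proof eventually_elim
      case (elim s)
      have "z * of_real s \<in> sector \<theta>'" using sector_scale[of s z \<theta>'] \<theta>' elim by (simp add: mult.commute)
      then have "norm (S (z * of_real s) (g s - P (S z x))) \<le> M * norm (g s - P (S z x))"
        using rM(3)[of "z * of_real s" "g s - P (S z x)"] elim gY[of s] PSY Y' by auto
      then show ?case using bounded_clinear_on_diff[OF Y S_bl[OF zs(1)] gY PSY] elim by simp
    qed
    show "((\<lambda>s. M * norm (g s - P (S z x))) \<longlongrightarrow> 0) (at_right 0)"
      using glim by (intro tendsto_mult_right_zero tendsto_norm_zero) (simp add: LIM_zero_iff)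
  qed
  from tendsto_add[OF this S_continuous_at_0[OF z PSY]]
  have "((\<lambda>s. u (1 - s)) \<longlongrightarrow> P (S z x)) (at_right 0)" by (simp add: u1)
  moreover have "\<forall>\<^sub>F s in at_right 0. u (1 - s) = c"
    using ev by (rule eventually_mono) (use c in auto)
  ultimately have "((\<lambda>s. c) \<longlongrightarrow> P (S z x)) (at_right (0::real))" by (rule Lim_transform_eventually)
  then have "c = P (S z x)" by (simp add: tendsto_const_iff)
  with e1 show ?thesis by simp
qed

text \<open>Near \<open>w\<close> the semigroup law gives S' z = S (z - w/2) S' (w/2), so the
  derivative inherits the continuity of \<open>S\<close> at \<open>w / 2\<close>. This supplies the
  continuity hypothesis of \<open>cauchy_estimate\<close>.\<close>

lemma S'_continuous:
  assumes x: "x \<in> Y"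
  shows "continuous_on (sector \<theta>) (\<lambda>z. S' z x)"
proof (rule continuous_at_imp_continuous_on, rule ballI)
  fix w assume w: "w \<in> sector \<theta>"
  have h: "w / 2 \<in> sector \<theta>" using sector_scale[of "1/2" w \<theta>] w by simp
  have "isCont (\<lambda>z. z - w / 2) w" by (intro continuous_intros)
  moreover have "isCont (\<lambda>z. S z (S' (w / 2) x)) (w - w / 2)"
    using has_derivative_continuous[OF S_deriv[OF h S'_Y[OF h x]]] by simp
  ultimately have "isCont (\<lambda>z. S (z - w / 2) (S' (w / 2) x)) w" by (rule isCont_o2)
  moreover have "\<forall>\<^sub>F z in nhds w. S (z - w / 2) (S' (w / 2) x) = S' z x"
  proof -
    have "((\<lambda>z. z - w / 2) \<longlongrightarrow> w / 2) (nhds w)"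
    proof -
      have "((\<lambda>z. z - w / 2) \<longlongrightarrow> w - w / 2) (nhds w)" by (intro tendsto_diff filterlim_ident tendsto_const)
      then show ?thesis by simp
    qed
    from eventually_compose_filterlim[OF eventually_sector[OF h] this]
    have "\<forall>\<^sub>F z in nhds w. z - w / 2 \<in> sector \<theta>" .
    then show ?thesis
    proof eventually_elim
      case (elim z)
      then show ?case using S'_add[OF elim h x] by (simp add: field_simps)
    qed
  qed
  ultimately show "isCont (\<lambda>z. S' z x) w" using isCont_cong by force
qed

text \<open>The disc about t with radius proportional to t lies in a smaller sector, where
  \<open>S\<close> is bounded near 0, so Cauchy's estimate costs a factor of order 1/t. This is the
  standard bound for A S(t).\<close>

lemma S'_bound:
  obtains t0 C where "0 < t0" "0 < C"
    "\<And>t x. 0 < t \<Longrightarrow> t \<le> t0 \<Longrightarrow> x \<in> Y \<Longrightarrow> norm (S (of_real t) x) \<le> C * norm x"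
    "\<And>t x. 0 < t \<Longrightarrow> t \<le> t0 \<Longrightarrow> x \<in> Y \<Longrightarrow> norm (S' (of_real t) x) \<le> C / t * norm x"
proof -
  have h: "0 < \<theta> / 2" "\<theta> / 2 < \<theta>" "\<theta> / 2 \<le> pi / 2" using \<theta> by auto
  obtain r M where rM: "0 < r" "0 < M"
    "\<And>z x. z \<in> sector (\<theta> / 2) \<Longrightarrow> cmod z < r \<Longrightarrow> x \<in> Y \<Longrightarrow> norm (S z x) \<le> M * norm x"
    using S_locally_bounded[OF h(1,2)] by blast
  \<comment> \<open>Half the distance from 1 to the boundary of the sector of angle
    \<open>\<theta> / 2\<close>, so that even the closed disc of radius \<open>t * s\<close> about t
    is inside. Since \<open>s < 1\<close>, this disc stays within modulus \<open>2 * t\<close>,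
    below \<open>r\<close> for \<open>t \<le> r / 3\<close>.\<close>
  define s where "s = sin (\<theta> / 2) / 2"
  have s: "0 < s" "s < 1" using h \<theta> sin_gt_zero[of "\<theta> / 2"] order.strict_trans1[OF sin_le_one[of "\<theta> / 2"], of 2] by (auto simp: s_def)
  have 1: "norm (S (of_real t) x) \<le> M * norm x" if "0 < t" "t \<le> r / 3" "x \<in> Y" for t x
    using rM(3)[of "of_real t" x] rM(1) of_real_in_sector[of t "\<theta> / 2"] h that by auto
  have 2: "norm (S' (of_real t) x) \<le> (2 * M / s) / t * norm x" if t: "0 < t" "t \<le> r / 3" "x \<in> Y" for t x
  proof -
    have in_sec: "w \<in> sector (\<theta> / 2)" "cmod w < r" if w: "w \<in> cball (of_real t) (t * s)" for w
    proof -
      have le: "cmod (w - of_real t) \<le> t * s" using w by (simp add: dist_norm norm_minus_commute)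
      also have "\<dots> < t * sin (\<theta> / 2)" using s(1) t by (simp add: s_def)
      finally show "w \<in> sector (\<theta> / 2)" by (rule ball_in_sector[OF h(1,3)])
      have "t * s \<le> t" using s t by simp
      moreover have "cmod (complex_of_real t) = t" using t by simp
      ultimately have "cmod w \<le> 2 * t" using le norm_triangle_sub[of w "complex_of_real t"] by linarith
      then show "cmod w < r" using t rM by simp
    qed
    have "norm (S' (of_real t) x) \<le> 2 * (M * norm x) / (t * s)"
    proof (rule cauchy_estimate[where f = "\<lambda>w. S w x" and U = "sector \<theta>"])
      show "cball (complex_of_real t) (t * s) \<subseteq> sector \<theta>" using in_sec sector_mono[of "\<theta> / 2" \<theta>] h by auto
      show "continuous_on (sector \<theta>) (\<lambda>w. S' w x)" by (rule S'_continuous[OF t(3)])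
    qed (use S_deriv t s in_sec rM in auto)
    then show ?thesis by (simp add: field_simps)
  qed
  define C where "C = max M (2 * M / s)"
  have "norm (S (of_real t) x) \<le> C * norm x" "norm (S' (of_real t) x) \<le> C / t * norm x"
    if "0 < t" "t \<le> r / 3" "x \<in> Y" for t x
  proof -
    have "M * norm x \<le> C * norm x" by (intro mult_right_mono) (auto simp: C_def)
    then show "norm (S (of_real t) x) \<le> C * norm x" using 1[OF that] by simp
    have "(2 * M / s) / t * norm x \<le> C / t * norm x"
      using that by (intro mult_right_mono divide_right_mono) (auto simp: C_def)
    then show "norm (S' (of_real t) x) \<le> C / t * norm x" using 2[OF that] by simp
  qed
  then show ?thesis using that[of "r / 3" C] rM by (auto simp: C_def)
qed

end

section \<open>The extension of the semigroup to the whole space\<close>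

text \<open>The interface through which the sum sees a single operator, with
  \<open>q = 1 / p\<close>. Boundedness holds on the whole space with a possible singularity at 0,
  whereas the derivative and the behaviour at 0 concern only the closure of the domain.\<close>

locale extended_semigroup =
  fixes A :: "'a::cbanach operator" and q \<theta> :: real and T T' :: "complex \<Rightarrow> 'a \<Rightarrow> 'a"
  assumes A: "closed_operator A" and \<theta>: "0 < \<theta>" "\<theta> \<le> pi / 2"
    and T_bl: "z \<in> sector \<theta> \<Longrightarrow> bounded_clinear_on UNIV (T z)"
    and T'_bl: "z \<in> sector \<theta> \<Longrightarrow> bounded_clinear_on (closure (Domain A)) (T' z)"
    and T_add: "z \<in> sector \<theta> \<Longrightarrow> w \<in> sector \<theta> \<Longrightarrow> T (z + w) x = T z (T w x)"
    and T_A: "z \<in> sector \<theta> \<Longrightarrow> (x, y) \<in> A \<Longrightarrow> (T z x, T z y) \<in> A"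
    and T_deriv: "z \<in> sector \<theta> \<Longrightarrow> has_op_derivative (closure (Domain A)) T (T' z) z"
    and T'_eq: "z \<in> sector \<theta> \<Longrightarrow> (x, y) \<in> A \<Longrightarrow> T' z x = T z y"
    and T_cont: "x \<in> closure (Domain A) \<Longrightarrow> 0 < \<theta>' \<Longrightarrow> \<theta>' < \<theta> \<Longrightarrow> ((\<lambda>z. T z x) \<longlongrightarrow> x) (at 0 within sector \<theta>')"
    and T_loc_bdd: "0 < \<theta>' \<Longrightarrow> \<theta>' < \<theta> \<Longrightarrow> \<exists>r>0. \<exists>M>0. \<forall>z\<in>sector \<theta>'. cmod z < r \<longrightarrow>
      (\<forall>x\<in>closure (Domain A). norm (T z x) \<le> M * norm x)"
    and T_bound: "\<exists>K>0. \<exists>\<omega>>0. \<forall>t>0. \<forall>x. norm (T (of_real t) x) \<le> K * t powr (q - 1) * exp (\<omega> * t) * norm x"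
    and T_commute: "z \<in> sector \<theta> \<Longrightarrow> preserves P A \<Longrightarrow> T z (P x) = P (T z x)"

context analytic_operator
begin

definition R :: "'a \<Rightarrow> 'a" where "R = resolvent A (of_real (\<omega> + 1))"

lemma mu: "complex_of_real (\<omega> + 1) \<in> resolvent_set A" by (rule res) simp

lemmas R = resolventD[OF mu, folded R_def]

lemma R_inj: "R x = R y \<Longrightarrow> x = y"
  using R(2)[of x] R(2)[of y] A_unique by fastforce

lemma R_Y: "R x \<in> Y" by (rule dom_Y[OF R(2)])

text \<open>This is (\<mu> - A) S(z) (\<mu> - A)\<inverse> for \<mu> = \<omega> + 1, with A S(z)
  expressed by the derivative of \<open>S\<close>.\<close>

definition T :: "complex \<Rightarrow> 'a \<Rightarrow> 'a" where
  "T z x = of_real (\<omega> + 1) *\<^sub>C S z (R x) - S' z (R x)"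

lemma R_T:
  assumes z: "z \<in> sector \<theta>"
  shows "R (T z x) = S z (R x)"
  unfolding T_def by (rule R(1)[OF S_gen[OF z R_Y]])

text \<open>\<open>R\<close> is injective, so the relation \<open>R (T z x) = S z (R x)\<close>
  determines \<open>T z x\<close>. Linearity, the semigroup law and commutation of \<open>T\<close>
  are all read off from \<open>S\<close> through it.\<close>

lemma T_eqI:
  assumes "z \<in> sector \<theta>" "R v = S z (R x)"
  shows "T z x = v"
  using R_T[OF assms(1)] assms(2) R_inj by metis

lemma T_on_Y: "z \<in> sector \<theta> \<Longrightarrow> x \<in> Y \<Longrightarrow> T z x = S z x"
  using preserves_resolvent[OF mu, folded R_def] by (intro T_eqI) (auto simp: S_commute)

lemma T_preserves_commute:
  assumes "z \<in> sector \<theta>" "preserves P A"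
  shows "T z (P x) = P (T z x)"
proof (rule T_eqI[OF assms(1)])
  have RP: "R (P y) = P (R y)" for y
    using preserves_resolvent_commute[OF assms(2) mu] by (simp add: R_def)
  show "R (P (T z x)) = S z (R (P x))"
    using S_commute[OF assms(2,1) R_Y] by (simp add: RP R_T[OF assms(1)])
qed

text \<open>Independence of the resolvent point. The resolvent at l preserves \<open>A\<close>,
  hence commutes with \<open>T z\<close>, and it maps into \<open>Y\<close>, where
  \<open>T z\<close> is \<open>S z\<close>; applying l - A to the resulting identity gives the
  formula. It makes the choice \<open>l = 1 / t\<close> possible.\<close>

lemma T_resolvent:
  assumes z: "z \<in> sector \<theta>" and l: "l > \<omega>"
  shows "T z x = of_real l *\<^sub>C S z (resolvent A (of_real l) x) - S' z (resolvent A (of_real l) x)"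
proof -
  let ?R = "resolvent A (of_real l)"
  note Rl = resolventD[OF res[OF l]]
  have RY: "?R x \<in> Y" by (rule dom_Y[OF Rl(2)])
  have "?R (T z x) = T z (?R x)" using T_preserves_commute[OF z preserves_resolvent[OF res[OF l]]] by simp
  also have "\<dots> = S z (?R x)" by (rule T_on_Y[OF z RY])
  finally have "(S z (?R x), of_real l *\<^sub>C S z (?R x) - T z x) \<in> A" using Rl(2)[of "T z x"] by simp
  from A_unique[OF S_gen[OF z RY] this] show ?thesis by simp
qed

lemma T_linear:
  assumes z: "z \<in> sector \<theta>"
  shows "bounded_clinear_on UNIV (T z)"
proof -
  have R_add: "R (x + y) = R x + R y" and R_sc: "R (c *\<^sub>C x) = c *\<^sub>C R x" for x y c
    using bounded_clinear_onD[OF R(3)] by auto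
  have "T z (x + y) = T z x + T z y" for x y
    by (rule T_eqI[OF z]) (simp add: R_add R_T[OF z] bounded_clinear_onD(2)[OF S_bl[OF z] R_Y R_Y])
  moreover have "T z (c *\<^sub>C x) = c *\<^sub>C T z x" for c x
    by (rule T_eqI[OF z]) (simp add: R_sc R_T[OF z] bounded_clinear_onD(3)[OF S_bl[OF z] R_Y])
  moreover have "\<exists>M. \<forall>x. norm (T z x) \<le> M * norm x"
  proof -
    obtain M where M: "M > 0" "\<And>x. x \<in> Y \<Longrightarrow> norm (S z x) \<le> M * norm x"
      using bounded_clinear_on_bound[OF S_bl[OF z]] by blast
    obtain N where N: "N > 0" "\<And>x. x \<in> Y \<Longrightarrow> norm (S' z x) \<le> N * norm x"
      using bounded_clinear_on_bound[OF S'(1)[OF z]] by blast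
    obtain L where L: "L > 0" "\<And>x. norm (R x) \<le> L * norm x" using bounded_clinear_on_bound[OF R(3)] by auto
    have "norm (T z x) \<le> (((\<omega> + 1) * M + N) * L) * norm x" for x
    proof -
      have "norm (T z x) \<le> (\<omega> + 1) * norm (S z (R x)) + norm (S' z (R x))"
        unfolding T_def using norm_triangle_ineq4[of "of_real (\<omega> + 1) *\<^sub>C S z (R x)" "S' z (R x)"] \<omega>
        by (simp add: norm_scaleC scaleC_of_real del: of_real_add)
      also have "\<dots> \<le> (\<omega> + 1) * (M * norm (R x)) + N * norm (R x)"
        using M(2)[OF R_Y] N(2)[OF R_Y] \<omega> by (intro add_mono mult_left_mono) auto
      also have "\<dots> = ((\<omega> + 1) * M + N) * norm (R x)" by (simp add: algebra_simps)
      also have "\<dots> \<le> ((\<omega> + 1) * M + N) * (L * norm x)" using L M N \<omega> by (intro mult_left_mono) auto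
      finally show ?thesis by (simp add: mult.assoc)
    qed
    then show ?thesis by blast
  qed
  ultimately show ?thesis by (auto simp: bounded_clinear_on_def)
qed

lemma T_inv:
  assumes z: "z \<in> sector \<theta>" and xy: "(x, y) \<in> A"
  shows "(T z x, T z y) \<in> A"
proof -
  let ?w = "of_real (\<omega> + 1) *\<^sub>C x - y"
  note Tl = T_linear[OF z]
  have x: "x \<in> Y" by (rule dom_Y[OF xy])
  have "R (T z ?w) = S z x" using R_T[OF z, of ?w] R(1)[OF xy] by simp
  also have "\<dots> = T z x" using T_on_Y[OF z x] by simp
  finally have "(T z x, of_real (\<omega> + 1) *\<^sub>C T z x - T z ?w) \<in> A" using R(2)[of "T z ?w"] by simp
  moreover have "T z ?w = of_real (\<omega> + 1) *\<^sub>C T z x - T z y"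
    using bounded_clinear_on_diff[OF closed_csubspace_UNIV Tl] bounded_clinear_onD(3)[OF Tl] by simp
  ultimately show ?thesis by simp
qed

lemma T_semigroup:
  assumes "z \<in> sector \<theta>" "w \<in> sector \<theta>"
  shows "T (z + w) x = T z (T w x)"
  by (rule T_eqI[OF sector_add[OF \<theta> assms]]) (simp add: R_T assms S_add R_Y)

text \<open>For small t the singular bound comes from \<open>T_resolvent\<close> at
  \<open>1 / t\<close>. For large t the semigroup law is iterated with steps bounded away from 0,
  and the polynomial decay of the claimed bound is paid for by an exponential.\<close>

lemma T_growth:
  assumes p: "1 \<le> p"
  shows "\<exists>K>0. \<exists>\<omega>>0. \<forall>t>0. \<forall>x. norm (T (of_real t) x) \<le> K * t powr (1 / p - 1) * exp (\<omega> * t) * norm x"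
proof -
  obtain t0 C where tC: "0 < t0" "0 < C"
    "\<And>t x. 0 < t \<Longrightarrow> t \<le> t0 \<Longrightarrow> x \<in> Y \<Longrightarrow> norm (S (of_real t) x) \<le> C * norm x"
    "\<And>t x. 0 < t \<Longrightarrow> t \<le> t0 \<Longrightarrow> x \<in> Y \<Longrightarrow> norm (S' (of_real t) x) \<le> C / t * norm x"
    using S'_bound by blast
  \<comment> \<open>Below \<open>1 / (\<omega> + 1)\<close> the point \<open>1 / t\<close> exceeds
    \<omega> and lies in the resolvent set.\<close>
  define t1 where "t1 = min t0 (1 / (\<omega> + 1))"
  have t1: "0 < t1" "t1 \<le> t0" "t1 \<le> 1 / (\<omega> + 1)" using tC \<omega> by (auto simp: t1_def)
  define L where "L = 2 * C * K"
  have L: "0 < L" using tC K by (simp add: L_def)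
  have small: "norm (T (of_real t) x) \<le> L * t powr (1 / p - 1) * norm x" if t: "0 < t" "t \<le> t1" for t x
  proof -
    let ?l = "1 / t"
    have l: "?l > \<omega>"
    proof -
      have "t \<le> 1 / (\<omega> + 1)" using t t1(3) by simp
      then have "\<omega> + 1 \<le> ?l" using t \<omega> by (simp add: field_simps)
      then show ?thesis by simp
    qed
    let ?R = "resolvent A (of_real ?l)"
    have sec: "complex_of_real t \<in> sector \<theta>" using t \<theta> by (simp add: of_real_in_sector)
    have RY: "?R x \<in> Y" by (rule dom_Y[OF resolventD(2)[OF res[OF l]]])
    have "norm (T (of_real t) x) \<le> ?l * norm (S (of_real t) (?R x)) + norm (S' (of_real t) (?R x))"
      unfolding T_resolvent[OF sec l] using t norm_triangle_ineq4[of "of_real ?l *\<^sub>C S (of_real t) (?R x)" "S' (of_real t) (?R x)"]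
      by (simp add: norm_scaleC scaleC_of_real del: of_real_divide)
    also have "\<dots> \<le> ?l * (C * norm (?R x)) + C / t * norm (?R x)"
      using tC(3)[of t "?R x"] tC(4)[of t "?R x"] t t1 RY by (intro add_mono mult_left_mono) auto
    also have "\<dots> = (2 * C / t) * norm (?R x)" by (simp add: field_simps)
    also have "\<dots> \<le> (2 * C / t) * (K * ?l powr (- 1 / p) * norm x)"
      using res_bound[OF l] t tC by (intro mult_left_mono) auto
    also have "?l powr (- 1 / p) = t powr (1 / p)"
      using t by (simp add: powr_divide powr_minus_divide)
    also have "(2 * C / t) * (K * t powr (1 / p) * norm x) = L * (t powr (1 / p) / t) * norm x"
      by (simp add: L_def)
    also have "t powr (1 / p) / t = t powr (1 / p - 1)" using t by (simp add: powr_diff)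
    finally show ?thesis .
  qed
  define g where "g = 1 - 1 / p"
  have g: "0 \<le> g" "g < 1" "1 / p - 1 = - g" using p by (auto simp: g_def)
  define M where "M = max 1 (L * (t1 / 2) powr (- g))"
  have M: "M \<ge> 1" by (simp add: M_def)
  have mid: "norm (T (of_real t) x) \<le> M * norm x" if t: "t1 / 2 \<le> t" "t \<le> t1" for t x
  proof -
    have "t powr (- g) \<le> (t1 / 2) powr (- g)" using t t1 g by (intro powr_mono2') auto
    then have "L * t powr (- g) * norm x \<le> L * (t1 / 2) powr (- g) * norm x"
      using L by (intro mult_right_mono mult_left_mono) auto
    also have "\<dots> \<le> M * norm x" by (intro mult_right_mono) (auto simp: M_def)
    finally show ?thesis using small[of t x] t t1 g by simp
  qed
  \<comment> \<open>Steps of length \<open>t1 / 2\<close> are taken only when \<open>t > t1\<close>,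
    so the remaining time stays at least \<open>t1 / 2\<close> and never meets the singularity.
    \<open>M \<ge> 1\<close> makes the powers increasing in \<open>n\<close>.\<close>
  have step: "norm (T (of_real t) x) \<le> M ^ (n + 1) * norm x" if "t1 / 2 \<le> t" "t \<le> t1 + real n * (t1 / 2)" for n t x
    using that
  proof (induction n arbitrary: t x)
    case 0
    then show ?case using mid by simp
  next
    case (Suc n)
    show ?case
    proof (cases "t \<le> t1")
      case True
      have "M ^ 1 \<le> M ^ (Suc n + 1)" using M by (intro power_increasing) auto
      then have "M * norm x \<le> M ^ (Suc n + 1) * norm x" by (intro mult_right_mono) auto
      then show ?thesis using mid[OF Suc.prems(1) True, of x] by simp
    next
      case False
      let ?s = "t - t1 / 2"
      have s: "t1 / 2 \<le> ?s" "?s \<le> t1 + real n * (t1 / 2)" using False Suc.prems(2) by (auto simp: field_simps)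
      have "T (of_real t) x = T (of_real (t1 / 2) + of_real ?s) x" by (simp flip: of_real_add)
      also have "\<dots> = T (of_real (t1 / 2)) (T (of_real ?s) x)"
        using s t1(1) by (intro T_semigroup of_real_in_sector \<theta>(1)) auto
      also have "norm \<dots> \<le> M * norm (T (of_real ?s) x)" using t1 by (intro mid) auto
      also have "\<dots> \<le> M * (M ^ (n + 1) * norm x)" using Suc.IH[OF s] M by (intro mult_left_mono) auto
      finally show ?thesis by simp
    qed
  qed
  \<comment> \<open>About \<open>2 * t / t1\<close> factors of \<open>M\<close> contribute the first
    summand; the additional 1 compensates \<open>t powr (1 - 1 / p) \<le> exp t\<close>.\<close>
  define W where "W = 2 * ln M / t1 + 1"
  have W: "W > 0" using M t1 by (simp add: W_def add_nonneg_pos)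
  define K' where "K' = max L (M ^ 2)"
  have K': "K' > 0" "L \<le> K'" "M ^ 2 \<le> K'" using L by (auto simp: K'_def)
  have "norm (T (of_real t) x) \<le> K' * t powr (1 / p - 1) * exp (W * t) * norm x" if t: "t > 0" for t x
  proof (cases "t \<le> t1")
    case True
    have "norm (T (of_real t) x) \<le> L * t powr (1 / p - 1) * norm x" by (rule small[OF t True])
    also have "\<dots> \<le> K' * t powr (1 / p - 1) * norm x" using K' by (intro mult_right_mono) auto
    also have "\<dots> \<le> K' * t powr (1 / p - 1) * exp (W * t) * norm x"
    proof (rule mult_right_mono)
      have "1 \<le> exp (W * t)" using W t by simp
      then have "K' * t powr (1 / p - 1) * 1 \<le> K' * t powr (1 / p - 1) * exp (W * t)"
        using K' by (intro mult_left_mono) auto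
      then show "K' * t powr (1 / p - 1) \<le> K' * t powr (1 / p - 1) * exp (W * t)" by simp
    qed simp
    finally show ?thesis .
  next
    case False
    define n where "n = nat \<lceil>(t - t1) / (t1 / 2)\<rceil>"
    have n1: "(t - t1) / (t1 / 2) \<le> real n" unfolding n_def by linarith
    have "real n \<le> (t - t1) / (t1 / 2) + 1" unfolding n_def using False t1 by (simp add: nat_ceiling_le_eq)
    then have n2: "real n \<le> 2 * t / t1" using t1 by (simp add: field_simps)
    have "t \<le> t1 + real n * (t1 / 2)" using n1 t1 by (simp add: field_simps)
    then have T_n: "norm (T (of_real t) x) \<le> M ^ (n + 1) * norm x" using False t1 by (intro step) auto
    have "M ^ (n + 1) \<le> M ^ 2 * exp (ln M * (2 * t / t1))"
    proof -
      have "M ^ n = exp (ln M * real n)" using M by (simp add: exp_of_nat2_mult)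
      also have "\<dots> \<le> exp (ln M * (2 * t / t1))"
        unfolding exp_le_cancel_iff using M n2 by (intro mult_left_mono) auto
      finally have "M ^ 2 * M ^ n \<le> M ^ 2 * exp (ln M * (2 * t / t1))" by (intro mult_left_mono) auto
      moreover have "M ^ (n + 1) \<le> M ^ 2 * M ^ n" using M by (simp add: power2_eq_square)
      ultimately show ?thesis by linarith
    qed
    also have "M ^ 2 * exp (ln M * (2 * t / t1)) \<le> K' * exp (ln M * (2 * t / t1))"
      using K' by (intro mult_right_mono) auto
    also have "\<dots> \<le> K' * (t powr (1 / p - 1) * exp t * exp (ln M * (2 * t / t1)))"
    proof -
      have "t powr g \<le> exp t"
      proof (cases "t \<le> 1")
        case True
        then have "t powr g \<le> 1" using t g by (simp add: powr_le1)
        also have "1 \<le> exp t" using t by simp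
        finally show ?thesis .
      next
        case False
        then have "t powr g \<le> t powr 1" using g by (intro powr_mono) auto
        also have "t powr 1 = t" using t by simp
        also have "t \<le> exp t" using exp_ge_add_one_self[of t] by linarith
        finally show ?thesis .
      qed
      then have "1 \<le> t powr (1 / p - 1) * exp t" using t by (simp add: g(3) powr_minus field_simps)
      then have "1 * exp (ln M * (2 * t / t1)) \<le> t powr (1 / p - 1) * exp t * exp (ln M * (2 * t / t1))"
        by (intro mult_right_mono) auto
      then show ?thesis using K' by (intro mult_left_mono) auto
    qed
    also have "\<dots> = K' * t powr (1 / p - 1) * exp (W * t)"
    proof -
      have "exp (W * t) = exp t * exp (ln M * (2 * t / t1))" unfolding exp_add[symmetric] by (simp add: W_def algebra_simps)
      then show ?thesis by simp
    qed
    finally have "M ^ (n + 1) * norm x \<le> K' * t powr (1 / p - 1) * exp (W * t) * norm x"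
      by (rule mult_right_mono) simp
    with T_n show ?thesis by linarith
  qed
  then show ?thesis using K'(1) W by blast
qed

lemma extended:
  assumes "1 \<le> p"
  shows "extended_semigroup A (1 / p) \<theta> T S'"
proof
  show "closed_operator A" by (rule A)
  show "0 < \<theta>" "\<theta> \<le> pi / 2" by (rule \<theta>)+
  show "\<exists>K>0. \<exists>\<omega>>0. \<forall>t>0. \<forall>x. norm (T (of_real t) x) \<le> K * t powr (1 / p - 1) * exp (\<omega> * t) * norm x"
    by (rule T_growth[OF assms])
  show "T z (P x) = P (T z x)" if "z \<in> sector \<theta>" "preserves P A" for z P x by (rule T_preserves_commute[OF that])
  fix z assume z: "z \<in> sector \<theta>"
  show "bounded_clinear_on UNIV (T z)" by (rule T_linear[OF z])
  show "bounded_clinear_on Y (S' z)" by (rule S'(1)[OF z])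
  show "T (z + w) x = T z (T w x)" if "w \<in> sector \<theta>" for w x by (rule T_semigroup[OF z that])
  show "(T z x, T z y) \<in> A" if "(x, y) \<in> A" for x y by (rule T_inv[OF z that])
  have "\<forall>\<^sub>F w in nhds z. \<forall>x\<in>Y. S w x = T w x"
    using eventually_sector[OF z] by (rule eventually_mono) (simp add: T_on_Y)
  then show "has_op_derivative Y T (S' z) z" by (rule has_op_derivative_cong[OF S'(2)[OF z]]) simp
  show "S' z x = T z y" if "(x, y) \<in> A" for x y
    using T_inv[OF z that] S_gen[OF z dom_Y[OF that]] A_unique unfolding T_on_Y[OF z dom_Y[OF that]] by blast
next
  fix \<theta>' assume \<theta>': "0 < \<theta>'" "\<theta>' < \<theta>"
  note m = sector_mono[OF less_imp_le[OF \<theta>'(2)]]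
  show "((\<lambda>z. T z x) \<longlongrightarrow> x) (at 0 within sector \<theta>')" if x: "x \<in> Y" for x
    by (rule Lim_transform_eventually[OF S_cont[OF x \<theta>']])
       (auto simp: eventually_at_filter T_on_Y[OF m x])
  show "\<exists>r>0. \<exists>M>0. \<forall>z\<in>sector \<theta>'. cmod z < r \<longrightarrow> (\<forall>x\<in>Y. norm (T z x) \<le> M * norm x)"
  proof -
    obtain r M where "0 < r" "0 < M"
      "\<And>z x. z \<in> sector \<theta>' \<Longrightarrow> cmod z < r \<Longrightarrow> x \<in> Y \<Longrightarrow> norm (S z x) \<le> M * norm x"
      using S_locally_bounded[OF \<theta>'] by blast
    then show ?thesis using T_on_Y[OF m] by (intro exI[of _ r] exI[of _ M] conjI ballI impI) auto
  qed
qed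

end

section \<open>From the analytic resolvent condition to the extended semigroup\<close>

lemma analytic_resolvent_condition_extended:
  assumes A: "closed_operator A" and p: "1 \<le> p" and arc: "analytic_resolvent_condition A p"
  obtains \<theta> T T' where "extended_semigroup A (1 / p) \<theta> T T'"
proof -
  obtain \<theta> S where S: "0 < \<theta>" "\<theta> \<le> pi / 2" "analytic_semigroup_on (closure (Domain A)) \<theta> S"
    "generator_on (closure (Domain A)) S = part_in_closure A"
    using arc unfolding analytic_resolvent_condition_def generates_analytic_semigroup_on_def by blast
  obtain \<omega> where \<omega>: "\<And>l. l > \<omega> \<Longrightarrow> complex_of_real l \<in> resolvent_set A"
    and O: "(\<lambda>l::real. onorm (resolvent A (complex_of_real l))) \<in> O[at_top](\<lambda>l. l powr (- 1 / p))"
    using arc unfolding analytic_resolvent_condition_def by blast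
  from O obtain c where c: "c > 0"
    "\<forall>\<^sub>F l in at_top. norm (onorm (resolvent A (complex_of_real l))) \<le> c * norm (l powr (- 1 / p))"
    by (elim landau_o.bigE) blast
  then obtain N where N: "\<And>l. l \<ge> N \<Longrightarrow> norm (onorm (resolvent A (complex_of_real l))) \<le> c * norm (l powr (- 1 / p))"
    unfolding eventually_at_top_linorder by blast
  \<comment> \<open>Beyond the threshold for the resolvent set as well as that of the Landau bound,
    and positive as \<open>analytic_operator\<close> demands.\<close>
  define \<omega>' where "\<omega>' = max 1 (max \<omega> N)"
  have w: "\<omega> \<le> \<omega>'" "N \<le> \<omega>'" "0 < \<omega>'" by (auto simp: \<omega>'_def)
  have "analytic_operator A p \<theta> \<omega>' c S"
  proof
    fix l :: real assume l: "l > \<omega>'"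
    show r: "complex_of_real l \<in> resolvent_set A" using \<omega> l w by simp
    fix x
    have bl: "bounded_linear (resolvent A (complex_of_real l))"
      by (rule bounded_clinear_UNIV_bounded_linear[OF resolventD(3)[OF r]])
    have "norm (resolvent A (complex_of_real l) x) \<le> onorm (resolvent A (complex_of_real l)) * norm x"
      by (rule onorm[OF bl])
    also have "\<dots> \<le> c * l powr (- 1 / p) * norm x"
      using N[of l] l w onorm_pos_le[OF bl] by (intro mult_right_mono) auto
    finally show "norm (resolvent A (complex_of_real l) x) \<le> c * l powr (- 1 / p) * norm x" .
  qed (use A S c w in auto)
  from analytic_operator.extended[OF this p] show ?thesis by (rule that)
qed

text \<open>The semigroups of \<open>A\<close> and \<open>B\<close> come with different angles;
  their product is formed on the smaller sector.\<close>

lemma extended_semigroup_mono: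
  assumes "extended_semigroup A q \<theta> T T'" "0 < \<theta>'" "\<theta>' \<le> \<theta>"
  shows "extended_semigroup A q \<theta>' T T'"
proof -
  interpret extended_semigroup A q \<theta> T T' by fact
  note m = sector_mono[OF assms(3)]
  show ?thesis
  proof
    show "\<exists>r>0. \<exists>M>0. \<forall>z\<in>sector \<theta>''. cmod z < r \<longrightarrow> (\<forall>x\<in>closure (Domain A). norm (T z x) \<le> M * norm x)"
      if "0 < \<theta>''" "\<theta>'' < \<theta>'" for \<theta>'' using T_loc_bdd that assms by simp
    show "((\<lambda>z. T z x) \<longlongrightarrow> x) (at 0 within sector \<theta>'')"
      if "x \<in> closure (Domain A)" "0 < \<theta>''" "\<theta>'' < \<theta>'" for \<theta>'' x using T_cont that assms by simp
  qed (use A \<theta> assms T_bl T'_bl T_add T_A T_deriv T'_eq T_bound T_commute m in auto)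
qed

section \<open>Sums of resolvent commuting operators\<close>

text \<open>Substitute for bounding the norm of the integral of \<open>f'\<close> by the integral of
  \<open>\<phi>'\<close>.\<close>

lemma vector_derivative_bound:
  fixes f :: "real \<Rightarrow> 'a::real_normed_vector"
  assumes "a < b" "\<And>t. a \<le> t \<Longrightarrow> t \<le> b \<Longrightarrow> (f has_vector_derivative f' t) (at t)"
    "\<And>t. a \<le> t \<Longrightarrow> t \<le> b \<Longrightarrow> (\<phi> has_vector_derivative \<phi>' t) (at t)"
    "\<And>t. a \<le> t \<Longrightarrow> t \<le> b \<Longrightarrow> norm (f' t) \<le> \<phi>' t"
  shows "norm (f b - f a) \<le> \<phi> b - \<phi> a"
proof (rule differentiable_bound_general[OF assms(1), where f' = f' and \<phi>' = \<phi>'])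
  show "continuous_on {a..b} f"
    using has_vector_derivative_continuous[OF assms(2)] by (auto intro!: continuous_at_imp_continuous_on)
  show "continuous_on {a..b} \<phi>"
    using has_vector_derivative_continuous[OF assms(3)] by (auto intro!: continuous_at_imp_continuous_on)
qed (use assms in auto)

lemma bounded_clinear_on_subset:
  assumes f: "bounded_clinear_on Z f" and YZ: "Y \<subseteq> Z" and fY: "\<And>x. x \<in> Y \<Longrightarrow> f x \<in> Y"
  shows "bounded_clinear_on Y f"
proof -
  obtain M where M: "M > 0" "\<And>x. x \<in> Z \<Longrightarrow> norm (f x) \<le> M * norm x"
    using bounded_clinear_on_bound[OF f] by blast
  show ?thesis
    unfolding bounded_clinear_on_def
  proof (intro conjI ballI allI exI[of _ M])
    fix x assume x: "x \<in> Y"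
    show "f x \<in> Y" by (rule fY[OF x])
    show "f (c *\<^sub>C x) = c *\<^sub>C f x" for c by (rule bounded_clinear_onD(3)[OF f subsetD[OF YZ x]])
    show "norm (f x) \<le> M * norm x" by (rule M(2)[OF subsetD[OF YZ x]])
    show "f (x + y) = f x + f y" if "y \<in> Y" for y
      by (rule bounded_clinear_onD(2)[OF f subsetD[OF YZ x] subsetD[OF YZ that]])
  qed
qed

text \<open>The derivative is the limit of real difference quotients, which stay in the closed
  subspace \<open>Y\<close>.\<close>

lemma has_op_derivative_in:
  assumes Y: "closed_csubspace Y" and F: "has_op_derivative Y F F' z"
    and FY: "\<forall>\<^sub>F w in nhds z. F w x \<in> Y" and x: "x \<in> Y"
  shows "F' x \<in> Y"
proof -
  have 1: "((\<lambda>t. z + of_real t) has_derivative (\<lambda>h. of_real h)) (at (0::real))"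
    by (auto intro!: derivative_eq_intros)
  have 2: "((\<lambda>w. F w x) has_derivative (\<lambda>h. h *\<^sub>C F' x)) (at (z + of_real 0))"
    using has_op_derivative_pointwise[OF F x] by simp
  have "((\<lambda>t. F (z + of_real t) x) has_vector_derivative F' x) (at 0)"
    using has_derivative_compose[OF 1 2] by (simp add: has_vector_derivative_def scaleC_of_real)
  from vector_derivative_quotient[OF this]
  have lim: "((\<lambda>t. (1 / t) *\<^sub>R (F (z + of_real t) x - F z x)) \<longlongrightarrow> F' x) (at_right 0)" by simp
  have Fz: "F z x \<in> Y" using FY by (rule eventually_nhds_x_imp_x)
  have "((\<lambda>t. z + complex_of_real t) \<longlongrightarrow> z) (at_right 0)" by (auto intro!: tendsto_eq_intros)
  from eventually_compose_filterlim[OF FY this]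
  have "\<forall>\<^sub>F t in at_right 0. (1 / t) *\<^sub>R (F (z + of_real t) x - F z x) \<in> Y"
    by (rule eventually_mono) (intro closed_csubspaceD(5,6)[OF Y] Fz)
  from Lim_in_closed_set[OF closed_csubspaceD(1)[OF Y] this _ lim] show ?thesis by simp
qed

text \<open>Applied to the difference of two solutions, the estimate has right-hand side 0; so it
  gives injectivity besides the norm bound.\<close>

lemma resolvent_setI:
  assumes T: "linear_operator T" and surj: "\<And>y. \<exists>x. (x, l *\<^sub>C x - y) \<in> T"
    and bound: "\<And>x y. (x, y) \<in> T \<Longrightarrow> norm x \<le> M * norm (l *\<^sub>C x - y)"
  shows "l \<in> resolvent_set T" "norm (resolvent T l y) \<le> M * norm y"
proof -
  note T' = linear_operatorD[OF T]
  have sh: "(x, y) \<in> shifted l T \<longleftrightarrow> (x, l *\<^sub>C x - y) \<in> T" for x y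
  proof
    assume "(x, y) \<in> shifted l T"
    then obtain z where z: "(x, z) \<in> T" "y = l *\<^sub>C x - z" by (auto simp: shifted_def)
    have "l *\<^sub>C x - y = z" by (simp add: z(2))
    with z(1) show "(x, l *\<^sub>C x - y) \<in> T" by simp
  next
    assume a: "(x, l *\<^sub>C x - y) \<in> T"
    have "y = l *\<^sub>C x - (l *\<^sub>C x - y)" by simp
    with a show "(x, y) \<in> shifted l T" unfolding shifted_def by blast
  qed
  have ex: "\<exists>!x. (x, y) \<in> shifted l T" for y
  proof (rule ex_ex1I)
    show "\<exists>x. (x, y) \<in> shifted l T" using surj sh by simp
    fix x x' assume "(x, y) \<in> shifted l T" "(x', y) \<in> shifted l T"
    then have "(x - x', (l *\<^sub>C x - y) - (l *\<^sub>C x' - y)) \<in> T" unfolding sh by (rule T'(5))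
    from bound[OF this] show "x = x'" by (simp add: scaleC.diff_right)
  qed
  have mem: "(resolvent T l y, l *\<^sub>C resolvent T l y - y) \<in> T" for y
    using theI'[OF ex, of y] unfolding sh resolvent_def .
  have eqI: "resolvent T l y = x" if "(x, l *\<^sub>C x - y) \<in> T" for x y
    using that ex mem sh by blast
  show b: "norm (resolvent T l y) \<le> M * norm y" for y using bound[OF mem[of y]] by simp
  have "resolvent T l (x + y) = resolvent T l x + resolvent T l y" for x y
  proof (rule eqI)
    have eq: "l *\<^sub>C (resolvent T l x + resolvent T l y) - (x + y)
      = (l *\<^sub>C resolvent T l x - x) + (l *\<^sub>C resolvent T l y - y)" by (simp add: scaleC_add_right)
    show "(resolvent T l x + resolvent T l y, l *\<^sub>C (resolvent T l x + resolvent T l y) - (x + y)) \<in> T"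
      unfolding eq by (rule T'(3)[OF mem mem])
  qed
  moreover have "resolvent T l (c *\<^sub>C x) = c *\<^sub>C resolvent T l x" for c x
  proof (rule eqI)
    have eq: "l *\<^sub>C c *\<^sub>C resolvent T l x - c *\<^sub>C x = c *\<^sub>C (l *\<^sub>C resolvent T l x - x)"
      by (simp add: scaleC.diff_right scaleC_left_commute)
    show "(c *\<^sub>C resolvent T l x, l *\<^sub>C c *\<^sub>C resolvent T l x - c *\<^sub>C x) \<in> T"
      unfolding eq by (rule T'(4)[OF mem])
  qed
  ultimately have "bounded_clinear_on UNIV (resolvent T l)"
    using b unfolding bounded_clinear_on_def by blast
  then show "l \<in> resolvent_set T" using ex by (simp add: resolvent_set_def)
qed

text \<open>Commutation is recorded at a common resolvent point \<open>m\<close>, from which it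
  passes to the semigroups. The exponents are \<open>1 / p\<close> for each operator, and the
  conditions on them place \<delta> in the interval from 0 (excluded) to 1.\<close>

locale operator_pair =
  EA: extended_semigroup A qA \<theta> TA TA' + EB: extended_semigroup B qB \<theta> TB TB'
  for A B :: "'a::cbanach operator" and qA qB \<theta> :: real and TA TA' TB TB' +
  fixes m :: complex
  assumes mA: "m \<in> resolvent_set A" and mB: "m \<in> resolvent_set B"
    and comm: "\<And>x. resolvent A m (resolvent B m x) = resolvent B m (resolvent A m x)"
    and q: "qA + qB > 1" "qA \<le> 1" "qB \<le> 1"
begin

definition "C = operator_sum A B"

abbreviation "Y \<equiv> closure (Domain C)"

abbreviation "\<delta> \<equiv> qA + qB - 1"

lemma lin: "linear_operator A" "linear_operator B"
  using EA.A EB.A by (auto simp: closed_operator_def)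

lemmas A' = linear_operatorD[OF lin(1)] and B' = linear_operatorD[OF lin(2)]

lemma C_I: "(x, a) \<in> A \<Longrightarrow> (x, b) \<in> B \<Longrightarrow> (x, a + b) \<in> C"
  unfolding C_def operator_sum_def by blast

lemma C_E:
  assumes "(x, y) \<in> C"
  obtains a b where "(x, a) \<in> A" "(x, b) \<in> B" "y = a + b"
  using assms unfolding C_def operator_sum_def by blast

lemma lin_C: "linear_operator C"
  unfolding linear_operator_def
proof (intro conjI allI impI)
  show "single_valued C"
    by (rule single_valuedI) (metis C_E A'(1) B'(1))
  show "(0, 0) \<in> C" using C_I[OF A'(2) B'(2)] by simp
  fix x y assume "(x, y) \<in> C"
  then obtain a b where ab: "(x, a) \<in> A" "(x, b) \<in> B" "y = a + b" by (rule C_E)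
  show "(c *\<^sub>C x, c *\<^sub>C y) \<in> C" for c
    using C_I[OF A'(4)[OF ab(1), of c] B'(4)[OF ab(2), of c]] by (simp add: ab(3) scaleC_add_right)
  fix x' y' assume "(x', y') \<in> C"
  then obtain a' b' where ab': "(x', a') \<in> A" "(x', b') \<in> B" "y' = a' + b'" by (rule C_E)
  have "(x + x', (a + a') + (b + b')) \<in> C" by (rule C_I[OF A'(3)[OF ab(1) ab'(1)] B'(3)[OF ab(2) ab'(2)]])
  then show "(x + x', y + y') \<in> C" by (simp add: ab(3) ab'(3) add_ac)
qed

lemma Y: "closed_csubspace Y" by (rule closed_csubspace_closure_Domain[OF lin_C])

lemmas Y' = closed_csubspaceD[OF Y]

lemma C_Y: "(x, y) \<in> C \<Longrightarrow> x \<in> Y"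
  by (rule subsetD[OF closure_subset DomainI])

lemma Y_sub: "Y \<subseteq> closure (Domain A)" "Y \<subseteq> closure (Domain B)"
proof -
  have "Domain C \<subseteq> Domain A" "Domain C \<subseteq> Domain B" unfolding C_def operator_sum_def by blast+
  from this[THEN closure_mono] show "Y \<subseteq> closure (Domain A)" "Y \<subseteq> closure (Domain B)" .
qed

lemma preserves_C:
  assumes "preserves P A" "preserves P B"
  shows "preserves P C"
  unfolding preserves_def
proof (intro conjI allI impI)
  show bl: "bounded_clinear_on UNIV P" using assms(1) by (simp add: preserves_def)
  fix x y assume "(x, y) \<in> C"
  then obtain a b where ab: "(x, a) \<in> A" "(x, b) \<in> B" "y = a + b" by (rule C_E)
  have "(P x, P a + P b) \<in> C" using ab assms by (intro C_I) (auto simp: preserves_def)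
  then show "(P x, P y) \<in> C" using bounded_clinear_onD(2)[OF bl, of a b] ab(3) by simp
qed

section \<open>Commutation of each semigroup with both operators\<close>

lemma TA_A: "z \<in> sector \<theta> \<Longrightarrow> preserves (TA z) A" and TB_B: "z \<in> sector \<theta> \<Longrightarrow> preserves (TB z) B"
  using EA.T_bl EA.T_A EB.T_bl EB.T_A by (auto simp: preserves_def)

text \<open>The resolvent of \<open>B\<close> commutes with that of \<open>A\<close>, hence
  preserves \<open>A\<close> and commutes with \<open>TA z\<close>. Read the other way,
  \<open>TA z\<close> commutes with the resolvent of \<open>B\<close> and so preserves
  \<open>B\<close>.\<close>

lemma TA_B: "z \<in> sector \<theta> \<Longrightarrow> preserves (TA z) B"
proof (rule preservesI_resolvent[OF EA.T_bl mB])
  have "preserves (resolvent B m) A"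
    by (rule preservesI_resolvent[OF resolventD(3)[OF mB] mA comm])
  then show "resolvent B m (TA z y) = TA z (resolvent B m y)" if "z \<in> sector \<theta>" for y
    using EA.T_commute[OF that] by simp
qed

lemma TB_A: "z \<in> sector \<theta> \<Longrightarrow> preserves (TB z) A"
proof (rule preservesI_resolvent[OF EB.T_bl mA])
  have "preserves (resolvent A m) B"
    by (rule preservesI_resolvent[OF resolventD(3)[OF mA] mB comm[symmetric]])
  then show "resolvent A m (TB z y) = TB z (resolvent A m y)" if "z \<in> sector \<theta>" for y
    using EB.T_commute[OF that] by simp
qed

lemma TB_TA: "z \<in> sector \<theta> \<Longrightarrow> w \<in> sector \<theta> \<Longrightarrow> TB w (TA z x) = TA z (TB w x)"
  by (rule EB.T_commute[OF _ TA_B])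

subsection \<open>Closability\<close>

text \<open>With the injective operator \<open>J = (m - A)\<inverse> (m - B)\<inverse>\<close> the operator \<open>(A + B) J\<close> extends to a bounded operator, which
  on \<open>D(A + B)\<close> agrees with \<open>J (A + B)\<close>; so \<open>A + B\<close> is contained in the closed operator \<open>J\<inverse> (A + B) J\<close>.\<close>

lemma closable_C: "closable C"
proof -
  define RA RB where "RA = resolvent A m" and "RB = resolvent B m"
  note RA = resolventD[OF mA, folded RA_def] and RB = resolventD[OF mB, folded RB_def]
  have comm': "RA (RB x) = RB (RA x)" for x using comm by (simp add: RA_def RB_def)
  interpret RA: bounded_linear RA by (rule bounded_clinear_UNIV_bounded_linear[OF RA(3)])
  interpret RB: bounded_linear RB by (rule bounded_clinear_UNIV_bounded_linear[OF RB(3)])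
  note sc = bounded_clinear_onD(3)[OF RA(3) UNIV_I] bounded_clinear_onD(3)[OF RB(3) UNIV_I]
  have injA: "x = 0" if "RA x = 0" for x
  proof -
    have "(0, - x) \<in> A" using RA(2)[of x] by (simp add: that scaleC.zero_right)
    from A'(1)[OF this A'(2)] show ?thesis by simp
  qed
  have injB: "x = 0" if "RB x = 0" for x
  proof -
    have "(0, - x) \<in> B" using RB(2)[of x] by (simp add: that scaleC.zero_right)
    from B'(1)[OF this B'(2)] show ?thesis by simp
  qed
  \<comment> \<open>The bounded form of (A + B) J: applying A to J gives m J - RB and applying B
    gives m J - RA, with J the product of \<open>RA\<close> and \<open>RB\<close>.\<close>
  define L where "L = (\<lambda>x. m *\<^sub>C RA (RB x) - RB x + (m *\<^sub>C RA (RB x) - RA x))"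
  define G where "G = {(x, y). L x = RA (RB y)}"
  have "C \<subseteq> G"
  proof (rule subrelI)
    fix x y assume "(x, y) \<in> C"
    then obtain a b where ab: "(x, a) \<in> A" "(x, b) \<in> B" "y = a + b" by (rule C_E)
    have "m *\<^sub>C RA x - RA a = x" using RA(1)[OF ab(1)] unfolding RA.diff sc .
    then have "RA a = m *\<^sub>C RA x - x" by (simp add: algebra_simps)
    then have "RB (RA a) = m *\<^sub>C RB (RA x) - RB x" by (simp only: RB.diff sc)
    then have 1: "RA (RB a) = m *\<^sub>C RA (RB x) - RB x" unfolding comm' .
    have "m *\<^sub>C RB x - RB b = x" using RB(1)[OF ab(2)] unfolding RB.diff sc .
    then have "RB b = m *\<^sub>C RB x - x" by (simp add: algebra_simps)
    then have "RA (RB b) = m *\<^sub>C RA (RB x) - RA x" by (simp only: RA.diff sc)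
    with 1 show "(x, y) \<in> G" by (simp add: G_def L_def ab(3) RA.add RB.add)
  qed
  moreover have "closed_operator G"
    unfolding closed_operator_def linear_operator_def
  proof (intro conjI allI impI)
    show "single_valued G"
    proof (rule single_valuedI)
      fix x y z assume "(x, y) \<in> G" "(x, z) \<in> G"
      then have "RA (RB (y - z)) = 0" by (simp add: G_def RA.diff RB.diff)
      from injB[OF injA[OF this]] show "y = z" by simp
    qed
    show "(0, 0) \<in> G" by (simp add: G_def L_def RA.zero RB.zero scaleC.zero_right)
    show "closed G"
    proof -
      have "continuous_on UNIV (\<lambda>p. L (fst p) - RA (RB (snd p)))"
        unfolding L_def by (intro continuous_intros RA.continuous_on RB.continuous_on scaleC.continuous_on)
      then have "closed {p. L (fst p) - RA (RB (snd p)) = 0}"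
        by (intro closed_Collect_eq) (auto intro: continuous_intros)
      also have "{p. L (fst p) - RA (RB (snd p)) = 0} = G" by (auto simp: G_def)
      finally show ?thesis .
    qed
    fix x y assume xy: "(x, y) \<in> G"
    show "(c *\<^sub>C x, c *\<^sub>C y) \<in> G" for c
    proof -
      have "L (c *\<^sub>C x) = c *\<^sub>C L x"
        by (simp add: L_def sc scaleC_add_right scaleC.diff_right scaleC_left_commute)
      then show ?thesis using xy by (simp add: G_def sc)
    qed
    fix x' y' assume "(x', y') \<in> G"
    moreover have "L (x + x') = L x + L x'" by (simp add: L_def RA.add RB.add scaleC_add_right)
    ultimately show "(x + x', y + y') \<in> G" using xy by (simp add: G_def RA.add RB.add)
  qed
  ultimately show ?thesis unfolding closable_def by blast
qed

section \<open>The closure of the sum\<close>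

definition "Cb = operator_closure C"

lemma Cb: "Cb = closure C" "closed_operator Cb" "linear_operator Cb"
  using closed_operator_closure[OF lin_C closable_C] by (auto simp: Cb_def closed_operator_def)

lemma C_Cb: "(x, y) \<in> C \<Longrightarrow> (x, y) \<in> Cb"
  unfolding Cb(1) by (rule subsetD[OF closure_subset])

lemma Cb_E:
  assumes "(x, y) \<in> Cb"
  obtains f g where "\<forall>n. (f n, g n) \<in> C" "f \<longlonglongrightarrow> x" "g \<longlonglongrightarrow> y"
proof -
  obtain h where h: "\<forall>n. h n \<in> C" "h \<longlonglongrightarrow> (x, y)" using assms unfolding Cb(1) by (rule closure_seqE)
  have "\<forall>n. (fst (h n), snd (h n)) \<in> C" using h(1) by simp
  then show ?thesis using that[of "\<lambda>n. fst (h n)" "\<lambda>n. snd (h n)"] tendsto_fst[OF h(2)] tendsto_snd[OF h(2)] by simp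
qed

lemma Cb_I:
  assumes "\<forall>n. (f n, g n) \<in> C" "f \<longlonglongrightarrow> x" "g \<longlonglongrightarrow> y"
  shows "(x, y) \<in> Cb"
  unfolding Cb(1) using closure_seqI[of "\<lambda>n. (f n, g n)" C "(x, y)"] assms tendsto_Pair by blast

lemma Cb_Y: "(x, y) \<in> Cb \<Longrightarrow> x \<in> Y"
proof (erule Cb_E)
  fix f g assume "\<forall>n. (f n, g n) \<in> C" "f \<longlonglongrightarrow> x"
  moreover from this have "\<forall>n. f n \<in> Domain C" by blast
  ultimately show "x \<in> Y" by (intro closure_seqI)
qed

text \<open>Thus the part of the closure lives on the same space \<open>Y\<close> on which the
  product semigroup is constructed.\<close>

lemma Domain_Cb: "closure (Domain Cb) = Y"
proof
  have "Domain Cb \<subseteq> Y" using Cb_Y by blast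
  then show "closure (Domain Cb) \<subseteq> Y" by (rule closure_minimal) simp
  have "Domain C \<subseteq> Domain Cb" using C_Cb by blast
  then show "Y \<subseteq> closure (Domain Cb)" by (rule closure_mono)
qed

lemma preserves_Cb:
  assumes "preserves P C"
  shows "preserves P Cb"
  unfolding preserves_def
proof (intro conjI allI impI)
  show bl: "bounded_clinear_on UNIV P" using assms by (simp add: preserves_def)
  note lim = bounded_linear.tendsto[OF bounded_clinear_UNIV_bounded_linear[OF bl]]
  fix x y assume "(x, y) \<in> Cb"
  then obtain f g where fg: "\<forall>n. (f n, g n) \<in> C" "f \<longlonglongrightarrow> x" "g \<longlonglongrightarrow> y" by (rule Cb_E)
  have "\<forall>n. (P (f n), P (g n)) \<in> C" using fg(1) assms by (simp add: preserves_def)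
  then show "(P x, P y) \<in> Cb" by (rule Cb_I[OF _ lim[OF fg(2)] lim[OF fg(3)]])
qed

subsection \<open>The product semigroup\<close>

definition U :: "complex \<Rightarrow> 'a \<Rightarrow> 'a" where "U z x = TA z (TB z x)"

definition U' :: "complex \<Rightarrow> 'a \<Rightarrow> 'a" where "U' z x = TA' z (TB z x) + TA z (TB' z x)"

lemma TA_C: "z \<in> sector \<theta> \<Longrightarrow> preserves (TA z) C" and TB_C: "z \<in> sector \<theta> \<Longrightarrow> preserves (TB z) C"
  by (intro preserves_C TA_A TA_B TB_A TB_B; assumption)+

lemma U_linear: "z \<in> sector \<theta> \<Longrightarrow> bounded_clinear_on UNIV (U z)"
  unfolding U_def by (rule bounded_clinear_on_comp[OF EA.T_bl EB.T_bl])

lemma U_C: "z \<in> sector \<theta> \<Longrightarrow> preserves (U z) C"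
  using TA_C[of z] TB_C[of z] U_linear[of z] unfolding preserves_def U_def by blast

lemma U_add:
  assumes "z \<in> sector \<theta>" "w \<in> sector \<theta>"
  shows "U (z + w) x = U z (U w x)"
  by (simp add: U_def EA.T_add[OF assms] EB.T_add[OF assms] TB_TA[OF assms(2,1)])

lemma on_Y:
  assumes "preserves P C"
  shows "bounded_clinear_on Y P"
proof (rule bounded_clinear_on_subset[OF _ subset_UNIV preserves_closure_Domain[OF assms]])
  show "bounded_clinear_on UNIV P" using assms by (simp add: preserves_def)
qed

text \<open>The derivatives are given on the larger closures of D(A) and D(B). The product rule on
  \<open>Y\<close> requires them to map \<open>Y\<close> into itself, which they inherit from the
  invariance of \<open>Y\<close> under \<open>TA\<close> and \<open>TB\<close>.\<close>

lemma T'_Y: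
  assumes z: "z \<in> sector \<theta>"
  shows "bounded_clinear_on Y (TA' z)" "bounded_clinear_on Y (TB' z)"
proof -
  have ev: "\<forall>\<^sub>F w in nhds z. w \<in> sector \<theta>" using open_sector[OF EA.\<theta>] z by (rule eventually_nhds_in_open)
  have inY: "\<forall>\<^sub>F w in nhds z. TA w x \<in> Y" "\<forall>\<^sub>F w in nhds z. TB w x \<in> Y" if "x \<in> Y" for x
    using ev by (rule eventually_mono, use preserves_closure_Domain[OF TA_C that] preserves_closure_Domain[OF TB_C that] in blast)+
  show "bounded_clinear_on Y (TA' z)"
    by (rule bounded_clinear_on_subset[OF EA.T'_bl[OF z] Y_sub(1)])
       (rule has_op_derivative_in[OF Y has_op_derivative_subset[OF EA.T_deriv[OF z] Y_sub(1)] inY(1)])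
  show "bounded_clinear_on Y (TB' z)"
    by (rule bounded_clinear_on_subset[OF EB.T'_bl[OF z] Y_sub(2)])
       (rule has_op_derivative_in[OF Y has_op_derivative_subset[OF EB.T_deriv[OF z] Y_sub(2)] inY(2)])
qed

lemma U'_linear: "z \<in> sector \<theta> \<Longrightarrow> bounded_clinear_on Y (U' z)"
  unfolding U'_def
  by (rule bounded_clinear_on_add[OF Y
        bounded_clinear_on_comp[OF T'_Y(1) on_Y[OF TB_C]] bounded_clinear_on_comp[OF on_Y[OF TA_C] T'_Y(2)]])

lemma U_deriv:
  assumes z: "z \<in> sector \<theta>"
  shows "has_op_derivative Y U (U' z) z"
proof -
  have "\<forall>\<^sub>F w in nhds z. w \<in> sector \<theta>" using open_sector[OF EA.\<theta>] z by (rule eventually_nhds_in_open)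
  then have "\<forall>\<^sub>F w in nhds z. \<forall>x\<in>Y. TB w x \<in> Y"
    by (rule eventually_mono) (intro ballI preserves_closure_Domain[OF TB_C])
  then have "has_op_derivative Y (\<lambda>w x. TA w (TB w x)) (\<lambda>x. TA' z (TB z x) + TA z (TB' z x)) z"
    by (intro has_op_derivative_comp[OF Y has_op_derivative_subset[OF EA.T_deriv[OF z] Y_sub(1)]
          has_op_derivative_subset[OF EB.T_deriv[OF z] Y_sub(2)]] T'_Y[OF z] on_Y TA_C[OF z] TB_C[OF z])
  then show ?thesis unfolding U_def[abs_def] U'_def[abs_def] .
qed

text \<open>On D(A) \<inter> D(B), \<open>TB z\<close> commutes with \<open>A\<close>, so the two
  terms of the product rule add up to \<open>U z\<close> applied to the sum. Boundedness of
  \<open>U' z\<close> on \<open>Y\<close> and of \<open>U z\<close> carries the identity to the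
  closure.\<close>

lemma U'_Cb:
  assumes z: "z \<in> sector \<theta>" and xy: "(x, y) \<in> Cb"
  shows "U' z x = U z y"
proof -
  have 1: "U' z x = U z y" if "(x, y) \<in> C" for x y
  proof -
    obtain a b where ab: "(x, a) \<in> A" "(x, b) \<in> B" "y = a + b" using \<open>(x, y) \<in> C\<close> by (rule C_E)
    have "(TB z x, TB z a) \<in> A" using TB_A[OF z] ab by (simp add: preserves_def)
    then have "U' z x = TA z (TB z a) + TA z (TB z b)"
      using EA.T'_eq[OF z] EB.T'_eq[OF z ab(2)] by (simp add: U'_def)
    also have "\<dots> = U z a + U z b" by (simp add: U_def)
    finally show ?thesis using bounded_clinear_onD(2)[OF U_linear[OF z]] ab(3) by simp
  qed
  obtain f g where fg: "\<forall>n. (f n, g n) \<in> C" "f \<longlonglongrightarrow> x" "g \<longlonglongrightarrow> y" using xy by (rule Cb_E)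
  have "(\<lambda>n. U' z (f n)) \<longlonglongrightarrow> U' z x"
    using fg C_Y Cb_Y[OF xy] by (intro bounded_clinear_on_tendsto[OF Y U'_linear[OF z]]) (auto intro: always_eventually)
  moreover have "(\<lambda>n. U z (g n)) \<longlonglongrightarrow> U z y"
    by (rule bounded_linear.tendsto[OF bounded_clinear_UNIV_bounded_linear[OF U_linear[OF z]] fg(3)])
  moreover have "(\<lambda>n. U' z (f n)) = (\<lambda>n. U z (g n))" using 1 fg(1) by auto
  ultimately show ?thesis using LIMSEQ_unique by metis
qed

lemma real_sector: "t > 0 \<Longrightarrow> complex_of_real t \<in> sector \<theta>"
  using EA.\<theta> by (simp add: of_real_in_sector)

lemma U_vector_derivative:
  assumes t: "t > 0" and xy: "(x, y) \<in> Cb"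
  shows "((\<lambda>t. U (of_real t) x) has_vector_derivative U (of_real t) y) (at t)"
proof -
  have 1: "(complex_of_real has_derivative (\<lambda>h. of_real h)) (at t)" by (auto intro!: derivative_eq_intros)
  show ?thesis
    using has_derivative_compose[OF 1 has_op_derivative_pointwise[OF U_deriv[OF real_sector[OF t]] Cb_Y[OF xy]]]
    by (simp add: has_vector_derivative_def scaleC_of_real U'_Cb[OF real_sector[OF t] xy])
qed

text \<open>\<open>U z x - TA z x\<close> is \<open>TA z\<close> applied to
  \<open>TB z x - x\<close>. On the whole space \<open>TA z\<close> may blow up at 0, but this
  vector lies in \<open>Y\<close>, where a local bound holds.\<close>

lemma U_cont:
  assumes x: "x \<in> Y" and \<theta>': "0 < \<theta>'" "\<theta>' < \<theta>"
  shows "((\<lambda>z. U z x) \<longlongrightarrow> x) (at 0 within sector \<theta>')"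
proof -
  have xA: "x \<in> closure (Domain A)" and xB: "x \<in> closure (Domain B)" using x Y_sub by auto
  obtain r M where rM: "r > 0" "M > 0"
    "\<And>z x. z \<in> sector \<theta>' \<Longrightarrow> cmod z < r \<Longrightarrow> x \<in> closure (Domain A) \<Longrightarrow> norm (TA z x) \<le> M * norm x"
    using EA.T_loc_bdd[OF \<theta>'] by blast
  have "((\<lambda>z. U z x - TA z x) \<longlongrightarrow> 0) (at 0 within sector \<theta>')"
  proof (rule Lim_null_comparison)
    show "((\<lambda>z. M * norm (TB z x - x)) \<longlongrightarrow> 0) (at 0 within sector \<theta>')"
      using EB.T_cont[OF xB \<theta>'] by (intro tendsto_mult_right_zero tendsto_norm_zero) (simp add: LIM_zero_iff)
    have "norm (U z x - TA z x) \<le> M * norm (TB z x - x)" if "z \<in> sector \<theta>'" "cmod z < r" for z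
    proof -
      have z: "z \<in> sector \<theta>" using sector_mono \<theta>' that by (meson less_imp_le)
      have "TB z x - x \<in> Y" by (intro Y'(5) preserves_closure_Domain[OF TB_C[OF z]] x)
      then have "norm (TA z (TB z x - x)) \<le> M * norm (TB z x - x)" using rM(3) that Y_sub by blast
      then show ?thesis using bounded_clinear_on_diff[OF closed_csubspace_UNIV EA.T_bl[OF z]] by (simp add: U_def)
    qed
    then show "\<forall>\<^sub>F z in at 0 within sector \<theta>'. norm (U z x - TA z x) \<le> M * norm (TB z x - x)"
      unfolding eventually_at using rM(1) by (intro exI[of _ r]) auto
  qed
  from tendsto_add[OF this EA.T_cont[OF xA \<theta>']] show ?thesis by simp
qed

lemma U_cont_real:
  assumes x: "x \<in> Y"
  shows "((\<lambda>t. U (of_real t) x) \<longlongrightarrow> x) (at_right 0)"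
proof -
  have h: "0 < \<theta> / 2" "\<theta> / 2 < \<theta>" using EA.\<theta> by auto
  have "(complex_of_real \<longlongrightarrow> 0) (at_right 0)" by (auto intro!: tendsto_eq_intros)
  moreover have "\<forall>\<^sub>F t in at_right 0. complex_of_real t \<in> sector (\<theta> / 2) \<and> complex_of_real t \<noteq> 0"
    using of_real_in_sector[OF _ h(1)] by (auto simp: eventually_at_filter)
  ultimately have "filterlim complex_of_real (at 0 within sector (\<theta> / 2)) (at_right 0)"
    unfolding filterlim_at by (auto elim: eventually_mono)
  from filterlim_compose[OF U_cont[OF x h] this] show ?thesis .
qed

lemma U_bound: "\<exists>K>0. \<exists>\<omega>>0. \<forall>t>0. \<forall>x. norm (U (of_real t) x) \<le> K * t powr (\<delta> - 1) * exp (\<omega> * t) * norm x"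
proof -
  obtain KA wA where A: "KA > 0" "wA > 0"
    "\<And>t x. t > 0 \<Longrightarrow> norm (TA (of_real t) x) \<le> KA * t powr (qA - 1) * exp (wA * t) * norm x"
    using EA.T_bound by blast
  obtain KB wB where B: "KB > 0" "wB > 0"
    "\<And>t x. t > 0 \<Longrightarrow> norm (TB (of_real t) x) \<le> KB * t powr (qB - 1) * exp (wB * t) * norm x"
    using EB.T_bound by blast
  have "norm (U (of_real t) x) \<le> (KA * KB) * t powr (\<delta> - 1) * exp ((wA + wB) * t) * norm x" if t: "t > 0" for t x
  proof -
    have "norm (U (of_real t) x) \<le> KA * t powr (qA - 1) * exp (wA * t) * norm (TB (of_real t) x)"
      unfolding U_def by (rule A(3)[OF t])
    also have "\<dots> \<le> KA * t powr (qA - 1) * exp (wA * t) * (KB * t powr (qB - 1) * exp (wB * t) * norm x)"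
      using A B(3)[OF t] by (intro mult_left_mono) auto
    also have "\<dots> = (KA * KB) * (t powr (qA - 1) * t powr (qB - 1)) * (exp (wA * t) * exp (wB * t)) * norm x"
      by simp
    also have "t powr (qA - 1) * t powr (qB - 1) = t powr (\<delta> - 1)" by (simp flip: powr_add add: algebra_simps)
    also have "exp (wA * t) * exp (wB * t) = exp ((wA + wB) * t)" by (simp flip: exp_add add: algebra_simps)
    finally show ?thesis .
  qed
  moreover have "KA * KB > 0" "wA + wB > 0" using A B by auto
  ultimately show ?thesis by blast
qed

subsection \<open>The a priori estimate\<close>

text \<open>The function f(t) = exp (- l t) U(t) x runs from x at 0 to 0 at infinity, and its
  derivative is exp (- l t) U(t) (y - l x). The size of this derivative is estimated separately on
  the two sides of t = 1/l, where the singular factor and the exponential trade places.\<close>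

lemma estimate_C:
  obtains K l0 where "K > 0" "l0 > 0" "\<And>l x y. l \<ge> l0 \<Longrightarrow> (x, y) \<in> C \<Longrightarrow> norm x \<le> K * l powr (- \<delta>) * norm (l *\<^sub>R x - y)"
proof -
  obtain K w where Kw: "K > 0" "w > 0"
    "\<And>t x. t > 0 \<Longrightarrow> norm (U (of_real t) x) \<le> K * t powr (\<delta> - 1) * exp (w * t) * norm x"
    using U_bound by blast
  have d: "\<delta> > 0" "\<delta> \<le> 1" using q by auto
  \<comment> \<open>For \<open>l \<ge> 2 * w\<close> half of the decay absorbs the growth exp (w t)
    of \<open>U\<close>. The summands \<open>1 / \<delta>\<close> and 2 are the contributions of the
    intervals below and above 1/l.\<close>
  have "norm x \<le> (K * (1 / \<delta> + 2)) * l powr (- \<delta>) * norm (l *\<^sub>R x - y)" if l: "l \<ge> 2 * w" and xy: "(x, y) \<in> C" for l x y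
  proof -
    have l0: "l > 0" using l Kw by linarith
    define N where "N = norm (l *\<^sub>R x - y)"
    define f where "f = (\<lambda>t. exp (- l * t) *\<^sub>R U (of_real t) x)"
    define f' where "f' = (\<lambda>t. exp (- l * t) *\<^sub>R (U (of_real t) (y - l *\<^sub>R x)))"
    have Ud: "U (of_real t) (y - l *\<^sub>R x) = U (of_real t) y - l *\<^sub>R U (of_real t) x" if "t > 0" for t
      using bounded_clinear_on_diff[OF closed_csubspace_UNIV U_linear[OF real_sector[OF that]]]
        bounded_clinear_onD(4)[OF U_linear[OF real_sector[OF that]]] by simp
    have f': "(f has_vector_derivative f' t) (at t)" if t: "t > 0" for t
    proof -
      have "((\<lambda>t. exp (- l * t)) has_real_derivative exp (- l * t) * (- l)) (at t)"
        by (auto intro!: derivative_eq_intros)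
      from has_vector_derivative_scaleR[OF this U_vector_derivative[OF t C_Cb[OF xy]]]
      show ?thesis by (simp add: f_def f'_def Ud[OF t] algebra_simps)
    qed
    have expb: "exp (- l * t) * exp (w * t) \<le> exp (- (l / 2) * t)" if "t > 0" for t
    proof -
      have "w * t \<le> l / 2 * t" using l that by (intro mult_right_mono) auto
      then show ?thesis by (simp flip: exp_add)
    qed
    have fb: "norm (exp (- l * t) *\<^sub>R U (of_real t) v) \<le> K * t powr (\<delta> - 1) * exp (- (l / 2) * t) * norm v" if t: "t > 0" for t v
    proof -
      have "norm (exp (- l * t) *\<^sub>R U (of_real t) v) \<le> exp (- l * t) * (K * t powr (\<delta> - 1) * exp (w * t) * norm v)"
        using Kw(3)[OF t, of v] by (simp add: mult_left_mono)
      also have "\<dots> = K * t powr (\<delta> - 1) * (exp (- l * t) * exp (w * t)) * norm v" by simp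
      also have "\<dots> \<le> K * t powr (\<delta> - 1) * exp (- (l / 2) * t) * norm v"
        using expb[OF t] Kw(1) by (intro mult_right_mono mult_left_mono) auto
      finally show ?thesis .
    qed
    have f'b: "norm (f' t) \<le> K * t powr (\<delta> - 1) * exp (- (l / 2) * t) * N" if "t > 0" for t
      using fb[OF that, of "y - l *\<^sub>R x"] by (simp add: f'_def N_def norm_minus_commute)
    have pinv: "(1 / l) powr a = l powr (- a)" for a
      using l0 by (simp add: powr_divide powr_minus_divide)
    have N: "N \<ge> 0" by (simp add: N_def)
    \<comment> \<open>Below 1/l the exponential is bounded by 1, and
      \<open>t powr \<delta> / \<delta>\<close> is a primitive of the singular factor; \<delta> > 0
      enters here. The lower end \<open>e\<close> stays away from the singularity.\<close>
    have p1: "norm (f (1 / l) - f e) \<le> K * N * l powr (- \<delta>) / \<delta>" if e: "0 < e" "e < 1 / l" for e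
    proof -
      have "norm (f (1 / l) - f e) \<le> K * N * (1 / l) powr \<delta> / \<delta> - K * N * e powr \<delta> / \<delta>"
      proof (rule vector_derivative_bound[OF e(2), where f' = f' and \<phi> = "\<lambda>t. K * N * t powr \<delta> / \<delta>" and \<phi>' = "\<lambda>t. K * N * t powr (\<delta> - 1)"])
        fix t assume t: "e \<le> t" "t \<le> 1 / l"
        then have t0: "t > 0" using e by simp
        show "(f has_vector_derivative f' t) (at t)" by (rule f'[OF t0])
        have "((\<lambda>t. K * N * t powr \<delta> / \<delta>) has_real_derivative K * N * (\<delta> * t powr (\<delta> - 1)) / \<delta>) (at t)"
          using t0 by (intro DERIV_cdivide DERIV_cmult has_real_derivative_powr)
        then show "((\<lambda>t. K * N * t powr \<delta> / \<delta>) has_vector_derivative K * N * t powr (\<delta> - 1)) (at t)"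
          using d by (simp add: has_real_derivative_iff_has_vector_derivative mult.assoc)
        have "exp (- (l / 2) * t) \<le> 1" using l0 t0 by simp
        then have "K * t powr (\<delta> - 1) * exp (- (l / 2) * t) * N \<le> K * t powr (\<delta> - 1) * 1 * N"
          using Kw(1) N by (intro mult_right_mono mult_left_mono) auto
        then show "norm (f' t) \<le> K * N * t powr (\<delta> - 1)" using f'b[OF t0] by (simp add: mult_ac)
      qed
      also have "\<dots> \<le> K * N * (1 / l) powr \<delta> / \<delta>" using Kw(1) N d by simp
      also have "(1 / l) powr \<delta> = l powr (- \<delta>)" by (rule pinv)
      finally show ?thesis .
    qed
    have lp: "t powr (\<delta> - 1) \<le> l powr (1 - \<delta>)" if "1 / l \<le> t" for t
    proof -
      have "t powr (\<delta> - 1) \<le> (1 / l) powr (\<delta> - 1)" using that l0 d by (intro powr_mono2') auto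
      also have "\<dots> = l powr (1 - \<delta>)" unfolding pinv by (simp add: algebra_simps)
      finally show ?thesis .
    qed
    have lpd: "l powr (1 - \<delta>) = l powr (- \<delta>) * l"
      using powr_add[of l "- \<delta>" 1] l0 by simp
    \<comment> \<open>Above 1/l the power is at most its value \<open>l powr (1 - \<delta>)\<close>
      at 1/l because \<delta> \<le> 1; what remains is the integral of exp (- l t / 2), at most
      2/l.\<close>
    have p2: "norm (f L - f (1 / l)) \<le> 2 * K * N * l powr (- \<delta>)" if L: "1 / l < L" for L
    proof -
      let ?\<phi> = "\<lambda>t. - 2 * K * N * l powr (- \<delta>) * exp (- (l / 2) * t)"
      have "norm (f L - f (1 / l)) \<le> ?\<phi> L - ?\<phi> (1 / l)"
      proof (rule vector_derivative_bound[OF L, where f' = f' and \<phi>' = "\<lambda>t. K * N * l powr (1 - \<delta>) * exp (- (l / 2) * t)"])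
        fix t assume t: "1 / l \<le> t" "t \<le> L"
        then have t0: "t > 0" using l0 by (meson order.strict_trans2 zero_less_divide_1_iff)
        show "(f has_vector_derivative f' t) (at t)" by (rule f'[OF t0])
        have "(?\<phi> has_real_derivative (- 2 * K * N * l powr (- \<delta>) * (exp (- (l / 2) * t) * (- (l / 2))))) (at t)"
          by (auto intro!: derivative_eq_intros)
        then show "(?\<phi> has_vector_derivative K * N * l powr (1 - \<delta>) * exp (- (l / 2) * t)) (at t)"
          unfolding has_real_derivative_iff_has_vector_derivative[symmetric] lpd by (simp add: mult_ac)
        have "K * t powr (\<delta> - 1) * exp (- (l / 2) * t) * N \<le> K * l powr (1 - \<delta>) * exp (- (l / 2) * t) * N"
          using Kw(1) N lp[OF t(1)] by (intro mult_right_mono mult_left_mono) auto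
        then show "norm (f' t) \<le> K * N * l powr (1 - \<delta>) * exp (- (l / 2) * t)" using f'b[OF t0] by (simp add: mult_ac)
      qed
      also have "\<dots> = 2 * K * N * l powr (- \<delta>) * (exp (- (l / 2) * (1 / l)) - exp (- (l / 2) * L))"
        by (simp add: algebra_simps)
      also have "\<dots> \<le> 2 * K * N * l powr (- \<delta>) * 1"
      proof (rule mult_left_mono)
        have "exp (- (l / 2) * (1 / l)) \<le> 1" using l0 by simp
        moreover have "exp (- (l / 2) * L) > 0" by simp
        ultimately show "exp (- (l / 2) * (1 / l)) - exp (- (l / 2) * L) \<le> 1" by linarith
      qed (use Kw N in auto)
      finally show ?thesis by simp
    qed
    let ?b = "K * N * l powr (- \<delta>) / \<delta> + 2 * K * N * l powr (- \<delta>)"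
    \<comment> \<open>Letting \<open>L\<close> tend to infinity removes the boundary term
      \<open>norm (f L)\<close>, which decays exponentially.\<close>
    have p3: "norm (f e) \<le> ?b" if e: "0 < e" "e < 1 / l" for e
    proof (rule tendsto_le[OF trivial_limit_at_top_linorder])
      show "((\<lambda>L. ?b + K * l powr (1 - \<delta>) * exp (- (l / 2) * L) * norm x) \<longlongrightarrow> ?b) at_top"
      proof -
        have "filterlim (\<lambda>L. - (l / 2) * L) at_bot at_top"
          using l0 by (intro filterlim_tendsto_neg_mult_at_bot[OF tendsto_const _ filterlim_ident]) auto
        from filterlim_compose[OF exp_at_bot this]
        have "((\<lambda>L. exp (- (l / 2) * L)) \<longlongrightarrow> 0) at_top" .
        then have "((\<lambda>L. ?b + K * l powr (1 - \<delta>) * exp (- (l / 2) * L) * norm x) \<longlongrightarrow> ?b + K * l powr (1 - \<delta>) * 0 * norm x) at_top"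
          by (intro tendsto_intros)
        then show ?thesis by simp
      qed
      show "((\<lambda>L::real. norm (f e)) \<longlongrightarrow> norm (f e)) at_top" by (rule tendsto_const)
      show "\<forall>\<^sub>F L in at_top. norm (f e) \<le> ?b + K * l powr (1 - \<delta>) * exp (- (l / 2) * L) * norm x"
        using eventually_gt_at_top[of "1 / l"]
      proof eventually_elim
        case (elim L)
        then have L0: "L > 0" using l0 by (meson order.strict_trans zero_less_divide_1_iff)
        have "norm (f L) \<le> K * L powr (\<delta> - 1) * exp (- (l / 2) * L) * norm x"
          unfolding f_def by (rule fb[OF L0])
        also have "\<dots> \<le> K * l powr (1 - \<delta>) * exp (- (l / 2) * L) * norm x"
          using Kw(1) lp[of L] elim by (intro mult_right_mono mult_left_mono) auto
        finally have "norm (f L) \<le> K * l powr (1 - \<delta>) * exp (- (l / 2) * L) * norm x" .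
        moreover have "norm (f e) \<le> norm (f (1 / l) - f e) + norm (f L - f (1 / l)) + norm (f L)"
          by norm
        ultimately show ?case using p1[OF e] p2[OF elim] by linarith
      qed
    qed
    \<comment> \<open>The other boundary term: \<open>x\<close> is in the domain of
      \<open>C\<close>, hence in \<open>Y\<close>, where \<open>U\<close> is strongly continuous at
      0.\<close>
    have "(f \<longlongrightarrow> exp (- l * 0) *\<^sub>R x) (at_right 0)"
      unfolding f_def by (intro tendsto_intros U_cont_real C_Y[OF xy])
    then have "((\<lambda>e. norm (f e)) \<longlongrightarrow> norm x) (at_right 0)" using tendsto_norm by fastforce
    moreover have "\<forall>\<^sub>F e in at_right 0. norm (f e) \<le> ?b"
      unfolding eventually_at_right_field using p3 l0 by (intro exI[of _ "1 / l"]) auto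
    ultimately have "norm x \<le> ?b" by (intro tendsto_upperbound[OF _ _ trivial_limit_at_right_real])
    also have "?b = (K * (1 / \<delta> + 2)) * l powr (- \<delta>) * N" by (simp add: algebra_simps)
    finally show ?thesis by (simp add: N_def)
  qed
  then show ?thesis using that[of "K * (1 / \<delta> + 2)" "2 * w"] Kw d by (simp add: add_pos_pos)
qed

text \<open>By the estimate, preimages of a convergent sequence under l - C form a Cauchy sequence,
  and their limit is a preimage under l minus the closure. So the dense range becomes the whole
  space.\<close>

lemma resolvent_Cb:
  assumes dense: "\<And>l. l \<ge> l1 \<Longrightarrow> closure (Range (shifted (complex_of_real l) C)) = UNIV"
  obtains K l0 where "K > 0" "l0 > 0" "\<And>l. l \<ge> l0 \<Longrightarrow> complex_of_real l \<in> resolvent_set Cb"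
    "\<And>l x. l \<ge> l0 \<Longrightarrow> norm (resolvent Cb (complex_of_real l) x) \<le> K * l powr (- \<delta>) * norm x"
proof -
  obtain K l0 where K: "K > 0" "l0 > 0"
    "\<And>l x y. l \<ge> l0 \<Longrightarrow> (x, y) \<in> C \<Longrightarrow> norm x \<le> K * l powr (- \<delta>) * norm (l *\<^sub>R x - y)"
    using estimate_C by blast
  define l2 where "l2 = max l0 l1"
  have main: "complex_of_real l \<in> resolvent_set Cb \<and> norm (resolvent Cb (complex_of_real l) z) \<le> K * l powr (- \<delta>) * norm z"
    if l: "l \<ge> l2" for l z
  proof -
    have l01: "l \<ge> l0" "l \<ge> l1" using l by (auto simp: l2_def)
    let ?M = "K * l powr (- \<delta>)"
    have M: "?M > 0" using K l01 by simp
    have bound: "norm x \<le> ?M * norm (complex_of_real l *\<^sub>C x - y)" if "(x, y) \<in> Cb" for x y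
    proof -
      obtain f g where fg: "\<forall>n. (f n, g n) \<in> C" "f \<longlonglongrightarrow> x" "g \<longlonglongrightarrow> y" using \<open>(x, y) \<in> Cb\<close> by (rule Cb_E)
      have "(\<lambda>n. norm (f n)) \<longlonglongrightarrow> norm x" "(\<lambda>n. ?M * norm (l *\<^sub>R f n - g n)) \<longlonglongrightarrow> ?M * norm (l *\<^sub>R x - y)"
        by (intro tendsto_intros fg)+
      then have "norm x \<le> ?M * norm (l *\<^sub>R x - y)"
        by (rule LIMSEQ_le) (use K(3)[OF l01(1)] fg(1) in auto)
      then show ?thesis by (simp add: scaleC_of_real)
    qed
    have surj: "\<exists>x. (x, complex_of_real l *\<^sub>C x - y) \<in> Cb" for y
    proof -
      have "y \<in> closure (Range (shifted (complex_of_real l) C))" using dense[OF l01(2)] by simp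
      then obtain h where h: "\<forall>n. h n \<in> Range (shifted (complex_of_real l) C)" "h \<longlonglongrightarrow> y" by (rule closure_seqE)
      have "\<forall>n. \<exists>x w. (x, w) \<in> C \<and> h n = l *\<^sub>R x - w"
        using h(1) unfolding shifted_def scaleC_of_real by blast
      then obtain f g where fg: "\<And>n. (f n, g n) \<in> C" "\<And>n. h n = l *\<^sub>R f n - g n" by metis
      have fd: "dist (f a) (f b) \<le> ?M * dist (h a) (h b)" for a b
      proof -
        have "l *\<^sub>R (f a - f b) - (g a - g b) = h a - h b" by (simp add: fg(2) algebra_simps)
        then show ?thesis using K(3)[OF l01(1) linear_operatorD(5)[OF lin_C fg(1)[of a] fg(1)[of b]]] by (simp add: dist_norm)
      qed
      have "Cauchy f"
      proof (rule metric_CauchyI)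
        fix e :: real assume "e > 0"
        have "Cauchy h" using h(2) by (rule LIMSEQ_imp_Cauchy)
        then obtain k where k: "\<And>a b. a \<ge> k \<Longrightarrow> b \<ge> k \<Longrightarrow> dist (h a) (h b) < e / ?M"
          using metric_CauchyD[of h "e / ?M"] \<open>e > 0\<close> M by auto
        have "dist (f a) (f b) < e" if "a \<ge> k" "b \<ge> k" for a b
        proof -
          have "?M * dist (h a) (h b) < ?M * (e / ?M)" using k[OF that] M by (rule mult_strict_left_mono)
          also have "?M * (e / ?M) = e" using M by (metis less_irrefl nonzero_mult_div_cancel_left times_divide_eq_right)
          finally show ?thesis using fd[of a b] by simp
        qed
        then show "\<exists>k. \<forall>a\<ge>k. \<forall>b\<ge>k. dist (f a) (f b) < e" by blast
      qed
      then obtain x where x: "f \<longlonglongrightarrow> x" using Cauchy_convergent_iff convergent_def by blast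
      have "(\<lambda>n. l *\<^sub>R f n - h n) \<longlonglongrightarrow> l *\<^sub>R x - y" by (intro tendsto_intros x h(2))
      moreover have "(\<lambda>n. l *\<^sub>R f n - h n) = g" by (auto simp: fg(2))
      ultimately have "g \<longlonglongrightarrow> l *\<^sub>R x - y" by simp
      then show ?thesis using Cb_I[of f g] fg(1) x by (auto simp: scaleC_of_real)
    qed
    show ?thesis using resolvent_setI[OF Cb(3) surj bound] by blast
  qed
  show ?thesis using that[of K l2] K main by (auto simp: l2_def)
qed

subsection \<open>The generator of the product semigroup\<close>

text \<open>The sector omits 0 and the value \<open>U 0\<close> is unspecified, so the identity is
  inserted there.\<close>

definition SC :: "complex \<Rightarrow> 'a \<Rightarrow> 'a" where "SC z x = (if z = 0 then x else U z x)"

lemma SC_U: "z \<in> sector \<theta> \<Longrightarrow> SC z = U z"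
  by (auto simp: SC_def sector_def)

lemma SC_analytic: "analytic_semigroup_on Y \<theta> SC"
  unfolding analytic_semigroup_on_def
proof (intro conjI)
  show "\<forall>z\<in>insert 0 (sector \<theta>). bounded_clinear_on Y (SC z)"
  proof
    fix z assume "z \<in> insert 0 (sector \<theta>)"
    then consider "z = 0" | "z \<in> sector \<theta>" by blast
    then show "bounded_clinear_on Y (SC z)"
    proof cases
      case 1
      then show ?thesis by (auto simp: SC_def bounded_clinear_on_def intro: exI[of _ 1])
    next
      case 2
      then show ?thesis using on_Y[OF U_C] SC_U by simp
    qed
  qed
  show "\<forall>x\<in>Y. SC 0 x = x" by (simp add: SC_def)
  show "\<forall>z\<in>sector \<theta>. \<forall>w\<in>sector \<theta>. \<forall>x\<in>Y. SC (z + w) x = SC z (SC w x)"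
    using SC_U sector_add[OF EA.\<theta>] U_add by simp
  show "\<forall>z\<in>sector \<theta>. \<exists>S'. bounded_clinear_on Y S' \<and>
      ((\<lambda>w. onorm_on Y (\<lambda>x. inverse (w - z) *\<^sub>C (SC w x - SC z x) - S' x)) \<longlongrightarrow> 0) (at z)"
  proof
    fix z assume z: "z \<in> sector \<theta>"
    have ev: "\<forall>\<^sub>F w in nhds z. w \<in> sector \<theta>" using open_sector[OF EA.\<theta>] z by (rule eventually_nhds_in_open)
    have "has_op_derivative Y SC (U' z) z"
      by (rule has_op_derivative_cong[OF U_deriv[OF z] eventually_mono[OF ev]]) (simp_all add: SC_U)
    moreover have "\<forall>\<^sub>F w in nhds z. bounded_clinear_on Y (SC w)"
      using ev by (rule eventually_mono) (simp add: SC_U on_Y U_C)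
    ultimately have "((\<lambda>w. onorm_on Y (\<lambda>x. inverse (w - z) *\<^sub>C (SC w x - SC z x) - U' z x)) \<longlongrightarrow> 0) (at z)"
      using has_op_derivative_iff_onorm_on[OF Y _ U'_linear[OF z]] by blast
    then show "\<exists>S'. bounded_clinear_on Y S' \<and>
      ((\<lambda>w. onorm_on Y (\<lambda>x. inverse (w - z) *\<^sub>C (SC w x - SC z x) - S' x)) \<longlongrightarrow> 0) (at z)"
      using U'_linear[OF z] by blast
  qed
  show "\<forall>x\<in>Y. \<forall>\<theta>'. 0 < \<theta>' \<and> \<theta>' < \<theta> \<longrightarrow> ((\<lambda>z. SC z x) \<longlongrightarrow> x) (at 0 within sector \<theta>')"
  proof (intro ballI allI impI)
    fix x \<theta>' assume x: "x \<in> Y" and \<theta>': "0 < \<theta>' \<and> \<theta>' < \<theta>"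
    show "((\<lambda>z. SC z x) \<longlongrightarrow> x) (at 0 within sector \<theta>')"
      by (rule Lim_transform_eventually[OF U_cont[OF x]])
         (use \<theta>' in \<open>auto simp: eventually_at_filter SC_def\<close>)
  qed
qed

text \<open>U(t) x - t y has derivative U(t) y - y, which is small near 0 because \<open>y\<close>
  is in \<open>Y\<close>. The mean value inequality on [s, h] followed by s tending to 0 bounds the
  error by a small multiple of h.\<close>

lemma Cb_quotient:
  assumes xy: "(x, y) \<in> Cb" and y: "y \<in> Y"
  shows "((\<lambda>t. (1 / t) *\<^sub>R (U (of_real t) x - x)) \<longlongrightarrow> y) (at_right 0)"
proof (rule tendstoI)
  fix e :: real assume "e > 0"
  then have e2: "e / 2 > 0" by simp
  obtain d where d: "d > 0" "\<And>t. 0 < t \<Longrightarrow> t < d \<Longrightarrow> dist (U (of_real t) y) y < e / 2"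
    using tendstoD[OF U_cont_real[OF y] e2] unfolding eventually_at_right_field by blast
  have "dist ((1 / h) *\<^sub>R (U (of_real h) x - x)) y < e" if h: "0 < h" "h < d" for h
  proof -
    define g where "g = (\<lambda>t. U (of_real t) x - t *\<^sub>R y)"
    have b: "norm (g h - g s) \<le> e / 2 * h" if s: "0 < s" "s < h" for s
    proof -
      have "norm (g h - g s) \<le> e / 2 * h - e / 2 * s"
      proof (rule vector_derivative_bound[OF s(2), where f' = "\<lambda>t. U (of_real t) y - y" and \<phi>' = "\<lambda>_. e / 2"])
        fix t assume t: "s \<le> t" "t \<le> h"
        then have t0: "t > 0" "t < d" using s h by auto
        have "((\<lambda>t. t *\<^sub>R y) has_vector_derivative y) (at t)"
          by (auto intro!: derivative_eq_intros simp: has_vector_derivative_def)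
        from has_vector_derivative_diff[OF U_vector_derivative[OF t0(1) xy] this]
        show "(g has_vector_derivative U (of_real t) y - y) (at t)" by (simp add: g_def)
        show "norm (U (of_real t) y - y) \<le> e / 2" using d(2)[OF t0] by (simp add: dist_norm)
        show "((\<lambda>t. e / 2 * t) has_vector_derivative e / 2) (at t)"
          unfolding has_real_derivative_iff_has_vector_derivative[symmetric] by (auto intro!: derivative_eq_intros)
      qed
      moreover have "0 \<le> e / 2 * s" using e2 s by simp
      ultimately show ?thesis by linarith
    qed
    have "(g \<longlongrightarrow> x - 0 *\<^sub>R y) (at_right 0)"
      unfolding g_def by (intro tendsto_intros U_cont_real Cb_Y[OF xy])
    then have "((\<lambda>s. norm (g h - g s)) \<longlongrightarrow> norm (g h - x)) (at_right 0)" by (intro tendsto_intros) simp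
    moreover have "\<forall>\<^sub>F s in at_right 0. norm (g h - g s) \<le> e / 2 * h"
      unfolding eventually_at_right_field using b h by (intro exI[of _ h]) auto
    ultimately have "norm (g h - x) \<le> e / 2 * h" by (intro tendsto_upperbound[OF _ _ trivial_limit_at_right_real])
    moreover have "(1 / h) *\<^sub>R (U (of_real h) x - x) - y = (1 / h) *\<^sub>R (g h - x)"
      using h by (simp add: g_def algebra_simps)
    ultimately have "norm ((1 / h) *\<^sub>R (U (of_real h) x - x) - y) \<le> e / 2"
      using h by (simp add: divide_le_eq)
    then show ?thesis using \<open>e > 0\<close> by (simp add: dist_norm)
  qed
  then show "\<forall>\<^sub>F t in at_right 0. dist ((1 / t) *\<^sub>R (U (of_real t) x - x)) y < e"
    unfolding eventually_at_right_field using d(1) by blast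
qed

text \<open>For x in the domain of the generator with value y, let R be the resolvent of
  \<open>Cb\<close> at l. The quotient at R x tends to l R x - x by \<open>Cb_quotient\<close>, and
  to R y because R commutes with \<open>U\<close>. Hence x = R (l x - y), which puts the pair of x
  and y into \<open>Cb\<close>.\<close>

lemma SC_generator:
  assumes l: "l \<in> resolvent_set Cb"
  shows "generator_on Y SC = part_in_closure Cb"
proof -
  have q: "((\<lambda>t. (1 / t) *\<^sub>R (SC (complex_of_real t) x - x)) \<longlongrightarrow> y) (at_right 0) \<longleftrightarrow>
      ((\<lambda>t. (1 / t) *\<^sub>R (U (complex_of_real t) x - x)) \<longlongrightarrow> y) (at_right 0)" for x y
    by (rule filterlim_cong) (auto simp: eventually_at_filter SC_def)
  note Rl = resolventD[OF l]
  have "(x, y) \<in> Cb" if x: "x \<in> Y" and y: "y \<in> Y"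
    and lim: "((\<lambda>t. (1 / t) *\<^sub>R (U (complex_of_real t) x - x)) \<longlongrightarrow> y) (at_right 0)" for x y
  proof -
    let ?R = "resolvent Cb l"
    interpret R: bounded_linear ?R by (rule bounded_clinear_UNIV_bounded_linear[OF Rl(3)])
    have "?R x \<in> Y" by (rule Cb_Y[OF Rl(2)])
    then have "l *\<^sub>C ?R x - x \<in> Y" using Y' x by blast
    from Cb_quotient[OF Rl(2) this]
    have "((\<lambda>t. (1 / t) *\<^sub>R (U (of_real t) (?R x) - ?R x)) \<longlongrightarrow> l *\<^sub>C ?R x - x) (at_right 0)" .
    moreover have "((\<lambda>t. (1 / t) *\<^sub>R (U (of_real t) (?R x) - ?R x)) \<longlongrightarrow> ?R y) (at_right 0)"
    proof (rule Lim_transform_eventually[OF R.tendsto[OF lim]])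
      have "?R ((1 / t) *\<^sub>R (U (complex_of_real t) x - x)) = (1 / t) *\<^sub>R (U (of_real t) (?R x) - ?R x)" if "t > 0" for t
        using preserves_resolvent_commute[OF preserves_Cb[OF U_C[OF real_sector[OF that]]] l] by (simp add: R.scaleR R.diff)
      then show "\<forall>\<^sub>F t in at_right 0. ?R ((1 / t) *\<^sub>R (U (complex_of_real t) x - x)) = (1 / t) *\<^sub>R (U (of_real t) (?R x) - ?R x)"
        by (auto simp: eventually_at_filter)
    qed
    ultimately have "l *\<^sub>C ?R x - x = ?R y" by (rule tendsto_unique[OF trivial_limit_at_right_real])
    then have "?R (l *\<^sub>C x - y) = x" by (simp add: R.diff bounded_clinear_onD(3)[OF Rl(3)] algebra_simps)
    then show ?thesis using Rl(2)[of "l *\<^sub>C x - y"] by simp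
  qed
  then show ?thesis
    unfolding generator_on_def part_in_closure_def Domain_Cb q
    using Cb_quotient Cb_Y by blast
qed

theorem closure_condition:
  assumes dense: "\<And>l. l \<ge> l1 \<Longrightarrow> closure (Range (shifted (complex_of_real l) C)) = UNIV"
    and p: "0 < 1 / p" "1 / p < \<delta>"
  shows "analytic_resolvent_condition Cb p"
proof -
  obtain K l0 where K: "K > 0" "l0 > 0" "\<And>l. l \<ge> l0 \<Longrightarrow> complex_of_real l \<in> resolvent_set Cb"
    "\<And>l x. l \<ge> l0 \<Longrightarrow> norm (resolvent Cb (complex_of_real l) x) \<le> K * l powr (- \<delta>) * norm x"
    using resolvent_Cb[OF dense] by blast
  have "generates_analytic_semigroup_on (closure (Domain Cb)) (part_in_closure Cb)"
    unfolding generates_analytic_semigroup_on_def Domain_Cb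
    using EA.\<theta> SC_analytic SC_generator[OF K(3)[OF order_refl]] by blast
  moreover have "(\<lambda>l::real. onorm (resolvent Cb (complex_of_real l))) \<in> O[at_top](\<lambda>l. l powr (- 1 / p))"
  proof (rule landau_o.bigI[OF K(1)])
    show "\<forall>\<^sub>F l in at_top. norm (onorm (resolvent Cb (complex_of_real l))) \<le> K * norm (l powr (- 1 / p))"
      \<comment> \<open>For \<open>l \<ge> 1\<close> the stronger decay
        \<open>l powr (- \<delta>)\<close> is below \<open>l powr (- 1 / p)\<close>.\<close>
      using eventually_ge_at_top[of "max 1 l0"]
    proof eventually_elim
      case (elim l)
      then have l: "l \<ge> 1" "l \<ge> l0" by auto
      have "onorm (resolvent Cb (complex_of_real l)) \<le> K * l powr (- \<delta>)"
        using K(1) K(4)[OF l(2)] by (intro onorm_bound) auto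
      also have "\<dots> \<le> K * l powr (- 1 / p)"
        using K(1) l(1) p by (intro mult_left_mono powr_mono) auto
      finally show ?case
        using onorm_pos_le[OF bounded_clinear_UNIV_bounded_linear[OF resolventD(3)[OF K(3)[OF l(2)]]]] by simp
    qed
  qed
  moreover have "\<forall>l>l0. complex_of_real l \<in> resolvent_set Cb" using K(3) by simp
  ultimately show ?thesis unfolding analytic_resolvent_condition_def by blast
qed

end

theorem corollary2p17:
  fixes A B :: "'a::cbanach operator" and pA pB :: real
  assumes "closed_operator A" and "closed_operator B"
    and "resolvent_commuting A B"
    and "1 \<le> pA" and "analytic_resolvent_condition A pA"
    and "1 \<le> pB" and "analytic_resolvent_condition B pB"
    and "\<exists>l0::real. \<forall>l\<ge>l0. closure (Range (shifted (complex_of_real l) (operator_sum A B))) = UNIV"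
    and "1 / pA + 1 / pB > 1"
  shows "closable (operator_sum A B) \<and>
    (\<forall>p::real. 1 < p \<and> 0 < 1 / p \<and> 1 / p < 1 / pA + 1 / pB - 1 \<and> 1 / pA + 1 / pB - 1 \<le> 1 \<longrightarrow>
      analytic_resolvent_condition (operator_closure (operator_sum A B)) p)"
proof -
  obtain \<theta>A TA TA' where EA: "extended_semigroup A (1 / pA) \<theta>A TA TA'"
    using analytic_resolvent_condition_extended[OF assms(1,4,5)] by blast
  obtain \<theta>B TB TB' where EB: "extended_semigroup B (1 / pB) \<theta>B TB TB'"
    using analytic_resolvent_condition_extended[OF assms(2,6,7)] by blast
  define \<theta> where "\<theta> = min \<theta>A \<theta>B"
  have \<theta>: "0 < \<theta>" "\<theta> \<le> \<theta>A" "\<theta> \<le> \<theta>B"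
    using extended_semigroup.\<theta>(1)[OF EA] extended_semigroup.\<theta>(1)[OF EB] by (auto simp: \<theta>_def)
  obtain \<omega>A where A: "\<And>l. l > \<omega>A \<Longrightarrow> complex_of_real l \<in> resolvent_set A"
    using assms(5) unfolding analytic_resolvent_condition_def by blast
  obtain \<omega>B where B: "\<And>l. l > \<omega>B \<Longrightarrow> complex_of_real l \<in> resolvent_set B"
    using assms(7) unfolding analytic_resolvent_condition_def by blast
  \<comment> \<open>The resolvent sets are known to contain only points strictly beyond the two
    thresholds, hence the added 1.\<close>
  define m where "m = complex_of_real (max \<omega>A \<omega>B + 1)"
  have m: "m \<in> resolvent_set A" "m \<in> resolvent_set B" unfolding m_def by (rule A, simp) (rule B, simp)
  have comm: "resolvent A m (resolvent B m x) = resolvent B m (resolvent A m x)" for x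
    using assms(3) m unfolding resolvent_commuting_def comp_def by (metis IntI)
  interpret EA: extended_semigroup A "1 / pA" \<theta> TA TA' by (rule extended_semigroup_mono[OF EA \<theta>(1,2)])
  interpret EB: extended_semigroup B "1 / pB" \<theta> TB TB' by (rule extended_semigroup_mono[OF EB \<theta>(1,3)])
  interpret operator_pair A B "1 / pA" "1 / pB" \<theta> TA TA' TB TB' m
    by unfold_locales (use m comm assms in auto)
  obtain l1 where "\<And>l. l \<ge> l1 \<Longrightarrow> closure (Range (shifted (complex_of_real l) (operator_sum A B))) = UNIV"
    using assms(8) by blast
  from closure_condition[unfolded C_def Cb_def, OF this] closable_C show ?thesis by (simp add: C_def)
qed

end
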